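(* Let $V$ be a valuation domain. The following conditions are equivalent. (1) $V$ is a Gröbner ring. (2) $\dim V\leq 1$, where $\dim$ denotes Krull dimension. (3) For every $n\geq 1$, every rational monomial order $\prec$ on $V[X_1,\ldots,X_n]$, and every finitely generated ideal $I\subseteq V[X_1,\ldots,X_n]$, the ideal $\operatorname{LT}_\prec(I)$ is finitely generated.
   Context: A valuation ring is a commutative ring with identity in which any two elements are comparable under divisibility; a valuation domain is a valuation ring that is an integral domain. $\mathbb N=\{0,1,2,\ldots\}$, $X^\alpha=X_1^{\alpha_1}\cdots X_n^{\alpha_n}$ for $\alpha\in\mathbb N^n$. Monomial order: a total order $\prec$ on the monomials $X^\alpha$ such that $1\preceq X^\alpha$ for all $\alpha$; $X^\alpha\prec X^\beta$ implies $X^{\alpha+\gamma}\prec X^{\beta+\gamma}$ for all $\gamma\in\mathbb N^n$; and every nonempty set of monomials has a least element. For $u,v\in\mathbb R^m$, $u<_{\mathrm{lex}}v$ means that the first nonzero coordinate of $v-u$ exists and is positive. A monomial order is rational if there are a finite $m$ and $Q\in\mathbb Q^{m\times n}$ with $X^\alpha\prec X^\beta\Longleftrightarrow Q\alpha<_{\mathrm{lex}}Q\beta$ for all $\alpha,\beta\in\mathbb N^n$. Leading terms include the coefficient: $\operatorname{LT}_\prec(f)=c_{\alpha_0}X^{\alpha_0}$, where $X^{\alpha_0}$ is the $\prec$-largest monomial in the support of $f=\sum_\alpha c_\alpha X^\alpha\ne0$. For an ideal $I$, $\operatorname{LT}_\prec(I)=\langle\operatorname{LT}_\prec(f)\mid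 0\neq f\in I\rangle$. Gröbner ring: a commutative ring $R$ such that for every $n\ge1$ and every finitely generated ideal $I\subseteq R[X_1,\ldots,X_n]$, the ideal $\operatorname{LT}_{\prec_{\mathrm{lex}}}(I)$ is finitely generated, where $\prec_{\mathrm{lex}}$ is the lexicographic order with $X_1\succ\cdots\succ X_n$ ($X^a\prec_{\mathrm{lex}}X^b$ if and only if, at the first index $i$ with $a_i\neq b_i$, one has $a_i<b_i$). *)

theory Defs
  imports
    "HOL-Algebra.Ideal"
    "HOL-Algebra.Algebraic_Closure_Type"
    "HOL-Library.Poly_Mapping"
    "HOL-Library.Extended_Nat"
    "Jordan_Normal_Form.Matrix"
begin

text \<open>
  Coefficient rings are types of class \<^class>\<open>comm_ring_1\<close>; definitions about the ring itself take
  its type as an argument of type \<^typ>\<open>'a itself\<close>. Ideals are those of HOL-Algebra, reached from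
  type classes through \<^const>\<open>ring_of_type_algebra\<close>.
\<close>

definition valuation_ring :: "'a::comm_ring_1 itself \<Rightarrow> bool" where
  "valuation_ring _ \<longleftrightarrow> (\<forall>a b :: 'a. a dvd b \<or> b dvd a)"

definition krull_dim :: "'a::comm_ring_1 itself \<Rightarrow> enat" where
  "krull_dim _ = Sup {enat k | k. \<exists>P :: nat \<Rightarrow> 'a set.
     (\<forall>i\<le>k. primeideal (P i) ring_of_type_algebra) \<and> (\<forall>i<k. P i \<subset> P (Suc i))}"

definition fin_gen_ideal :: "('r, 'm) ring_scheme \<Rightarrow> 'r set \<Rightarrow> bool" where
  "fin_gen_ideal R I \<longleftrightarrow> (\<exists>S. finite S \<and> S \<subseteq> carrier R \<and> I = genideal R S)"

text \<open>
  The variables \<open>X\<^sub>1, \<dots>, X\<^sub>n\<close> are indexed by \<open>0, \<dots>, n - 1\<close>. A monomial is identified with its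
  exponent \<open>\<alpha>\<close>, and a polynomial is a finitely supported map from exponents to coefficients,
  multiplied by convolution; the ring in \<open>n\<close> variables is a subring of the ring in countably many.
\<close>

type_synonym expo = "nat \<Rightarrow>\<^sub>0 nat"
type_synonym 'a mpol = "expo \<Rightarrow>\<^sub>0 'a"

definition expos :: "nat \<Rightarrow> expo set" where
  "expos n = {\<alpha>. Poly_Mapping.keys \<alpha> \<subseteq> {..<n}}"

definition mpoly_ring :: "nat \<Rightarrow> 'a::comm_ring_1 mpol ring" where
  "mpoly_ring n = ring_of_type_algebra\<lparr>carrier := {p. Poly_Mapping.keys p \<subseteq> expos n}\<rparr>"

text \<open>
  Orders are given by their strict part. Only the values on \<^term>\<open>expos n\<close> matter.
\<close>

definition monomial_order :: "nat \<Rightarrow> (expo \<Rightarrow> expo \<Rightarrow> bool) \<Rightarrow> bool" where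
  "monomial_order n ord \<longleftrightarrow>
     irreflp_on (expos n) ord \<and> transp_on (expos n) ord \<and> totalp_on (expos n) ord \<and>
     (\<forall>\<alpha>\<in>expos n. \<alpha> = 0 \<or> ord 0 \<alpha>) \<and>
     (\<forall>\<alpha>\<in>expos n. \<forall>\<beta>\<in>expos n. \<forall>\<gamma>\<in>expos n. ord \<alpha> \<beta> \<longrightarrow> ord (\<alpha> + \<gamma>) (\<beta> + \<gamma>)) \<and>
     (\<forall>A. A \<subseteq> expos n \<and> A \<noteq> {} \<longrightarrow> (\<exists>\<alpha>\<in>A. \<forall>\<beta>\<in>A. \<beta> = \<alpha> \<or> ord \<alpha> \<beta>))"

definition lex_less :: "'b::linordered_field vec \<Rightarrow> 'b vec \<Rightarrow> bool" where
  "lex_less u v \<longleftrightarrow>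
     (\<exists>i<dim_vec (v - u). (\<forall>k<i. (v - u) $ k = 0) \<and> (v - u) $ i > 0)"

definition expo_vec :: "nat \<Rightarrow> expo \<Rightarrow> rat vec" where
  "expo_vec n \<alpha> = vec n (\<lambda>j. of_nat (Poly_Mapping.lookup \<alpha> j))"

definition rational_monomial_order :: "nat \<Rightarrow> (expo \<Rightarrow> expo \<Rightarrow> bool) \<Rightarrow> bool" where
  "rational_monomial_order n ord \<longleftrightarrow> monomial_order n ord \<and>
     (\<exists>m. \<exists>Q \<in> carrier_mat m n. \<forall>\<alpha>\<in>expos n. \<forall>\<beta>\<in>expos n.
        ord \<alpha> \<beta> \<longleftrightarrow> lex_less (Q *\<^sub>v expo_vec n \<alpha>) (Q *\<^sub>v expo_vec n \<beta>))"

definition lex_order :: "expo \<Rightarrow> expo \<Rightarrow> bool" where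
  "lex_order \<alpha> \<beta> \<longleftrightarrow>
     (\<exists>i. (\<forall>k<i. Poly_Mapping.lookup \<alpha> k = Poly_Mapping.lookup \<beta> k) \<and>
        Poly_Mapping.lookup \<alpha> i < Poly_Mapping.lookup \<beta> i)"

text \<open>Meaningful only for nonzero \<open>p\<close> and for \<open>ord\<close> total on the support of \<open>p\<close>.\<close>

definition lead_expo :: "(expo \<Rightarrow> expo \<Rightarrow> bool) \<Rightarrow> 'a::comm_ring_1 mpol \<Rightarrow> expo" where
  "lead_expo ord p = 
     (THE \<alpha>. \<alpha> \<in> Poly_Mapping.keys p \<and> (\<forall>\<beta>\<in>Poly_Mapping.keys p. \<beta> = \<alpha> \<or> ord \<beta> \<alpha>))"

definition lead_term :: "(expo \<Rightarrow> expo \<Rightarrow> bool) \<Rightarrow> 'a::comm_ring_1 mpol \<Rightarrow> 'a mpol" where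
  "lead_term ord p = Poly_Mapping.single (lead_expo ord p) (Poly_Mapping.lookup p (lead_expo ord p))"

definition lead_ideal ::
    "nat \<Rightarrow> (expo \<Rightarrow> expo \<Rightarrow> bool) \<Rightarrow> 'a::comm_ring_1 mpol set \<Rightarrow> 'a mpol set" where
  "lead_ideal n ord I = genideal (mpoly_ring n) {lead_term ord f | f. f \<in> I \<and> f \<noteq> 0}"

definition groebner_ring :: "'a::comm_ring_1 itself \<Rightarrow> bool" where
  "groebner_ring _ \<longleftrightarrow>
     (\<forall>n\<ge>1. \<forall>I :: 'a mpol set. ideal I (mpoly_ring n) \<and> fin_gen_ideal (mpoly_ring n) I \<longrightarrow>
        fin_gen_ideal (mpoly_ring n) (lead_ideal n lex_order I))"

lemma expos_add: "\<alpha> \<in> expos n \<Longrightarrow> \<beta> \<in> expos n \<Longrightarrow> \<alpha> + \<beta> \<in> expos n"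
  using Poly_Mapping.keys_add[of \<alpha> \<beta>] unfolding expos_def by blast

lemma cring_mpoly_ring: "cring (mpoly_ring n :: 'a::comm_ring_1 mpol ring)"
proof -
  let ?C = "{p :: 'a mpol. Poly_Mapping.keys p \<subseteq> expos n}"
  have add: "p + q \<in> ?C" if "p \<in> ?C" "q \<in> ?C" for p q
    using that Poly_Mapping.keys_add[of p q] by blast
  have mult: "p * q \<in> ?C" if "p \<in> ?C" "q \<in> ?C" for p q
    using that Poly_Mapping.keys_mult[of p q] expos_add by blast
  have one: "1 \<in> ?C"
    by (simp add: expos_def)
  have neg': "\<exists>y. Poly_Mapping.keys y \<subseteq> expos n \<and> x + y = 0"
    if "Poly_Mapping.keys x \<subseteq> expos n" for x :: "'a mpol"
    using that by (intro exI[of _ "- x"]) simp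
  show ?thesis
    by (intro cringI abelian_groupI comm_monoidI)
       (use add mult one neg' in \<open>auto simp: mpoly_ring_def ring_of_type_algebra_def algebra_simps\<close>)
qed

end

theory Submission
  imports Defs
begin

text \<open>
  Let \<open>V\<close> be a valuation domain and \<open>R\<^sub>n\<close> the polynomial ring in \<open>n\<close> variables over \<open>V\<close>. That \<open>V\<close> has
  dimension at most one means that \<open>V\<close> is archimedean: every nonzero element divides a power of every
  nonunit (\<open>krull_dim_le_1_imp_archimedean\<close>, \<open>archimedean_imp_krull_dim_le_1\<close>).

  If \<open>V\<close> is not archimedean, some \<open>a \<noteq> 0\<close> is divisible by all powers of a nonunit \<open>b\<close>. The constants in
  the ideal generated by \<open>a\<close> and \<open>1 + b X\<close> form an ideal of \<open>V\<close> that is closed under division by \<open>b\<close>,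
  so it is not principal. Since it is the constant part of the leading ideal, the latter is not
  finitely generated either (\<open>lead_ideal_lex_not_fin_gen\<close>).

  Let \<open>V\<close> be archimedean. An order given by a rational matrix compares finitely many integer weights
  one after the other, so the leading ideal arises from \<open>I\<close> by passing successively to the initial
  ideals for these weights (\<open>lex_initial_Cons\<close>, \<open>lead_ideal_eq_lex_initial\<close>). The initial ideal for one
  weight is the homogenization of \<open>I\<close>, with the homogenizing variable \<open>t\<close> set to zero, and the
  homogenization is the saturation \<open>J : t\<^sup>\<infinity>\<close> of the ideal \<open>J\<close> generated by the homogenized generators
  (\<open>initial_fgm\<close>). Everything thus rests on the fact that \<open>I : f\<^sup>\<infinity>\<close> is finitely generated when \<open>I\<close> is
  (\<open>saturation_at_polynomial_fgm\<close>).

  The first ingredient holds for every valuation domain: a submodule of a free \<open>R\<^sub>n\<close>-module of finite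
  rank that is saturated with respect to \<open>V\<close> is finitely generated (\<open>saturated_fgm\<close>). Modules of
  relations are saturated, so \<open>R\<^sub>n\<close> is coherent (\<open>fgm_preimage\<close>). This also reduces the claim on
  \<open>I : f\<^sup>\<infinity>\<close> to the case where \<open>I\<close> contains a constant \<open>c \<noteq> 0\<close>.

  The second ingredient is that on a finitely presented \<open>R\<^sub>n\<close>-module killed by a constant \<open>c \<noteq> 0\<close> the
  torsion of an endomorphism \<open>f\<close> is bounded, that is, killed by one power of \<open>f\<close> (\<open>bounded_torsion\<close>). The
  proof is an induction on \<open>n\<close>. The endomorphism satisfies a polynomial equation over \<open>R\<^sub>n\<close>
  with a coefficient that is primitive, that is, has a unit among its own coefficients. Polynomials
  without a unit coefficient act nilpotently because \<open>V\<close> is archimedean, and it follows that a fixed power of \<open>f\<close> sends the torsion to elements that are killed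
  by primitive polynomials (\<open>torsion_generic_bound\<close>). The localization of \<open>R\<^sub>n\<close> at the primitive polynomials
  is a valuation domain, and therefore a single primitive \<open>g\<close> kills all these elements
  (\<open>primitive_saturation\<close>). The kernel of \<open>g\<close> is finitely presented by coherence. After a change of
  variables \<open>g\<close> may be taken monic in the last variable, so this kernel is finitely presented over
  \<open>R\<^sub>n\<^sub>-\<^sub>1\<close> (\<open>presentation_primitive_descent\<close>) and the induction hypothesis applies to it.
\<close>

section \<open>Polynomials in the first variables and modules over them\<close>

abbreviation supp :: "('b \<Rightarrow>\<^sub>0 'c::zero) \<Rightarrow> 'b set" where
  "supp \<equiv> Poly_Mapping.keys"

abbreviation sgl :: "'b \<Rightarrow> 'c \<Rightarrow> ('b \<Rightarrow>\<^sub>0 'c::zero)" where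
  "sgl \<equiv> Poly_Mapping.single"

abbreviation lk :: "('b \<Rightarrow>\<^sub>0 'c::zero) \<Rightarrow> 'b \<Rightarrow> 'c" where
  "lk \<equiv> Poly_Mapping.lookup"

definition polys :: "nat \<Rightarrow> 'a::comm_ring_1 mpol set" where
  "polys n = {p. supp p \<subseteq> expos n}"

definition const :: "'a::comm_ring_1 \<Rightarrow> 'a mpol" where
  "const c = sgl 0 c"

definition mpow :: "expo \<Rightarrow> 'a::comm_ring_1 mpol" where
  "mpow \<alpha> = sgl \<alpha> 1"

lift_definition lo :: "nat \<Rightarrow> expo \<Rightarrow> expo" is
  "\<lambda>n f i. if i < n then f i else 0"
  by (rule finite_subset) auto

lift_definition hi :: "nat \<Rightarrow> expo \<Rightarrow> expo" is
  "\<lambda>n f i. if i < n then 0 else f i"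
  by (rule finite_subset) auto

lemma lookup_lo [simp]: "lk (lo n \<gamma>) i = (if i < n then lk \<gamma> i else 0)"
  by transfer simp

lemma lookup_hi [simp]: "lk (hi n \<gamma>) i = (if i < n then 0 else lk \<gamma> i)"
  by transfer simp

lemma lo_add [simp]: "lo n (\<alpha> + \<beta>) = lo n \<alpha> + lo n \<beta>"
  by (rule poly_mapping_eqI) (simp add: lookup_add)

lemma hi_add [simp]: "hi n (\<alpha> + \<beta>) = hi n \<alpha> + hi n \<beta>"
  by (rule poly_mapping_eqI) (simp add: lookup_add)

lemma lo_plus_hi: "lo n \<gamma> + hi n \<gamma> = \<gamma>"
  by (rule poly_mapping_eqI) (simp add: lookup_add)

lemma lo_0 [simp]: "lo n 0 = 0" and hi_0 [simp]: "hi n 0 = 0"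
  by (rule poly_mapping_eqI, simp)+

lemma in_expos_iff: "\<alpha> \<in> expos n \<longleftrightarrow> (\<forall>i\<ge>n. lk \<alpha> i = 0)"
  unfolding expos_def by (auto simp: in_keys_iff subset_iff) (metis not_le_imp_less less_numeral_extra(3))

lemma in_expos_iff_hi: "\<alpha> \<in> expos n \<longleftrightarrow> hi n \<alpha> = 0"
  unfolding in_expos_iff poly_mapping_eq_iff fun_eq_iff by (auto simp: not_less)

lemma in_expos_iff_lo: "\<alpha> \<in> expos n \<longleftrightarrow> lo n \<alpha> = \<alpha>"
  using lo_plus_hi[of n \<alpha>] unfolding in_expos_iff_hi by (metis add.right_neutral add_left_cancel)

lemma zero_in_expos [simp]: "0 \<in> expos n"
  by (simp add: in_expos_iff)

lemma lo_in_expos [simp]: "lo n \<gamma> \<in> expos n"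
  by (simp add: in_expos_iff)

lemma hi_idem [simp]: "hi n (hi n \<gamma>) = hi n \<gamma>"
  by (rule poly_mapping_eqI) simp

lemma lo_idem [simp]: "lo n (lo n \<gamma>) = lo n \<gamma>"
  by (rule poly_mapping_eqI) simp

lemma lo_hi [simp]: "lo n (hi n \<gamma>) = 0" and hi_lo [simp]: "hi n (lo n \<gamma>) = 0"
  by (rule poly_mapping_eqI, simp)+

lemma mpol_sum_single: "(p :: 'a::comm_ring_1 mpol) = (\<Sum>\<gamma>\<in>supp p. sgl \<gamma> (lk p \<gamma>))"
  by (rule poly_mapping_eqI)
    (auto simp: lookup_sum lookup_single when_def in_keys_iff sum.delta)

lemma lookup_single_mult:
  "lk (sgl \<alpha> c * p :: 'a::comm_ring_1 mpol) (\<alpha> + \<gamma>) = c * lk p \<gamma>"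
proof -
  have "sgl \<alpha> c * p = (\<Sum>\<delta>\<in>supp p. sgl (\<alpha> + \<delta>) (c * lk p \<delta>))"
    by (subst (1) mpol_sum_single[of p]) (simp add: sum_distrib_left mult_single)
  also have "lk \<dots> (\<alpha> + \<gamma>) = c * lk p \<gamma>"
    by (auto simp: lookup_sum lookup_single when_def in_keys_iff sum.delta)
  finally show ?thesis .
qed

lemma lookup_const_mult [simp]: "lk (const c * p) \<gamma> = c * lk p \<gamma>"
  using lookup_single_mult[of 0 c p \<gamma>] by (simp add: const_def)

lemma keys_single_mult: "supp (sgl \<alpha> c * p :: 'a::comm_ring_1 mpol) \<subseteq> (+) \<alpha> ` supp p"
  using Poly_Mapping.keys_mult[of "sgl \<alpha> c" p] by (auto split: if_splits)

lemma const_mult: "const (a * b) = const a * const b"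
  by (simp add: const_def mult_single)

lemma const_add: "const (a + b) = const a + const b"
  by (simp add: const_def single_add)

lemma const_0 [simp]: "const 0 = 0" and const_1 [simp]: "const 1 = 1"
  by (simp_all add: const_def)

lemma const_eq_0_iff [simp]: "const c = 0 \<longleftrightarrow> c = 0"
  by (metis const_def lookup_single_eq lookup_zero single_zero)

lemma const_power: "const (a ^ k) = const a ^ k"
  by (induction k) (simp_all add: const_mult)

lemma mpow_add: "mpow (\<alpha> + \<beta>) = mpow \<alpha> * mpow \<beta>"
  by (simp add: mpow_def mult_single)

lemma mpow_0 [simp]: "mpow 0 = 1"
  by (simp add: mpow_def)

lemma single_eq_const_mpow: "sgl \<alpha> c = const c * mpow \<alpha>"
  by (simp add: const_def mpow_def mult_single)

section \<open>Subrings and free modules\<close>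

lemma polys_add: "p \<in> polys n \<Longrightarrow> q \<in> polys n \<Longrightarrow> p + q \<in> polys n"
  unfolding polys_def using Poly_Mapping.keys_add[of p q] by auto

lemma polys_uminus: "p \<in> polys n \<Longrightarrow> - p \<in> polys n"
  unfolding polys_def by simp

lemma polys_diff: "p \<in> polys n \<Longrightarrow> q \<in> polys n \<Longrightarrow> p - q \<in> polys n"
  using polys_add[of p n "- q"] polys_uminus[of q n] by simp

lemma polys_mult: "p \<in> polys n \<Longrightarrow> q \<in> polys n \<Longrightarrow> p * q \<in> polys n"
  unfolding polys_def using Poly_Mapping.keys_mult[of p q] expos_add by blast

lemma polys_0 [simp]: "0 \<in> polys n" and polys_1 [simp]: "1 \<in> polys n"
  by (simp_all add: polys_def)

lemma polys_single [simp]: "\<alpha> \<in> expos n \<Longrightarrow> sgl \<alpha> c \<in> polys n"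
  by (simp add: polys_def)

lemma polys_const [simp]: "const c \<in> polys n"
  by (simp add: const_def)

lemma polys_mpow [simp]: "\<alpha> \<in> expos n \<Longrightarrow> mpow \<alpha> \<in> polys n"
  by (simp add: mpow_def)

lemma polys_power: "p \<in> polys n \<Longrightarrow> p ^ k \<in> polys n"
  by (induction k) (simp_all add: polys_mult)

lemma polys_sum: "(\<And>i. i \<in> I \<Longrightarrow> f i \<in> polys n) \<Longrightarrow> sum f I \<in> polys n"
  by (induction I rule: infinite_finite_induct) (auto intro: polys_add)

lemma polys_prod: "(\<And>i. i \<in> I \<Longrightarrow> f i \<in> polys n) \<Longrightarrow> prod f I \<in> polys n"
  by (induction I rule: infinite_finite_induct) (auto intro: polys_mult)

lemma expos_mono: "m \<le> n \<Longrightarrow> expos m \<subseteq> expos n"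
  by (auto simp: in_expos_iff)

lemma polys_mono: "m \<le> n \<Longrightarrow> polys m \<subseteq> polys n"
  unfolding polys_def using expos_mono by blast

definition submod :: "nat \<Rightarrow> 'a::comm_ring_1 mpol set \<Rightarrow> bool" where
  "submod n P \<longleftrightarrow> 0 \<in> P \<and> (\<forall>p\<in>P. \<forall>q\<in>P. p + q \<in> P) \<and> (\<forall>a\<in>polys n. \<forall>p\<in>P. a * p \<in> P)"

inductive_set rspan :: "nat \<Rightarrow> 'a::comm_ring_1 mpol set \<Rightarrow> 'a mpol set" for n S where
  rspan_zero [simp]: "0 \<in> rspan n S"
| rspan_step: "a \<in> polys n \<Longrightarrow> s \<in> S \<Longrightarrow> p \<in> rspan n S \<Longrightarrow> a * s + p \<in> rspan n S"

definition fgm :: "nat \<Rightarrow> 'a::comm_ring_1 mpol set \<Rightarrow> bool" where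
  "fgm n P \<longleftrightarrow> (\<exists>S. finite S \<and> P = rspan n S)"

lemma submodI:
  assumes "0 \<in> P" "\<And>p q. p \<in> P \<Longrightarrow> q \<in> P \<Longrightarrow> p + q \<in> P" "\<And>a p. a \<in> polys n \<Longrightarrow> p \<in> P \<Longrightarrow> a * p \<in> P"
  shows "submod n P"
  using assms unfolding submod_def by blast

lemma submodD:
  assumes "submod n P"
  shows "0 \<in> P" "\<And>p q. p \<in> P \<Longrightarrow> q \<in> P \<Longrightarrow> p + q \<in> P" "\<And>a p. a \<in> polys n \<Longrightarrow> p \<in> P \<Longrightarrow> a * p \<in> P"
    "\<And>p. p \<in> P \<Longrightarrow> - p \<in> P" "\<And>p q. p \<in> P \<Longrightarrow> q \<in> P \<Longrightarrow> p - q \<in> P"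
proof -
  show 1: "0 \<in> P" "\<And>p q. p \<in> P \<Longrightarrow> q \<in> P \<Longrightarrow> p + q \<in> P" "\<And>a p. a \<in> polys n \<Longrightarrow> p \<in> P \<Longrightarrow> a * p \<in> P"
    using assms unfolding submod_def by blast+
  show 2: "- p \<in> P" if "p \<in> P" for p
    using 1(3)[of "- 1" p, OF polys_uminus[OF polys_1] that] by simp
  show "p - q \<in> P" if "p \<in> P" "q \<in> P" for p q
    using 1(2)[OF that(1) 2[OF that(2)]] by simp
qed

lemma submod_sum: "submod n P \<Longrightarrow> (\<And>i. i \<in> I \<Longrightarrow> f i \<in> P) \<Longrightarrow> sum f I \<in> P"
  by (induction I rule: infinite_finite_induct) (auto intro: submodD)

lemma submod_rspan: "submod n (rspan n S)"
proof (rule submodI)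
  show "p + q \<in> rspan n S" if "p \<in> rspan n S" "q \<in> rspan n S" for p q
    using that by (induction p rule: rspan.induct) (simp_all add: add.assoc rspan_step)
  show "a * p \<in> rspan n S" if "p \<in> rspan n S" "a \<in> polys n" for a p
    using that by (induction p rule: rspan.induct)
      (simp_all add: distrib_left rspan_step polys_mult mult.assoc[symmetric])
qed simp

lemma rspan_base: "s \<in> S \<Longrightarrow> s \<in> rspan n S"
  using rspan_step[of 1 n s S 0] by simp

lemma rspan_least: "submod n P \<Longrightarrow> S \<subseteq> P \<Longrightarrow> rspan n S \<subseteq> P"
proof
  fix p assume "submod n P" "S \<subseteq> P" "p \<in> rspan n S"
  from this(3,1,2) show "p \<in> P"
    by (induction p rule: rspan.induct) (auto intro: submodD)
qed

lemma rspan_mono: "S \<subseteq> T \<Longrightarrow> rspan n S \<subseteq> rspan n T"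
  by (rule rspan_least[OF submod_rspan]) (auto intro: rspan_base)

lemma fgmI: "finite S \<Longrightarrow> submod n P \<Longrightarrow> S \<subseteq> P \<Longrightarrow> P \<subseteq> rspan n S \<Longrightarrow> fgm n P"
  unfolding fgm_def using rspan_least by blast

lemma fgm_submod: "fgm n P \<Longrightarrow> submod n P"
  unfolding fgm_def using submod_rspan by blast

lemma submod_polys: "submod n (polys n)"
  by (rule submodI) (auto intro: polys_add polys_mult)

text \<open>
  The free module over \<^term>\<open>polys n\<close> whose basis consists of the monomials with exponents in
  \<open>B\<close>, exponents that avoid the first \<open>n\<close> variables. Coding vectors as polynomials keeps all
  modules inside one type, whatever their rank and their ring of scalars.
\<close>

definition free :: "nat \<Rightarrow> expo set \<Rightarrow> 'a::comm_ring_1 mpol set" where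
  "free n B = {p. \<forall>\<gamma>\<in>supp p. hi n \<gamma> \<in> B}"

lemma free_zero_basis: "free n {0} = polys n"
  unfolding free_def polys_def by (auto simp: in_expos_iff_hi)

lemma submod_free: "submod n (free n B)"
proof (rule submodI)
  show "p + q \<in> free n B" if "p \<in> free n B" "q \<in> free n B" for p q :: "'a mpol"
    using that Poly_Mapping.keys_add[of p q] unfolding free_def by blast
  show "a * p \<in> free n B" if a: "a \<in> polys n" and p: "p \<in> free n B" for a p :: "'a mpol"
    unfolding free_def
  proof (intro CollectI ballI)
    fix \<gamma> assume "\<gamma> \<in> supp (a * p)"
    then obtain \<alpha> \<beta> where "\<alpha> \<in> supp a" "\<beta> \<in> supp p" "\<gamma> = \<alpha> + \<beta>"
      using Poly_Mapping.keys_mult[of a p] by blast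
    then show "hi n \<gamma> \<in> B"
      using a p by (auto simp: polys_def free_def in_expos_iff_hi)
  qed
qed (simp add: free_def)

lemma free_mono: "B \<subseteq> B' \<Longrightarrow> free n B \<subseteq> free n B'"
  unfolding free_def by blast

text \<open>
  Additive extension to all polynomials of a map that is given on terms.
\<close>

definition lext :: "(expo \<Rightarrow> 'a \<Rightarrow> 'b) \<Rightarrow> 'a::comm_ring_1 mpol \<Rightarrow> 'b::comm_monoid_add" where
  "lext g p = (\<Sum>\<gamma>\<in>supp p. g \<gamma> (lk p \<gamma>))"

lemma lext_superset:
  assumes "\<And>\<gamma>. g \<gamma> 0 = 0" "finite A" "supp p \<subseteq> A"
  shows "lext g p = (\<Sum>\<gamma>\<in>A. g \<gamma> (lk p \<gamma>))"
  unfolding lext_def using assms by (intro sum.mono_neutral_left) (auto simp: in_keys_iff)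

lemma lext_0 [simp]: "lext g 0 = 0"
  by (simp add: lext_def)

lemma lext_add:
  assumes "\<And>\<gamma> c d. g \<gamma> (c + d) = g \<gamma> c + g \<gamma> d" "\<And>\<gamma>. g \<gamma> 0 = 0"
  shows "lext g (p + q) = lext g p + lext g q"
proof -
  let ?A = "supp p \<union> supp q"
  have "lext g (p + q) = (\<Sum>\<gamma>\<in>?A. g \<gamma> (lk (p + q) \<gamma>))"
    by (rule lext_superset[of g, OF assms(2)]) (use Poly_Mapping.keys_add[of p q] in auto)
  also have "\<dots> = (\<Sum>\<gamma>\<in>?A. g \<gamma> (lk p \<gamma>)) + (\<Sum>\<gamma>\<in>?A. g \<gamma> (lk q \<gamma>))"
    by (simp add: lookup_add assms(1) sum.distrib)
  also have "\<dots> = lext g p + lext g q"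
    using lext_superset[of g, OF assms(2), of ?A p] lext_superset[of g, OF assms(2), of ?A q] by simp
  finally show ?thesis .
qed

lemma lext_single: "g \<gamma> 0 = 0 \<Longrightarrow> lext g (sgl \<gamma> c) = g \<gamma> c"
  by (simp add: lext_def)

lemma additive_sum:
  assumes "f 0 = (0::'c::comm_monoid_add)" "\<And>x y. f (x + y) = f x + f y"
  shows "f (sum g I) = (\<Sum>i\<in>I. f (g i))"
  by (induction I rule: infinite_finite_induct) (simp_all add: assms)

lemma additive_eq_on_terms:
  fixes p :: "'a::comm_ring_1 mpol"
  assumes "f 0 = (0::'c::comm_monoid_add)" "\<And>x y. f (x + y) = f x + f y"
    "h 0 = 0" "\<And>x y. h (x + y) = h x + h y"
    "\<And>\<gamma> c. \<gamma> \<in> supp p \<Longrightarrow> f (sgl \<gamma> c) = h (sgl \<gamma> c)"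
  shows "f p = h p"
proof -
  have "f p = (\<Sum>\<gamma>\<in>supp p. f (sgl \<gamma> (lk p \<gamma>)))"
    by (subst mpol_sum_single[of p]) (rule additive_sum[of f, OF assms(1,2)])
  also have "\<dots> = (\<Sum>\<gamma>\<in>supp p. h (sgl \<gamma> (lk p \<gamma>)))"
    using assms(5) by (intro sum.cong) auto
  also have "\<dots> = h p"
    by (subst (3) mpol_sum_single[of p]) (rule additive_sum[of h, OF assms(3,4), symmetric])
  finally show ?thesis .
qed

lemma multiplicative_on_terms:
  fixes f :: "'a::comm_ring_1 mpol \<Rightarrow> 'c::comm_ring_1"
  assumes "f 0 = 0" "\<And>x y. f (x + y) = f x + f y" "h 0 = 0" "\<And>x y. h (x + y) = h x + h y"
    "k 0 = 0" "\<And>x y. k (x + y) = k x + k y"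
    "\<And>\<gamma> \<delta> c d. \<gamma> \<in> supp p \<Longrightarrow> \<delta> \<in> supp q \<Longrightarrow>
       f (sgl (\<gamma> + \<delta>) (c * d)) = h (sgl \<gamma> c) * k (sgl \<delta> d)"
  shows "f (p * q) = h p * k q"
proof -
  let ?P = "supp p" and ?Q = "supp q"
  have "p * q = (\<Sum>\<gamma>\<in>?P. sgl \<gamma> (lk p \<gamma>)) * (\<Sum>\<delta>\<in>?Q. sgl \<delta> (lk q \<delta>))"
    by (simp add: mpol_sum_single[symmetric])
  also have "\<dots> = (\<Sum>\<gamma>\<in>?P. \<Sum>\<delta>\<in>?Q. sgl (\<gamma> + \<delta>) (lk p \<gamma> * lk q \<delta>))"
    by (simp add: sum_product mult_single)
  finally have "f (p * q) = (\<Sum>\<gamma>\<in>?P. \<Sum>\<delta>\<in>?Q. f (sgl (\<gamma> + \<delta>) (lk p \<gamma> * lk q \<delta>)))"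
    by (simp add: additive_sum[of f, OF assms(1,2)])
  also have "\<dots> = (\<Sum>\<gamma>\<in>?P. \<Sum>\<delta>\<in>?Q. h (sgl \<gamma> (lk p \<gamma>)) * k (sgl \<delta> (lk q \<delta>)))"
    by (intro sum.cong refl assms(7))
  also have "\<dots> = h (\<Sum>\<gamma>\<in>?P. sgl \<gamma> (lk p \<gamma>)) * k (\<Sum>\<delta>\<in>?Q. sgl \<delta> (lk q \<delta>))"
    by (simp add: sum_product additive_sum[of h, OF assms(3,4)] additive_sum[of k, OF assms(5,6)])
  finally show ?thesis
    by (simp add: mpol_sum_single[symmetric])
qed

text \<open>The coefficient of the basis monomial \<open>\<beta>\<close>, as a polynomial in the first \<open>n\<close> variables.\<close>

definition cpart :: "nat \<Rightarrow> expo \<Rightarrow> 'a::comm_ring_1 mpol \<Rightarrow> 'a mpol" where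
  "cpart n \<beta> = lext (\<lambda>\<gamma> c. if hi n \<gamma> = \<beta> then sgl (lo n \<gamma>) c else 0)"

lemma cpart_0 [simp]: "cpart n \<beta> 0 = 0"
  by (simp add: cpart_def)

lemma cpart_add: "cpart n \<beta> (p + q) = cpart n \<beta> p + cpart n \<beta> q"
  unfolding cpart_def by (rule lext_add) (auto simp: single_add)

lemma cpart_single: "cpart n \<beta> (sgl \<gamma> c) = (if hi n \<gamma> = \<beta> then sgl (lo n \<gamma>) c else 0)"
  unfolding cpart_def by (subst lext_single) auto

lemma cpart_in_polys: "cpart n \<beta> p \<in> polys n"
  unfolding cpart_def lext_def by (intro polys_sum) auto

lemma cpart_mult: 
  assumes "a \<in> polys n"
  shows "cpart n \<beta> (a * p) = a * cpart n \<beta> p"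
proof (rule multiplicative_on_terms[where f = "cpart n \<beta>" and h = "\<lambda>x. x" and k = "cpart n \<beta>"])
  fix \<gamma> \<delta> and c d :: 'a assume "\<gamma> \<in> supp a"
  then have "lo n \<gamma> = \<gamma>" "hi n \<gamma> = 0"
    using assms by (auto simp: polys_def in_expos_iff_lo[symmetric] in_expos_iff_hi[symmetric])
  then show "cpart n \<beta> (sgl (\<gamma> + \<delta>) (c * d)) = sgl \<gamma> c * cpart n \<beta> (sgl \<delta> d)"
    by (simp add: cpart_single mult_single)
qed (simp_all add: cpart_add)

lemma cpart_uminus: "cpart n \<beta> (- p) = - cpart n \<beta> p"
  using cpart_mult[of "- 1" n \<beta> p, OF polys_uminus[OF polys_1]] by simp

lemma cpart_diff: "cpart n \<beta> (p - q) = cpart n \<beta> p - cpart n \<beta> q"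
  using cpart_add[of n \<beta> p "- q"] by (simp add: cpart_uminus)

lemma cpart_sum: "cpart n \<beta> (sum f I) = (\<Sum>i\<in>I. cpart n \<beta> (f i))"
  by (rule additive_sum[of "cpart n \<beta>"]) (simp_all add: cpart_add)

lemma free_expand:
  assumes "finite B" "p \<in> free n B"
  shows "p = (\<Sum>\<beta>\<in>B. cpart n \<beta> p * mpow \<beta>)"
proof -
  have "p = (\<Sum>\<gamma>\<in>supp p. sgl \<gamma> (lk p \<gamma>))"
    by (rule mpol_sum_single)
  also have "\<dots> = (\<Sum>\<gamma>\<in>supp p. \<Sum>\<beta>\<in>B. if hi n \<gamma> = \<beta> then sgl (lo n \<gamma>) (lk p \<gamma>) * mpow \<beta> else 0)"
  proof (intro sum.cong refl)
    fix \<gamma> assume "\<gamma> \<in> supp p"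
    then have "hi n \<gamma> \<in> B" using assms(2) by (simp add: free_def)
    then show "sgl \<gamma> (lk p \<gamma>) = (\<Sum>\<beta>\<in>B. if hi n \<gamma> = \<beta> then sgl (lo n \<gamma>) (lk p \<gamma>) * mpow \<beta> else 0)"
      using assms(1) by (simp add: sum.delta' mpow_def mult_single lo_plus_hi)
  qed
  also have "\<dots> = (\<Sum>\<beta>\<in>B. \<Sum>\<gamma>\<in>supp p. if hi n \<gamma> = \<beta> then sgl (lo n \<gamma>) (lk p \<gamma>) * mpow \<beta> else 0)"
    by (rule sum.swap)
  also have "\<dots> = (\<Sum>\<beta>\<in>B. cpart n \<beta> p * mpow \<beta>)"
    unfolding cpart_def lext_def sum_distrib_right by (intro sum.cong refl) simp
  finally show ?thesis .
qed

lemma mpow_in_free: "hi n \<beta> = \<beta> \<Longrightarrow> \<beta> \<in> B \<Longrightarrow> mpow \<beta> \<in> free n B"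
  unfolding free_def mpow_def by simp

lemma free_insert_drop:
  assumes "p \<in> free n (insert \<beta> B)" "cpart n \<beta> p = 0"
  shows "p \<in> free n B"
  unfolding free_def
proof (intro CollectI ballI)
  fix \<gamma> assume \<gamma>: "\<gamma> \<in> supp p"
  have "hi n \<gamma> \<noteq> \<beta>"
  proof
    assume h: "hi n \<gamma> = \<beta>"
    have "lk (cpart n \<beta> p) (lo n \<gamma>) = (\<Sum>\<delta>\<in>supp p. if \<delta> = \<gamma> then lk p \<delta> else 0)"
      unfolding cpart_def lext_def lookup_sum
    proof (intro sum.cong refl)
      fix \<delta> assume "\<delta> \<in> supp p"
      have "\<delta> = \<gamma>" if "hi n \<delta> = \<beta>" "lo n \<delta> = lo n \<gamma>"
        using that h lo_plus_hi by metis
      then show "lk (if hi n \<delta> = \<beta> then sgl (lo n \<delta>) (lk p \<delta>) else 0) (lo n \<gamma>) = (if \<delta> = \<gamma> then lk p \<delta> else 0)"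
        using h by (auto simp: lookup_single when_def)
    qed
    also have "\<dots> = lk p \<gamma>"
      using \<gamma> by (simp add: sum.delta)
    finally show False
      using assms(2) \<gamma> by (simp add: in_keys_iff)
  qed
  then show "hi n \<gamma> \<in> B"
    using assms(1) \<gamma> unfolding free_def by blast
qed

section \<open>Dickson's lemma\<close>

text \<open>
  Formulated for numerical functions on an arbitrary set, so that the exponents in the first \<open>n\<close>
  variables can be combined with a further quantity that is not an exponent.
\<close>

lemma dickson_nat:
  fixes f :: "nat \<Rightarrow> 'x \<Rightarrow> nat"
  shows "\<exists>A0. finite A0 \<and> A0 \<subseteq> A \<and> (\<forall>a\<in>A. \<exists>b\<in>A0. \<forall>i<k. f i b \<le> f i a)"
proof (induction k arbitrary: A)
  case 0
  show ?case
  proof (cases "A = {}")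
    case False
    then obtain x where "x \<in> A" by blast
    then show ?thesis by (intro exI[of _ "{x}"]) simp
  next
    case True
    then show ?thesis by (intro exI[of _ "{}"]) simp
  qed
next
  case (Suc k)
  obtain A0 where A0: "finite A0" "A0 \<subseteq> A" "\<forall>a\<in>A. \<exists>b\<in>A0. \<forall>i<k. f i b \<le> f i a"
    using Suc[of A] by blast
  \<comment> \<open>Only elements with a small last value can escape \<open>A0\<close>; there are finitely many such values.\<close>
  have "\<exists>Av. \<forall>v. finite (Av v) \<and> Av v \<subseteq> {a \<in> A. f k a = v} \<and>
      (\<forall>a\<in>{a \<in> A. f k a = v}. \<exists>b\<in>Av v. \<forall>i<k. f i b \<le> f i a)"
    by (intro choice allI Suc)
  then obtain Av where Av': "\<forall>v. finite (Av v) \<and> Av v \<subseteq> {a \<in> A. f k a = v} \<and>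
      (\<forall>a\<in>{a \<in> A. f k a = v}. \<exists>b\<in>Av v. \<forall>i<k. f i b \<le> f i a)" ..
  have Av: "finite (Av v)" "Av v \<subseteq> {a \<in> A. f k a = v}" for v
    using Av' by auto
  have Av3: "\<exists>b\<in>Av v. \<forall>i<k. f i b \<le> f i a" if "a \<in> A" "f k a = v" for v a
    using Av'[rule_format, of v] that by auto
  define N where "N = Max (insert 0 (f k ` A0))"
  have N: "f k b \<le> N" if "b \<in> A0" for b
    using A0(1) that unfolding N_def by (intro Max_ge) auto
  show ?case
  proof (intro exI conjI ballI)
    show "finite (A0 \<union> (\<Union>v\<le>N. Av v))"
      using A0(1) Av(1) by simp
    have "Av v \<subseteq> A" for v
      using Av(2)[of v] by blast
    then show "A0 \<union> (\<Union>v\<le>N. Av v) \<subseteq> A"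
      using A0(2) by blast
    fix a assume a: "a \<in> A"
    show "\<exists>b\<in>A0 \<union> (\<Union>v\<le>N. Av v). \<forall>i<Suc k. f i b \<le> f i a"
    proof (cases "f k a \<le> N")
      case True
      obtain b where b: "b \<in> Av (f k a)" "\<forall>i<k. f i b \<le> f i a"
        using Av3[OF a refl] by blast
      then have "\<forall>i<Suc k. f i b \<le> f i a"
        using Av(2)[of "f k a"] by (auto simp: less_Suc_eq)
      then show ?thesis
        using b(1) True by blast
    next
      case False
      obtain b where b: "b \<in> A0" "\<forall>i<k. f i b \<le> f i a"
        using A0(3) a by blast
      then have "\<forall>i<Suc k. f i b \<le> f i a"
        using N[of b] False by (auto simp: less_Suc_eq)
      then show ?thesis
        using b(1) by blast
    qed
  qed
qed

section \<open>Saturated submodules are finitely generated\<close>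

definition tdeg :: "nat \<Rightarrow> expo \<Rightarrow> nat" where
  "tdeg n \<gamma> = (\<Sum>i<n. lk \<gamma> i)"

lemma tdeg_add: "tdeg n (\<alpha> + \<beta>) = tdeg n \<alpha> + tdeg n \<beta>"
  by (simp add: tdeg_def lookup_add sum.distrib)

lemma finite_bounded_expos:
  assumes "finite B"
  shows "finite {\<gamma>. hi n \<gamma> \<in> B \<and> tdeg n \<gamma> \<le> d}"
proof -
  let ?F = "{f. \<forall>i. (i \<in> {..<n} \<longrightarrow> f i \<in> {..d}) \<and> (i \<notin> {..<n} \<longrightarrow> f i = (0::nat))}"
  have F: "finite ?F"
    by (rule finite_set_of_finite_funs) auto
  have inj: "inj_on (\<lambda>\<gamma>. (hi n \<gamma>, lk (lo n \<gamma>))) UNIV"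
    by (rule inj_onI) (metis lo_plus_hi poly_mapping_eq_iff prod.inject)
  have "(\<lambda>\<gamma>. (hi n \<gamma>, lk (lo n \<gamma>))) ` {\<gamma>. hi n \<gamma> \<in> B \<and> tdeg n \<gamma> \<le> d} \<subseteq> B \<times> ?F"
  proof (rule image_subsetI)
    fix \<gamma> assume "\<gamma> \<in> {\<gamma>. hi n \<gamma> \<in> B \<and> tdeg n \<gamma> \<le> d}"
    then have *: "hi n \<gamma> \<in> B" "tdeg n \<gamma> \<le> d" by auto
    have "lk \<gamma> i \<le> d" if "i < n" for i
      using *(2) that member_le_sum[of i "{..<n}" "lk \<gamma>"] unfolding tdeg_def by simp
    then show "(hi n \<gamma>, lk (lo n \<gamma>)) \<in> B \<times> ?F"
      using * by auto
  qed
  then show ?thesis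
    using finite_imageD[OF finite_subset inj_on_subset[OF inj]] F assms by blast
qed

definition primitive :: "'a::comm_ring_1 mpol \<Rightarrow> bool" where
  "primitive p \<longleftrightarrow> (\<exists>\<gamma>. lk p \<gamma> dvd 1)"

text \<open>The exponent of the largest term whose coefficient survives modulo the maximal ideal.\<close>

definition ulead :: "'a::comm_ring_1 mpol \<Rightarrow> expo \<Rightarrow> bool" where
  "ulead p \<gamma> \<longleftrightarrow> lk p \<gamma> dvd 1 \<and> (\<forall>\<delta>>\<gamma>. \<not> lk p \<delta> dvd 1)"

locale valuation_domain =
  fixes V :: "'a::idom itself"
  assumes valuation_ring: "valuation_ring V"
begin

lemma dvd_linear: "(a::'a) dvd b \<or> b dvd a"
  using valuation_ring unfolding valuation_ring_def by blast

lemma nonunit_add: "\<not> (a::'a) dvd 1 \<Longrightarrow> \<not> b dvd 1 \<Longrightarrow> \<not> (a + b) dvd 1"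
  using dvd_linear[of a b] by (metis dvd_add dvd_refl dvd_trans)

lemma nonunit_sum: "(\<And>i. i \<in> I \<Longrightarrow> \<not> (f i :: 'a) dvd 1) \<Longrightarrow> \<not> sum f I dvd 1"
  by (induction I rule: infinite_finite_induct) (auto dest: nonunit_add)

lemma finite_common_divisor:
  assumes "finite A" "A \<noteq> {}"
  shows "\<exists>a\<in>A. \<forall>b\<in>A. (a::'a) dvd b"
  using assms
proof (induction A rule: finite_ne_induct)
  case (insert x F)
  from insert.IH obtain a where a: "a \<in> F" "\<forall>b\<in>F. a dvd b" by blast
  show ?case
  proof (cases "a dvd x")
    case True
    then show ?thesis using a by (intro bexI[of _ a]) auto
  next
    case False
    then have "x dvd a" using dvd_linear by blast
    then show ?thesis using a by (intro bexI[of _ x]) (auto intro: dvd_trans)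
  qed
qed simp

text \<open>
  Divisibility is total, so one of the finitely many nonzero coefficients divides all the others;
  its own quotient is \<open>1\<close>. Families are needed because a linear relation has to be divided by a
  factor that is common to all of its coefficients.
\<close>

lemma family_content:
  fixes p :: "'i \<Rightarrow> 'a mpol"
  assumes "finite I" "\<exists>i\<in>I. p i \<noteq> 0"
  shows "\<exists>c q. c \<noteq> 0 \<and> (\<forall>i\<in>I. p i = const c * q i \<and> supp (q i) \<subseteq> supp (p i)) \<and> (\<exists>i\<in>I. primitive (q i))"
proof -
  define A where "A = (\<Union>i\<in>I. lk (p i) ` supp (p i))"
  have "finite A" "A \<noteq> {}"
    using assms unfolding A_def by auto
  then obtain c where c: "c \<in> A" "\<forall>b\<in>A. c dvd b"
    using finite_common_divisor by blast
  have c0: "c \<noteq> 0"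
    using c(1) unfolding A_def by (auto simp: in_keys_iff)
  define q where "q i = (\<Sum>\<gamma>\<in>supp (p i). sgl \<gamma> (SOME x. lk (p i) \<gamma> = c * x))" for i
  have lq: "lk (q i) \<gamma> = (if \<gamma> \<in> supp (p i) then SOME x. lk (p i) \<gamma> = c * x else 0)" for i \<gamma>
    unfolding q_def by (auto simp: lookup_sum lookup_single when_def sum.delta)
  have lp: "lk (p i) \<gamma> = c * lk (q i) \<gamma>" if "i \<in> I" for i \<gamma>
  proof (cases "\<gamma> \<in> supp (p i)")
    case True
    then have "\<exists>x. lk (p i) \<gamma> = c * x"
      using c(2) that unfolding A_def by (blast elim: dvdE)
    then have "lk (p i) \<gamma> = c * (SOME x. lk (p i) \<gamma> = c * x)"
      by (rule someI_ex)
    then show ?thesis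
      using True lq by simp
  qed (simp add: lq in_keys_iff)
  obtain i \<gamma> where i: "i \<in> I" "c = lk (p i) \<gamma>"
    using c(1) unfolding A_def by blast
  then have "lk (q i) \<gamma> = 1"
    using lp[OF i(1), of \<gamma>] c0 by simp
  then have "primitive (q i)"
    unfolding primitive_def by (intro exI[of _ \<gamma>]) simp
  moreover have "supp (q i) \<subseteq> supp (p i)" for i
    using lq[of i] by (auto simp: in_keys_iff)
  ultimately show ?thesis
    using c0 lp i(1) by (intro exI[of _ c] exI[of _ q]) (auto intro!: poly_mapping_eqI)
qed

lemma content:
  assumes "(p::'a mpol) \<noteq> 0"
  obtains c q where "c \<noteq> 0" "p = const c * q" "primitive q" "supp q \<subseteq> supp p"
  using family_content[of "{()}" "\<lambda>_. p"] assms by auto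

lemma primitive_ulead:
  assumes "primitive (p::'a mpol)"
  obtains \<gamma> where "ulead p \<gamma>"
proof -
  let ?U = "{\<gamma>. lk p \<gamma> dvd 1}"
  have "?U \<subseteq> supp p"
    by (auto simp: in_keys_iff)
  then have fin: "finite ?U"
    by (rule finite_subset) simp
  have ne: "?U \<noteq> {}"
    using assms unfolding primitive_def by auto
  have "ulead p (Max ?U)"
    unfolding ulead_def using Max_in[OF fin ne] Max_ge[OF fin] by (auto simp: leD)
  then show ?thesis ..
qed

text \<open>
  Gaussian elimination: a family with distinct unit-leading exponents is triangular modulo the
  maximal ideal, so it can be used to clear the entries at these exponents of any vector.
\<close>

lemma eliminate:
  fixes g :: "expo \<Rightarrow> 'a mpol"
  assumes "finite E" "\<And>e. e \<in> E \<Longrightarrow> ulead (g e) e"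
    and "0 \<in> U" "\<And>u v. u \<in> U \<Longrightarrow> v \<in> U \<Longrightarrow> u + v \<in> U" "\<And>c u. u \<in> U \<Longrightarrow> const c * u \<in> U"
    and "\<And>e. e \<in> E \<Longrightarrow> g e \<in> U"
  shows "\<exists>u\<in>U. \<forall>e\<in>E. lk (f - u) e = 0"
  using assms
proof (induction E arbitrary: U f rule: finite_linorder_max_induct)
  case empty
  then show ?case by auto
next
  case (insert b E)
  let ?U = "{u \<in> U. \<not> lk u b dvd 1}"
  have "\<exists>u\<in>?U. \<forall>e\<in>E. lk (f - u) e = 0" for f
  proof (rule insert.IH)
    show "ulead (g e) e" if "e \<in> E" for e
      using insert.prems(1) that by blast
    show "g e \<in> ?U" if "e \<in> E" for e
      using insert.prems(1)[of e] insert.prems(5)[of e] insert.hyps(2) that unfolding ulead_def by auto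
    show "u + v \<in> ?U" if "u \<in> ?U" "v \<in> ?U" for u v
      using that nonunit_add by (auto simp: lookup_add insert.prems(3))
    show "const c * u \<in> ?U" if "u \<in> ?U" for c u
      using that insert.prems(4) by (auto dest: dvd_mult_right)
  qed (use insert.prems in auto)
  note IH = this
  obtain u where u: "u \<in> ?U" "\<forall>e\<in>E. lk (f - u) e = 0" using IH by blast
  obtain v where v: "v \<in> ?U" "\<forall>e\<in>E. lk (g b - v) e = 0" using IH by blast
  let ?h = "g b - v"
  have "lk ?h b dvd 1"
  proof (rule ccontr)
    assume "\<not> lk ?h b dvd 1"
    then have "\<not> (lk ?h b + lk v b) dvd 1"
      using v(1) nonunit_add by blast
    then show False
      using insert.prems(1)[of b] unfolding ulead_def by (simp add: lookup_minus)
  qed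
  then obtain w where w: "1 = lk ?h b * w" by (rule dvdE)
  let ?c = "lk (f - u) b * w"
  have m: "- v \<in> U"
    using insert.prems(4)[of v "- 1"] v(1) by (simp add: const_def single_uminus)
  have "?h \<in> U"
    using insert.prems(3)[OF insert.prems(5)[of b] m] by simp
  then have "u + const ?c * ?h \<in> U"
    using u(1) insert.prems(3,4) by blast
  moreover have "lk (f - (u + const ?c * ?h)) e = 0" if "e \<in> insert b E" for e
  proof -
    have "lk (f - (u + const ?c * ?h)) e = lk (f - u) e - ?c * lk ?h e"
      by (simp only: lookup_minus lookup_add lookup_const_mult) (simp add: algebra_simps)
    also have "\<dots> = 0"
    proof (cases "e = b")
      case True
      have "?c * lk ?h b = lk (f - u) b * (lk ?h b * w)" by (simp add: mult_ac)
      then show ?thesis using True w by simp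
    next
      case False
      then show ?thesis using that u(2) v(2) by simp
    qed
    finally show ?thesis .
  qed
  ultimately show ?case by blast
qed

text \<open>
  Filtering by degree replaces homogenization: in each degree the module is a pure submodule of a
  free module of finite rank over the valuation domain, hence spanned by any family that
  realizes all unit-leading exponents, and Dickson's lemma provides such families uniformly.
\<close>

theorem saturated_fgm:
  fixes P :: "'a mpol set"
  assumes B: "finite B" and PB: "P \<subseteq> free n B" and P: "submod n P"
    and sat: "\<And>c p. c \<noteq> 0 \<Longrightarrow> const c * p \<in> P \<Longrightarrow> p \<in> P"
  shows "fgm n P"
proof -
  define Pd where "Pd d = {p \<in> P. \<forall>\<gamma>\<in>supp p. tdeg n \<gamma> \<le> d}" for d
  define A where "A = {(\<gamma>, d). \<exists>p\<in>Pd d. ulead p \<gamma>}"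
  have A_free: "hi n \<gamma> \<in> B \<and> tdeg n \<gamma> \<le> d" if "p \<in> Pd d" "ulead p \<gamma>" for p \<gamma> d
  proof -
    have "\<gamma> \<in> supp p"
      using that(2) by (auto simp: ulead_def in_keys_iff)
    then show ?thesis
      using that(1) PB unfolding Pd_def free_def by blast
  qed
  \<comment> \<open>the last function is the exponent that a homogenizing variable would carry\<close>
  define f where "f i x = (case x of (\<gamma>, d) \<Rightarrow> if i < n then lk \<gamma> i else d - tdeg n \<gamma>)" for i and x :: "expo \<times> nat"
  have "\<exists>A0. \<forall>\<beta>. finite (A0 \<beta>) \<and> A0 \<beta> \<subseteq> {x \<in> A. hi n (fst x) = \<beta>} \<and>
      (\<forall>a\<in>{x \<in> A. hi n (fst x) = \<beta>}. \<exists>b\<in>A0 \<beta>. \<forall>i<Suc n. f i b \<le> f i a)"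
    by (intro choice allI dickson_nat)
  then obtain A0 where A0': "\<forall>\<beta>. finite (A0 \<beta>) \<and> A0 \<beta> \<subseteq> {x \<in> A. hi n (fst x) = \<beta>} \<and>
      (\<forall>a\<in>{x \<in> A. hi n (fst x) = \<beta>}. \<exists>b\<in>A0 \<beta>. \<forall>i<Suc n. f i b \<le> f i a)" ..
  have A0: "finite (A0 \<beta>)" "A0 \<beta> \<subseteq> {x \<in> A. hi n (fst x) = \<beta>}" for \<beta>
    using A0' by auto
  have A03: "\<exists>b\<in>A0 \<beta>. \<forall>i<Suc n. f i b \<le> f i a" if "a \<in> A" "hi n (fst a) = \<beta>" for a \<beta>
    using conjunct2[OF conjunct2[OF spec[OF A0', of \<beta>]]] that by blast
  have "\<exists>g. \<forall>x\<in>A. g x \<in> Pd (snd x) \<and> ulead (g x) (fst x)"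
    by (rule bchoice) (auto simp: A_def)
  then obtain g where "\<forall>x\<in>A. g x \<in> Pd (snd x) \<and> ulead (g x) (fst x)" ..
  then have g: "\<And>x. x \<in> A \<Longrightarrow> g x \<in> Pd (snd x)" "\<And>x. x \<in> A \<Longrightarrow> ulead (g x) (fst x)"
    by auto
  define G where "G = g ` (\<Union>\<beta>\<in>B. A0 \<beta>)"
  have GP: "G \<subseteq> P"
    using g(1) A0(2) unfolding G_def Pd_def by blast
  have spanP: "rspan n G \<subseteq> P"
    by (rule rspan_least[OF P GP])
  have real: "\<exists>h \<in> Pd d \<inter> rspan n G. ulead h \<gamma>" if "p \<in> Pd d" "ulead p \<gamma>" for p \<gamma> d
  proof -
    have a: "(\<gamma>, d) \<in> A" using that unfolding A_def by blast
    obtain b where b: "b \<in> A0 (hi n \<gamma>)" "\<And>i. i < Suc n \<Longrightarrow> f i b \<le> f i (\<gamma>, d)"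
      using A03[OF a] by force
    obtain \<delta> e where be: "b = (\<delta>, e)" by force
    have bA: "b \<in> A" "hi n \<delta> = hi n \<gamma>" using b(1) A0(2) be by force+
    have le: "lk \<delta> i \<le> lk \<gamma> i" if "i < n" for i
      using b(2)[of i] that unfolding f_def be by simp
    have slack: "e - tdeg n \<delta> \<le> d - tdeg n \<gamma>"
      using b(2)[of n] unfolding f_def be by simp
    define \<alpha> where "\<alpha> = lo n (\<gamma> - \<delta>)"
    have \<alpha>: "\<gamma> = \<alpha> + \<delta>"
    proof (rule poly_mapping_eqI)
      fix i
      have "lk (hi n \<delta>) i = lk (hi n \<gamma>) i" using bA(2) by simp
      then show "lk \<gamma> i = lk (\<alpha> + \<delta>) i"
        using le[of i] unfolding \<alpha>_def by (auto simp: lookup_add lookup_minus split: if_splits)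
    qed
    have \<alpha>n: "\<alpha> \<in> expos n" unfolding \<alpha>_def by simp
    let ?h = "mpow \<alpha> * g b"
    have gb: "g b \<in> Pd e" "ulead (g b) \<delta>" using g[OF bA(1)] be by auto
    have "g b \<in> G" using b(1) A_free[OF that] unfolding G_def by blast
    then have h1: "?h \<in> rspan n G"
      using submodD(3)[OF submod_rspan polys_mpow[OF \<alpha>n] rspan_base] by blast
    have "tdeg n \<kappa> \<le> d" if \<kappa>: "\<kappa> \<in> supp ?h" for \<kappa>
    proof -
      obtain \<eta> where \<eta>: "\<eta> \<in> supp (g b)" "\<kappa> = \<alpha> + \<eta>"
        using \<kappa> keys_single_mult[of \<alpha> 1 "g b"] unfolding mpow_def by blast
      have "tdeg n \<eta> \<le> e" using gb(1) \<eta>(1) unfolding Pd_def by blast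
      moreover have "tdeg n \<delta> \<le> e" "tdeg n \<gamma> \<le> d" using A_free[OF gb] A_free[OF \<open>p \<in> Pd d\<close> \<open>ulead p \<gamma>\<close>] by simp_all
      moreover have "tdeg n \<gamma> = tdeg n \<alpha> + tdeg n \<delta>" by (simp add: \<alpha> tdeg_add)
      ultimately show ?thesis using slack \<eta>(2) by (simp add: tdeg_add)
    qed
    then have h2: "?h \<in> Pd d" using h1 spanP unfolding Pd_def by blast
    have lk_h: "lk ?h (\<alpha> + \<eta>) = lk (g b) \<eta>" for \<eta>
      unfolding mpow_def by (simp add: lookup_single_mult)
    have "ulead ?h \<gamma>" unfolding ulead_def
    proof (intro conjI allI impI)
      show "lk ?h \<gamma> dvd 1" using gb(2) lk_h[of \<delta>] unfolding ulead_def \<alpha> by simp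
      fix \<kappa> assume \<kappa>: "\<gamma> < \<kappa>"
      show "\<not> lk ?h \<kappa> dvd 1"
      proof
        assume *: "lk ?h \<kappa> dvd 1"
        then have "\<kappa> \<in> supp ?h" by (auto simp: in_keys_iff)
        then obtain \<eta> where \<eta>: "\<kappa> = \<alpha> + \<eta>"
          using keys_single_mult[of \<alpha> 1 "g b"] unfolding mpow_def by blast
        then have "\<delta> < \<eta>" using \<kappa> \<alpha> by simp
        then show False using * gb(2) lk_h[of \<eta>] \<eta> unfolding ulead_def by auto
      qed
    qed
    then show ?thesis using h1 h2 by blast
  qed
  have "P \<subseteq> rspan n G"
  proof
    fix p assume p: "p \<in> P"
    define d where "d = Max (insert 0 (tdeg n ` supp p))"
    have pd: "p \<in> Pd d"
      unfolding Pd_def d_def using p by (auto intro: Max_ge)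
    define E where "E = {\<gamma>. \<exists>q\<in>Pd d. ulead q \<gamma>}"
    have E: "finite E"
      by (rule finite_subset[OF _ finite_bounded_expos[OF B, of n d]]) (use A_free in \<open>auto simp: E_def\<close>)
    have "\<exists>h. \<forall>e\<in>E. h e \<in> Pd d \<inter> rspan n G \<and> ulead (h e) e"
      by (rule bchoice) (use real in \<open>auto simp: E_def Bex_def\<close>)
    then obtain h where "\<forall>e\<in>E. h e \<in> Pd d \<inter> rspan n G \<and> ulead (h e) e" ..
    then have h: "\<And>e. e \<in> E \<Longrightarrow> h e \<in> Pd d \<inter> rspan n G" "\<And>e. e \<in> E \<Longrightarrow> ulead (h e) e"
      by auto
    let ?U = "Pd d \<inter> rspan n G"
    have Pd_add: "u + v \<in> Pd d" if "u \<in> Pd d" "v \<in> Pd d" for u v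
      using that submodD(2)[OF P] Poly_Mapping.keys_add[of u v] unfolding Pd_def by blast
    have Pd_const: "const c * u \<in> Pd d" if "u \<in> Pd d" for c u
      using that submodD(3)[OF P polys_const[of c n]] keys_single_mult[of 0 c u] unfolding Pd_def const_def by auto
    have "\<exists>u\<in>?U. \<forall>e\<in>E. lk (p - u) e = 0"
    proof (rule eliminate[OF E h(2)])
      show "0 \<in> ?U" using submodD(1)[OF P] unfolding Pd_def by simp
      show "u + v \<in> ?U" if "u \<in> ?U" "v \<in> ?U" for u v
        using that Pd_add submodD(2)[OF submod_rspan] by blast
      show "const c * u \<in> ?U" if "u \<in> ?U" for c u
        using that Pd_const submodD(3)[OF submod_rspan polys_const] by blast
    qed (use h in auto)
    then obtain u where u: "u \<in> ?U" "\<forall>e\<in>E. lk (p - u) e = 0" by blast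
    \<comment> \<open>a nonzero remainder would have a unit-leading exponent in \<open>E\<close> after division by its content\<close>
    have "p - u = 0"
    proof (rule ccontr)
      assume "p - u \<noteq> 0"
      then obtain c q where q: "c \<noteq> 0" "p - u = const c * q" "primitive q" "supp q \<subseteq> supp (p - u)"
        using content by blast
      have "- u \<in> Pd d" using Pd_const[of u "- 1"] u(1) by (simp add: const_def single_uminus)
      then have pu: "p - u \<in> Pd d" using Pd_add[OF pd] by fastforce
      then have "q \<in> P" using sat[OF q(1)] q(2) unfolding Pd_def by simp
      then have "q \<in> Pd d" using pu q(4) unfolding Pd_def by blast
      moreover obtain \<gamma> where \<gamma>: "ulead q \<gamma>" using primitive_ulead[OF q(3)] .
      ultimately have "\<gamma> \<in> E" unfolding E_def by blast
      then have "c * lk q \<gamma> = 0" using u(2) q(2) by (metis lookup_const_mult)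
      then have "lk q \<gamma> = 0" using q(1) by simp
      then show False using \<gamma> unfolding ulead_def by simp
    qed
    then show "p \<in> rspan n G" using u(1) by simp
  qed
  moreover have "finite G" unfolding G_def using B A0(1) by blast
  ultimately show ?thesis using fgmI P GP by blast
qed

end

section \<open>Linear maps and coherence\<close>

definition linear_over :: "nat \<Rightarrow> ('a::comm_ring_1 mpol \<Rightarrow> 'a mpol) \<Rightarrow> bool" where
  "linear_over n f \<longleftrightarrow> (\<forall>p q. f (p + q) = f p + f q) \<and> (\<forall>a\<in>polys n. \<forall>p. f (a * p) = a * f p)"

lemma linear_overD:
  assumes "linear_over n f"
  shows "f 0 = 0" "f (p + q) = f p + f q" "a \<in> polys n \<Longrightarrow> f (a * p) = a * f p" "f (sum g I) = (\<Sum>i\<in>I. f (g i))"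
proof -
  show 1: "f (p + q) = f p + f q" for p q
    using assms unfolding linear_over_def by blast
  show 2: "f 0 = 0"
    using 1[of 0 0] by simp
  show "a \<in> polys n \<Longrightarrow> f (a * p) = a * f p"
    using assms unfolding linear_over_def by blast
  show "f (sum g I) = (\<Sum>i\<in>I. f (g i))"
    by (rule additive_sum[of f, OF 2 1])
qed

lemma rspan_finite_sum:
  assumes "finite S"
  shows "p \<in> rspan n S \<longleftrightarrow> (\<exists>a. (\<forall>s\<in>S. a s \<in> polys n) \<and> p = (\<Sum>s\<in>S. a s * s))"
proof
  assume "p \<in> rspan n S"
  then show "\<exists>a. (\<forall>s\<in>S. a s \<in> polys n) \<and> p = (\<Sum>s\<in>S. a s * s)"
  proof (induction p rule: rspan.induct)
    case rspan_zero
    then show ?case by (intro exI[of _ "\<lambda>_. 0"]) simp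
  next
    case (rspan_step b s p)
    then obtain a where a: "\<forall>s\<in>S. a s \<in> polys n" "p = (\<Sum>s\<in>S. a s * s)" by (elim exE conjE)
    have "(\<Sum>x\<in>S. (a(s := a s + b)) x * x) = (\<Sum>x\<in>S. a x * x + (if x = s then b * s else 0))"
      by (intro sum.cong refl) (simp add: algebra_simps)
    also have "\<dots> = p + b * s"
      using assms rspan_step.hyps(2) a(2) by (simp add: sum.distrib)
    finally show ?case
      using a(1) rspan_step.hyps by (intro exI[of _ "a(s := a s + b)"]) (auto intro: polys_add)
  qed
next
  assume "\<exists>a. (\<forall>s\<in>S. a s \<in> polys n) \<and> p = (\<Sum>s\<in>S. a s * s)"
  then obtain a where a: "\<forall>s\<in>S. a s \<in> polys n" "p = (\<Sum>s\<in>S. a s * s)" by (elim exE conjE)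
  show "p \<in> rspan n S" unfolding a(2)
    by (intro submod_sum[OF submod_rspan] submodD(3)[OF submod_rspan bspec[OF a(1)] rspan_base])
qed

lemma rspan_lincomb:
  assumes "\<And>i. i \<in> I \<Longrightarrow> a i \<in> polys n" "\<And>i. i \<in> I \<Longrightarrow> f i \<in> rspan n S"
  shows "(\<Sum>i\<in>I. a i * f i) \<in> rspan n S"
proof (rule submod_sum[OF submod_rspan])
  show "a i * f i \<in> rspan n S" if "i \<in> I" for i
    by (rule submodD(3)[OF submod_rspan assms(1)[OF that] assms(2)[OF that]])
qed

lemma rspan_image:
  assumes "linear_over n f"
  shows "f ` rspan n S = rspan n (f ` S)"
proof
  show "f ` rspan n S \<subseteq> rspan n (f ` S)"
  proof (rule image_subsetI)
    fix p assume "p \<in> rspan n S"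
    then show "f p \<in> rspan n (f ` S)"
      by (induction p rule: rspan.induct)
        (auto simp: linear_overD[OF assms] intro: rspan.rspan_step)
  qed
  show "rspan n (f ` S) \<subseteq> f ` rspan n S"
  proof
    fix p assume "p \<in> rspan n (f ` S)"
    then show "p \<in> f ` rspan n S"
    proof (induction p rule: rspan.induct)
      case rspan_zero
      then show ?case using linear_overD(1)[OF assms] by (intro image_eqI[of _ _ 0]) auto
    next
      case (rspan_step a t p)
      obtain s where s: "s \<in> S" "t = f s" using rspan_step.hyps(2) by (rule imageE)
      obtain q where q: "q \<in> rspan n S" "p = f q" using rspan_step.IH by (rule imageE)
      have "f (a * s + q) = a * t + p"
        using rspan_step.hyps(1) s(2) q(2) by (simp add: linear_overD[OF assms])
      moreover have "a * s + q \<in> rspan n S"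
        using rspan.rspan_step rspan_step.hyps(1) s(1) q(1) by blast
      ultimately show ?case by (intro image_eqI[of _ _ "a * s + q"]) auto
    qed
  qed
qed

lemma linear_cpart: "linear_over n (cpart n \<beta>)"
  unfolding linear_over_def by (simp add: cpart_add cpart_mult)

lemma linear_compose: "linear_over n f \<Longrightarrow> linear_over n g \<Longrightarrow> linear_over n (\<lambda>x. f (g x))"
  unfolding linear_over_def by simp

lemma linear_sum: "(\<And>i. i \<in> I \<Longrightarrow> linear_over n (f i)) \<Longrightarrow> linear_over n (\<lambda>x. \<Sum>i\<in>I. f i x)"
  unfolding linear_over_def by (simp add: sum.distrib sum_distrib_left)

lemma linear_mult: "linear_over n (\<lambda>x. p * x)"
  unfolding linear_over_def by (simp add: algebra_simps)

lemma linear_mult_right: "linear_over n f \<Longrightarrow> linear_over n (\<lambda>x. f x * p)"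
  unfolding linear_over_def by (simp add: algebra_simps)

text \<open>The map that sends the basis monomials \<open>mpow \<beta>\<close> to \<open>y \<beta>\<close>.\<close>

definition basis_map :: "nat \<Rightarrow> expo set \<Rightarrow> (expo \<Rightarrow> 'a::comm_ring_1 mpol) \<Rightarrow> 'a mpol \<Rightarrow> 'a mpol" where
  "basis_map n B y p = (\<Sum>\<beta>\<in>B. cpart n \<beta> p * y \<beta>)"

lemma linear_basis_map: "linear_over n (basis_map n B y)"
  unfolding basis_map_def by (intro linear_sum linear_mult_right linear_cpart)

lemma cpart_mult_mpow:
  assumes "a \<in> polys n" "hi n \<beta> = \<beta>"
  shows "cpart n \<gamma> (a * mpow \<beta>) = (if \<beta> = \<gamma> then a else 0)"
proof -
  have "lo n \<beta> = 0" using assms(2) lo_hi[of n \<beta>] by simp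
  then have "cpart n \<gamma> (mpow \<beta> :: 'a mpol) = (if \<beta> = \<gamma> then 1 else 0)"
    using assms(2) unfolding mpow_def by (auto simp: cpart_single)
  then show ?thesis using assms(1) by (simp add: cpart_mult)
qed

text \<open>
  Exponents of single variables with large index supply as many new basis elements as desired.
\<close>

lemma fresh_basis:
  assumes "finite (S :: 'x set)" "finite B"
  obtains j :: "'x \<Rightarrow> expo" where "inj_on j S" "\<And>s. s \<in> S \<Longrightarrow> hi n (j s) = j s" "j ` S \<inter> B = {}"
proof -
  let ?e = "\<lambda>v. sgl (n + v) 1 :: expo"
  have inj: "inj ?e"
    by (rule injI) (metis add_left_cancel keys_single singleton_insert_inj_eq' zero_neq_one)
  have "infinite (range ?e - B)"
    using inj assms(2) finite_imageD[of ?e UNIV] by (metis Diff_infinite_finite infinite_UNIV_nat)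
  then obtain T where T: "T \<subseteq> range ?e - B" "finite T" "card T = card S"
    using infinite_arbitrarily_large by metis
  then obtain j where j: "bij_betw j S T"
    using finite_same_card_bij[OF assms(1), of T] by metis
  show ?thesis
  proof (rule that[of j])
    show "inj_on j S" using j by (rule bij_betw_imp_inj_on)
    have img: "j ` S = T" using j by (rule bij_betw_imp_surj_on)
    show "j ` S \<inter> B = {}" using img T(1) by blast
    show "hi n (j s) = j s" if "s \<in> S" for s
    proof -
      obtain v where "j s = ?e v" using img T(1) \<open>s \<in> S\<close> by blast
      then show ?thesis by (auto intro!: poly_mapping_eqI simp: lookup_single when_def)
    qed
  qed
qed

context valuation_domain
begin

text \<open>
  Coherence. Such a preimage is a projection of a module of relations, and modules of relations
  are saturated because \<^typ>\<open>'a mpol\<close> has no torsion over the constants.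
\<close>

theorem fgm_preimage:
  fixes f :: "'a mpol \<Rightarrow> 'a mpol"
  assumes B: "finite B" and f: "linear_over n f" and K: "fgm n K"
  shows "fgm n {q \<in> free n B. f q \<in> K}"
proof -
  obtain S where S: "finite S" "K = rspan n S"
    using K unfolding fgm_def by (elim exE conjE)
  obtain j where j: "inj_on j S" "\<And>s. s \<in> S \<Longrightarrow> hi n (j s) = j s" "j ` S \<inter> B = {}"
    using fresh_basis[OF S(1) B, of n] by (metis (no_types))
  let ?C = "B \<union> j ` S"
  let ?F = "\<lambda>q. f (basis_map n B mpow q)"
  let ?G = "\<lambda>q. \<Sum>s\<in>S. cpart n (j s) q * s"
  \<comment> \<open>\<open>f q\<close> lies in \<open>K\<close> if and only if \<open>q\<close> extends to a solution of a linear equation with new unknowns for the generators\<close>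
  define P where "P = {q \<in> free n ?C. ?F q = ?G q}"
  have F: "linear_over n ?F"
    by (rule linear_compose[OF f linear_basis_map])
  have G: "linear_over n ?G"
    by (intro linear_sum linear_mult_right linear_cpart)
  have subP: "submod n P"
  proof (rule submodI)
    show "0 \<in> P" unfolding P_def by (simp add: submodD(1)[OF submod_free] linear_overD(1)[OF F])
    show "p + q \<in> P" if "p \<in> P" "q \<in> P" for p q
      using that submodD(2)[OF submod_free, of p n ?C q] linear_overD(2)[OF F] linear_overD(2)[OF G] unfolding P_def by auto
    show "a * p \<in> P" if "a \<in> polys n" "p \<in> P" for a p
      using that submodD(3)[OF submod_free, of a n p ?C] linear_overD(3)[OF F] linear_overD(3)[OF G] unfolding P_def by auto
  qed
  have "fgm n P"
  proof (rule saturated_fgm[of ?C])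
    show "q \<in> P" if c: "c \<noteq> 0" and q: "const c * q \<in> P" for c q
    proof -
      have "supp q \<subseteq> supp (const c * q)"
        using c by (auto simp: in_keys_iff)
      then have "q \<in> free n ?C" using q unfolding P_def free_def by blast
      moreover have "const c * ?F q = const c * ?G q"
        using q linear_overD(3)[OF F polys_const] linear_overD(3)[OF G polys_const] unfolding P_def by simp
      then have "?F q = ?G q" using c by simp
      ultimately show ?thesis unfolding P_def by simp
    qed
  qed (use subP B S(1) in \<open>auto simp: P_def\<close>)
  then obtain T where T: "finite T" "P = rspan n T" unfolding fgm_def by (elim exE conjE)
  have "{q \<in> free n B. f q \<in> K} = basis_map n B mpow ` P"
  proof (intro equalityI subsetI)
    fix q assume "q \<in> {q \<in> free n B. f q \<in> K}"
    then have q: "q \<in> free n B" "f q \<in> rspan n S" using S by auto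
    then obtain a where a: "\<forall>s\<in>S. a s \<in> polys n" "f q = (\<Sum>s\<in>S. a s * s)"
      unfolding rspan_finite_sum[OF S(1)] by (elim exE conjE)
    define r where "r = (\<Sum>s\<in>S. a s * mpow (j s))"
    have rfree: "r \<in> free n ?C" unfolding r_def
      using a(1) j(2) by (intro submod_sum[OF submod_free] submodD(3)[OF submod_free] mpow_in_free) auto
    have cr: "cpart n \<beta> r = (\<Sum>s\<in>S. if j s = \<beta> then a s else 0)" for \<beta>
      unfolding r_def cpart_sum using a(1) j(2) by (intro sum.cong refl) (simp add: cpart_mult_mpow)
    have crB: "cpart n \<beta> r = 0" if "\<beta> \<in> B" for \<beta>
      unfolding cr using that j(3) by (intro sum.neutral) auto
    have crS: "cpart n (j s) r = a s" if "s \<in> S" for s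
    proof -
      have "cpart n (j s) r = (\<Sum>t\<in>S. if t = s then a t else 0)"
        unfolding cr using j(1) that by (intro sum.cong refl) (auto simp: inj_on_def)
      then show ?thesis using S(1) that by simp
    qed
    have cqS: "cpart n (j s) q = 0" if "s \<in> S" for s
    proof -
      have "q = (\<Sum>\<beta>\<in>B. cpart n \<beta> q * mpow \<beta>)" by (rule free_expand[OF B q(1)])
      have "(if hi n \<gamma> = j s then sgl (lo n \<gamma>) (lk q \<gamma>) else 0) = 0" if "\<gamma> \<in> supp q" for \<gamma>
        using q(1) that j(3) \<open>s \<in> S\<close> unfolding free_def by auto
      then show ?thesis unfolding cpart_def lext_def by (intro sum.neutral) blast
    qed
    have b: "basis_map n B mpow (q + r) = q"
      using free_expand[OF B q(1)] crB unfolding basis_map_def by (simp add: cpart_add)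
    have "q + r \<in> P"
      unfolding P_def
    proof (intro CollectI conjI)
      show "q + r \<in> free n ?C"
        using submodD(2)[OF submod_free _ rfree] q(1) free_mono[of B ?C n] by blast
      show "?F (q + r) = ?G (q + r)"
        unfolding b using a(2) crS cqS by (simp add: cpart_add)
    qed
    then show "q \<in> basis_map n B mpow ` P" using b by (intro image_eqI[of _ _ "q + r"]) auto
  next
    fix q assume "q \<in> basis_map n B mpow ` P"
    then obtain p where p: "q = basis_map n B mpow p" "p \<in> P" by (rule imageE)
    have GK: "?G p \<in> K" unfolding S(2)
      by (rule rspan_lincomb[OF cpart_in_polys rspan_base])
    have FG: "?F p = ?G p"
      by (rule conjunct2[OF CollectD[OF p(2)[unfolded P_def]]])
    have "f q = ?G p"
      by (rule trans[OF arg_cong[where f = f, OF p(1)] FG])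
    then have "f q \<in> K" using GK by (rule ssubst)
    moreover have "q \<in> free n B"
    proof -
      have "cpart n \<beta> p * mpow \<beta> \<in> free n B" if "\<beta> \<in> B" for \<beta>
      proof (cases "hi n \<beta> = \<beta>")
        case True
        show ?thesis
          by (rule submodD(3)[OF submod_free cpart_in_polys mpow_in_free[OF True that]])
      next
        case False
        then have "hi n \<gamma> \<noteq> \<beta>" for \<gamma> by auto
        then have "cpart n \<beta> p = 0" by (simp add: cpart_def lext_def)
        then show ?thesis using submodD(1)[OF submod_free] by simp
      qed
      then show ?thesis unfolding p(1) basis_map_def by (intro submod_sum[OF submod_free])
    qed
    ultimately show "q \<in> {q \<in> free n B. f q \<in> K}" by simp
  qed
  then have "{q \<in> free n B. f q \<in> K} = rspan n (basis_map n B mpow ` T)"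
    using rspan_image[OF linear_basis_map] T(2) by metis
  then show ?thesis unfolding fgm_def using T(1) by blast
qed

section \<open>Primitive polynomials\<close>

text \<open>
  Gauss's lemma: modulo the maximal ideal the two unit-leading terms multiply to a term that no
  other product of terms reaches.
\<close>

lemma primitive_mult:
  fixes p q :: "'a mpol"
  assumes "primitive p" "primitive q"
  shows "primitive (p * q)"
proof -
  obtain \<gamma> \<delta> where \<gamma>: "ulead p \<gamma>" and \<delta>: "ulead q \<delta>"
    using primitive_ulead assms by metis
  let ?I = "supp p \<times> supp q"
  let ?t = "\<lambda>(x, y). if x + y = \<gamma> + \<delta> then lk p x * lk q y else 0"
  have "p * q = (\<Sum>x\<in>supp p. sgl x (lk p x)) * (\<Sum>y\<in>supp q. sgl y (lk q y))"
    by (simp add: mpol_sum_single[symmetric])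
  also have "\<dots> = (\<Sum>(x, y)\<in>?I. sgl (x + y) (lk p x * lk q y))"
    by (simp add: sum_product mult_single sum.cartesian_product)
  finally have pq: "p * q = (\<Sum>(x, y)\<in>?I. sgl (x + y) (lk p x * lk q y))" .
  have "lk (p * q) (\<gamma> + \<delta>) = sum ?t ?I"
    unfolding pq lookup_sum by (intro sum.cong refl) (auto simp: lookup_single when_def)
  also have "\<dots> = ?t (\<gamma>, \<delta>) + sum ?t (?I - {(\<gamma>, \<delta>)})"
    using \<gamma> \<delta> by (intro sum.remove) (auto simp: ulead_def in_keys_iff)
  finally have eq: "lk (p * q) (\<gamma> + \<delta>) = lk p \<gamma> * lk q \<delta> + sum ?t (?I - {(\<gamma>, \<delta>)})" by simp
  have "\<not> sum ?t (?I - {(\<gamma>, \<delta>)}) dvd 1"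
  proof (rule nonunit_sum)
    fix i assume i: "i \<in> ?I - {(\<gamma>, \<delta>)}"
    obtain x y where xy: "i = (x, y)" by force
    show "\<not> ?t i dvd 1"
    proof (cases "x + y = \<gamma> + \<delta>")
      case True
      have "x > \<gamma> \<or> y > \<delta>"
      proof (rule ccontr)
        assume "\<not> (x > \<gamma> \<or> y > \<delta>)"
        then have "x \<le> \<gamma>" "y \<le> \<delta>" by auto
        moreover have "x < \<gamma> \<or> y < \<delta>" using i xy calculation by auto
        ultimately have "x + y < \<gamma> + \<delta>"
          by (metis add_less_le_mono add_le_less_mono)
        then show False using True by simp
      qed
      then have "\<not> lk p x dvd 1 \<or> \<not> lk q y dvd 1" using \<gamma> \<delta> unfolding ulead_def by blast
      then show ?thesis using True xy by (auto dest: dvd_mult_left dvd_mult_right)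
    qed (simp add: xy)
  qed
  moreover have "lk p \<gamma> * lk q \<delta> dvd 1"
    using \<gamma> \<delta> mult_dvd_mono[of "lk p \<gamma>" 1 "lk q \<delta>" 1] unfolding ulead_def by simp
  ultimately have "lk (p * q) (\<gamma> + \<delta>) dvd 1"
    using nonunit_add[of "lk (p * q) (\<gamma> + \<delta>)" "- sum ?t (?I - {(\<gamma>, \<delta>)})"] eq by auto
  then show ?thesis unfolding primitive_def by blast
qed

lemma primitive_1 [simp]: "primitive (1 :: 'a mpol)"
  unfolding primitive_def by (intro exI[of _ 0]) simp

lemma primitive_power: "primitive (p :: 'a mpol) \<Longrightarrow> primitive (p ^ k)"
  by (induction k) (simp_all add: primitive_mult)

lemma primitive_nonzero: "primitive (p :: 'a mpol) \<Longrightarrow> p \<noteq> 0"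
  unfolding primitive_def by auto

text \<open>
  Multiplication by a primitive polynomial preserves the content.
\<close>

lemma primitive_cancel:
  fixes u x y :: "'a mpol"
  assumes "primitive u" "u * x = const c * y" "c \<noteq> 0"
  obtains z where "x = const c * z" "supp z \<subseteq> supp x"
proof (cases "x = 0")
  case True
  then show ?thesis using that[of 0] by simp
next
  case False
  then obtain e z where z: "e \<noteq> 0" "x = const e * z" "primitive z" "supp z \<subseteq> supp x"
    using content by (metis (no_types))
  have "primitive (u * z)" using primitive_mult assms(1) z(3) .
  then obtain \<gamma> where "lk (u * z) \<gamma> dvd 1" unfolding primitive_def ..
  then obtain w where w: "1 = lk (u * z) \<gamma> * w" by (rule dvdE)
  have "const e * (u * z) = const c * y" using assms(2) z(2) by (simp add: mult_ac)
  then have "e * lk (u * z) \<gamma> = c * lk y \<gamma>" by (metis lookup_const_mult)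
  then have "e * (lk (u * z) \<gamma> * w) = c * (lk y \<gamma> * w)" by (metis mult.assoc)
  then have "e = c * (lk y \<gamma> * w)" using w by simp
  then obtain d where d: "e = c * d" by blast
  show ?thesis
  proof (rule that[of "const d * z"])
    show "x = const c * (const d * z)" unfolding z(2) d const_mult by (simp add: mult_ac)
    show "supp (const d * z) \<subseteq> supp x"
      using keys_single_mult[of 0 d z] z(4) unfolding const_def by auto
  qed
qed

text \<open>
  Localizing at the primitive polynomials turns \<^term>\<open>polys n\<close> into a valuation domain with the
  same divisibility of constants, over which finitely generated modules are triangularized by
  elimination. Only finitely many primitive denominators enter, so one of them serves all elements.
\<close>

theorem primitive_saturation:
  fixes S :: "'a mpol set"
  assumes "finite B" "finite S" "rspan n S \<subseteq> free n B"
  shows "\<exists>g\<in>polys n. primitive g \<and> (\<forall>q\<in>free n B. \<forall>u\<in>polys n. primitive u \<longrightarrow> u * q \<in> rspan n S \<longrightarrow> g * q \<in> rspan n S)"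
  using assms
proof (induction B arbitrary: S rule: finite_induct)
  case empty
  have "q = 0" if "q \<in> free n {}" for q :: "'a mpol"
    using that unfolding free_def by (auto simp flip: keys_eq_empty)
  then have "\<forall>q\<in>free n {}. \<forall>u\<in>polys n. primitive u \<longrightarrow> u * q \<in> rspan n S \<longrightarrow> 1 * q \<in> rspan n S"
    by (metis mult_1 rspan_zero)
  then show ?case by (metis primitive_1 polys_1)
next
  case (insert \<beta> B)
  let ?K = "rspan n S"
  show ?case
  proof (cases "\<forall>s\<in>S. cpart n \<beta> s = 0")
    case True
    have "S \<subseteq> free n B"
      using True free_insert_drop insert.prems(2) rspan_base by blast
    then have "?K \<subseteq> free n B" by (rule rspan_least[OF submod_free])
    then obtain g where g: "g \<in> polys n" "primitive g" "\<forall>q\<in>free n B. \<forall>u\<in>polys n. primitive u \<longrightarrow> u * q \<in> ?K \<longrightarrow> g * q \<in> ?K"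
      using insert.IH[OF insert.prems(1)] by blast
    have z: "cpart n \<beta> p = 0" if "p \<in> ?K" for p
      using that by (induction p rule: rspan.induct) (simp_all add: cpart_add cpart_mult True)
    have gq: "g * q \<in> ?K" if q: "q \<in> free n (insert \<beta> B)" and u: "u \<in> polys n" "primitive u" "u * q \<in> ?K" for q u
    proof -
      have "u * cpart n \<beta> q = 0" using z[OF u(3)] u(1) by (simp add: cpart_mult)
      then have "cpart n \<beta> q = 0" using primitive_nonzero[OF u(2)] by simp
      then have "q \<in> free n B" using free_insert_drop q by blast
      then show ?thesis using g(3) u by blast
    qed
    show ?thesis using g(1,2) gq by (intro bexI[of _ g] conjI ballI impI)
  next
    case False
    then have ex: "\<exists>s\<in>S. cpart n \<beta> s \<noteq> 0" by blast
    obtain c b where cb: "c \<noteq> 0" "\<forall>s\<in>S. cpart n \<beta> s = const c * b s \<and> supp (b s) \<subseteq> supp (cpart n \<beta> s)"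
        "\<exists>s\<in>S. primitive (b s)"
      using family_content[OF insert.prems(1) ex] by (elim exE conjE)
    then obtain s0 where s0: "s0 \<in> S" "primitive (b s0)" by blast
    have b: "b s \<in> polys n" if "s \<in> S" for s
      using cb(2) that cpart_in_polys[of n \<beta> s] unfolding polys_def by blast
    have cs: "cpart n \<beta> s = const c * b s" if "s \<in> S" for s
      using cb(2) that by simp
    \<comment> \<open>\<open>s0\<close> is the pivot: its entry at \<open>\<beta>\<close> divides the others after localization, and \<open>b s0\<close> is the denominator\<close>
    let ?t = "\<lambda>s. b s0 * s - b s * s0"
    let ?K' = "rspan n (?t ` S)"
    have SK: "s \<in> ?K" if "s \<in> S" for s using that by (rule rspan_base)
    have tK: "?t s \<in> ?K" if "s \<in> S" for s
      by (intro submodD(5)[OF submod_rspan] submodD(3)[OF submod_rspan] b SK that s0(1))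
    have K'K: "?K' \<subseteq> ?K" using tK by (intro rspan_least[OF submod_rspan]) blast
    have "?t s \<in> free n B" if "s \<in> S" for s
    proof (rule free_insert_drop)
      show "?t s \<in> free n (insert \<beta> B)" using tK[OF that] insert.prems(2) by blast
      show "cpart n \<beta> (?t s) = 0"
        by (simp add: cpart_diff cpart_mult b that s0(1) cs)
    qed
    then have "?K' \<subseteq> free n B" by (intro rspan_least[OF submod_free]) blast
    then obtain g where g: "g \<in> polys n" "primitive g" "\<forall>q\<in>free n B. \<forall>u\<in>polys n. primitive u \<longrightarrow> u * q \<in> ?K' \<longrightarrow> g * q \<in> ?K'"
      using insert.IH[of "?t ` S"] insert.prems(1) by blast
    have gq: "(g * b s0) * q \<in> ?K" if q: "q \<in> free n (insert \<beta> B)" and u: "u \<in> polys n" "primitive u" "u * q \<in> ?K" for q u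
    proof -
      obtain d where d: "\<forall>s\<in>S. d s \<in> polys n" "u * q = (\<Sum>s\<in>S. d s * s)"
        using u(3) unfolding rspan_finite_sum[OF insert.prems(1)] by (elim exE conjE)
      have "u * cpart n \<beta> q = cpart n \<beta> (\<Sum>s\<in>S. d s * s)" using d(2) u(1) by (metis cpart_mult)
      also have "\<dots> = (\<Sum>s\<in>S. d s * (const c * b s))"
        unfolding cpart_sum using d(1) cb(2) by (intro sum.cong refl) (simp add: cpart_mult)
      also have "\<dots> = const c * (\<Sum>s\<in>S. d s * b s)" by (simp add: sum_distrib_left mult_ac)
      finally have ucq: "u * cpart n \<beta> q = const c * (\<Sum>s\<in>S. d s * b s)" .
      then obtain y where y: "cpart n \<beta> q = const c * y" "supp y \<subseteq> supp (cpart n \<beta> q)"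
        using primitive_cancel[OF u(2) _ cb(1)] by metis
      have yn: "y \<in> polys n" using y(2) cpart_in_polys[of n \<beta> q] unfolding polys_def by blast
      have "const c * (u * y) = const c * (\<Sum>s\<in>S. d s * b s)" using ucq y(1) by (simp add: mult_ac)
      then have uy: "u * y = (\<Sum>s\<in>S. d s * b s)" using cb(1) by simp
      let ?z = "b s0 * q - y * s0"
      have zf: "?z \<in> free n B"
      proof (rule free_insert_drop)
        show "?z \<in> free n (insert \<beta> B)"
          using SK[OF s0(1)] insert.prems(2)
          by (intro submodD(5)[OF submod_free] submodD(3)[OF submod_free] b[OF s0(1)] q yn) blast
        show "cpart n \<beta> ?z = 0"
          by (simp add: cpart_diff cpart_mult b s0(1) yn cs y(1))
      qed
      have "u * ?z = b s0 * (u * q) - (u * y) * s0" by (simp add: algebra_simps)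
      also have "\<dots> = (\<Sum>s\<in>S. d s * ?t s)"
        unfolding d(2) uy by (simp add: sum_distrib_left sum_distrib_right sum_subtractf algebra_simps)
      also have "\<dots> \<in> ?K'"
        by (rule rspan_lincomb[OF bspec[OF d(1)] rspan_base]) auto
      finally have "g * ?z \<in> ?K'" using g(3) zf u(1,2) by blast
      then have "g * ?z + (g * y) * s0 \<in> ?K"
        using K'K by (intro submodD(2)[OF submod_rspan] submodD(3)[OF submod_rspan polys_mult[OF g(1) yn] SK[OF s0(1)]]) blast
      then show ?thesis by (simp add: algebra_simps)
    qed
    show ?thesis using polys_mult[OF g(1) b[OF s0(1)]] primitive_mult[OF g(2) s0(2)] gq
      by (intro bexI[of _ "g * b s0"] conjI ballI impI)
  qed
qed

end

text \<open>Fraction-free Gaussian elimination, one coordinate at a time.\<close>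

lemma free_dependent:
  fixes v :: "'i \<Rightarrow> 'a::idom mpol"
  assumes "finite B" "finite I" "card B < card I" "\<And>i. i \<in> I \<Longrightarrow> v i \<in> free n B"
  shows "\<exists>a. (\<forall>i\<in>I. a i \<in> polys n) \<and> (\<exists>i\<in>I. a i \<noteq> 0) \<and> (\<Sum>i\<in>I. a i * v i) = 0"
  using assms
proof (induction B arbitrary: I v rule: finite_induct)
  case empty
  have "v i = 0" if "i \<in> I" for i
    using empty.prems(3)[OF that] unfolding free_def by (auto simp flip: keys_eq_empty)
  moreover obtain i where "i \<in> I" using empty.prems(2) by fastforce
  ultimately show ?case by (intro exI[of _ "\<lambda>_. 1"]) auto
next
  case (insert \<beta> B)
  show ?case
  proof (cases "\<forall>i\<in>I. cpart n \<beta> (v i) = 0")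
    case True
    show ?thesis
    proof (rule insert.IH)
      show "card B < card I" using insert.prems(2) insert.hyps by simp
      show "v i \<in> free n B" if "i \<in> I" for i
        using free_insert_drop insert.prems(3)[OF that] True that by blast
    qed (rule insert.prems(1))
  next
    case False
    then obtain j where j: "j \<in> I" "cpart n \<beta> (v j) \<noteq> 0" by blast
    let ?I = "I - {j}"
    let ?u = "\<lambda>i. cpart n \<beta> (v i)"
    have "\<exists>a. (\<forall>i\<in>?I. a i \<in> polys n) \<and> (\<exists>i\<in>?I. a i \<noteq> 0) \<and> (\<Sum>i\<in>?I. a i * (?u j * v i - ?u i * v j)) = 0"
    proof (rule insert.IH)
      show "finite ?I" "card B < card ?I" using insert.prems(1,2) insert.hyps j(1) by auto
      show "?u j * v i - ?u i * v j \<in> free n B" if "i \<in> ?I" for i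
      proof (rule free_insert_drop)
        show "?u j * v i - ?u i * v j \<in> free n (insert \<beta> B)"
          using insert.prems(3) that j(1) by (intro submodD(5)[OF submod_free] submodD(3)[OF submod_free] cpart_in_polys) auto
        show "cpart n \<beta> (?u j * v i - ?u i * v j) = 0"
          by (simp add: cpart_diff cpart_mult cpart_in_polys)
      qed
    qed
    then obtain a where a: "\<forall>i\<in>?I. a i \<in> polys n" "\<exists>i\<in>?I. a i \<noteq> 0" "(\<Sum>i\<in>?I. a i * (?u j * v i - ?u i * v j)) = 0"
      by (elim exE conjE)
    let ?a = "\<lambda>i. if i = j then - (\<Sum>i\<in>?I. a i * ?u i) else ?u j * a i"
    have "(\<Sum>i\<in>I. ?a i * v i) = ?a j * v j + (\<Sum>i\<in>?I. ?a i * v i)"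
      using insert.prems(1) j(1) by (rule sum.remove)
    also have "(\<Sum>i\<in>?I. ?a i * v i) = (\<Sum>i\<in>?I. ?u j * a i * v i)"
      by (intro sum.cong refl) auto
    also have "?a j * v j + \<dots> = (\<Sum>i\<in>?I. a i * (?u j * v i - ?u i * v j))"
      by (simp add: algebra_simps sum_subtractf sum_distrib_left)
    finally have "(\<Sum>i\<in>I. ?a i * v i) = 0" using a(3) by simp
    moreover have "\<forall>i\<in>I. ?a i \<in> polys n"
      using a(1) by (auto intro!: polys_uminus polys_sum polys_mult cpart_in_polys)
    moreover have "\<exists>i\<in>I. ?a i \<noteq> 0" using a(2) j by auto
    ultimately show ?thesis by (intro exI[of _ ?a] conjI)
  qed
qed

section \<open>Making polynomials monic in the last variable\<close>

definition ringhom :: "('a::comm_ring_1 mpol \<Rightarrow> 'a mpol) \<Rightarrow> bool" where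
  "ringhom \<rho> \<longleftrightarrow> \<rho> 1 = 1 \<and> (\<forall>p q. \<rho> (p + q) = \<rho> p + \<rho> q) \<and> (\<forall>p q. \<rho> (p * q) = \<rho> p * \<rho> q)"

lemma ringhomD:
  assumes "ringhom \<rho>"
  shows "\<rho> 1 = 1" "\<rho> (p + q) = \<rho> p + \<rho> q" "\<rho> (p * q) = \<rho> p * \<rho> q" "\<rho> 0 = 0"
    "\<rho> (- p) = - \<rho> p" "\<rho> (p - q) = \<rho> p - \<rho> q" "\<rho> (p ^ k) = \<rho> p ^ k"
    "\<rho> (sum f I) = (\<Sum>i\<in>I. \<rho> (f i))" "\<rho> (prod f I) = (\<Prod>i\<in>I. \<rho> (f i))"
proof -
  show 1: "\<rho> 1 = 1" and add: "\<rho> (p + q) = \<rho> p + \<rho> q" and mult: "\<rho> (p * q) = \<rho> p * \<rho> q" for p q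
    using assms unfolding ringhom_def by blast+
  show 0: "\<rho> 0 = 0"
    using add[of 0 0] by simp
  show neg: "\<rho> (- p) = - \<rho> p" for p
    using add[of p "- p"] 0 by (simp add: eq_neg_iff_add_eq_0 add.commute)
  show "\<rho> (p - q) = \<rho> p - \<rho> q"
    using add[of p "- q"] neg[of q] by simp
  show "\<rho> (p ^ k) = \<rho> p ^ k"
    by (induction k) (simp_all add: 1 mult)
  show "\<rho> (sum f I) = (\<Sum>i\<in>I. \<rho> (f i))"
    by (rule additive_sum[of \<rho>, OF 0 add])
  show "\<rho> (prod f I) = (\<Prod>i\<in>I. \<rho> (f i))"
    by (induction I rule: infinite_finite_induct) (simp_all add: 1 mult)
qed

lemma ringhom_id: "ringhom (\<lambda>p. p)"
  by (simp add: ringhom_def)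

lemma ringhom_compose: "ringhom \<rho> \<Longrightarrow> ringhom \<sigma> \<Longrightarrow> ringhom (\<lambda>p. \<rho> (\<sigma> p))"
  by (simp add: ringhom_def)

abbreviation var :: "nat \<Rightarrow> nat \<Rightarrow> 'a::comm_ring_1 mpol" where
  "var i k \<equiv> mpow (sgl i k)"

lemma var_add: "var i (j + k) = var i j * var i k"
  by (simp add: single_add mpow_add)

lemma var_power: "(var i 1 :: 'a::comm_ring_1 mpol) ^ k = var i k"
proof (induction k)
  case (Suc k)
  then show ?case using var_add[of i 1 k, where 'a = 'a] by simp
qed simp

lemma mpow_sum: "mpow (sum f I) = (\<Prod>i\<in>I. mpow (f i))"
  by (induction I rule: infinite_finite_induct) (simp_all add: mpow_add)

text \<open>The substitution \<open>X\<^sub>i \<mapsto> X\<^sub>i + s X\<^sub>m ^ N i\<close> for \<open>i < m\<close>, the other variables being kept.\<close>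

definition shear :: "nat \<Rightarrow> (nat \<Rightarrow> nat) \<Rightarrow> 'a::comm_ring_1 \<Rightarrow> 'a mpol \<Rightarrow> 'a mpol" where
  "shear m N s = lext (\<lambda>\<gamma> c. (\<Prod>i<m. (var i 1 + const s * var m (N i)) ^ lk \<gamma> i) * sgl (hi m \<gamma>) c)"

lemma shear_single:
  "shear m N s (sgl \<gamma> c) = (\<Prod>i<m. (var i 1 + const s * var m (N i)) ^ lk \<gamma> i) * sgl (hi m \<gamma>) c"
  unfolding shear_def by (subst lext_single) auto

lemma shear_hi: "hi m \<gamma> = \<gamma> \<Longrightarrow> shear m N s (sgl \<gamma> c) = sgl \<gamma> c"
proof -
  assume h: "hi m \<gamma> = \<gamma>"
  have "lk \<gamma> i = 0" if "i < m" for i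
    using that lookup_hi[of m \<gamma> i] unfolding h by simp
  then show ?thesis unfolding shear_single h by simp
qed

lemma shear_const: "shear m N s (const c) = const c"
  unfolding const_def by (rule shear_hi) simp

lemma ringhom_shear: "ringhom (shear m N s :: 'a::comm_ring_1 mpol \<Rightarrow> 'a mpol)"
proof -
  have add: "shear m N s (p + q) = shear m N s p + shear m N s q" for p q :: "'a mpol"
    unfolding shear_def by (rule lext_add) (auto simp: single_add algebra_simps)
  have zero: "shear m N s (0 :: 'a mpol) = 0"
    by (simp add: shear_def)
  have mult: "shear m N s (p * q) = shear m N s p * shear m N s q" for p q :: "'a mpol"
  proof (rule multiplicative_on_terms[where f = "shear m N s" and h = "shear m N s" and k = "shear m N s", OF zero add zero add zero add])
    fix \<gamma> \<delta> and c d :: 'a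
    have s: "sgl (hi m \<gamma> + hi m \<delta>) (c * d) = sgl (hi m \<gamma>) c * sgl (hi m \<delta>) d"
      by (simp add: mult_single)
    show "shear m N s (sgl (\<gamma> + \<delta>) (c * d)) =
        shear m N s (sgl \<gamma> c) * shear m N s (sgl \<delta> d)"
      unfolding shear_single lookup_add power_add prod.distrib hi_add s by (simp only: mult_ac)
  qed
  show ?thesis
    unfolding ringhom_def using add mult shear_const[of m N s 1] by simp
qed

lemma hi_single: "hi m (sgl i k) = (if i < m then 0 else sgl i k)"
  by (rule poly_mapping_eqI) (auto simp: lookup_single when_def)

lemma shear_var_less: "i < m \<Longrightarrow> shear m N s (var i 1) = var i 1 + const s * var m (N i)"
proof -
  assume i: "i < m"
  have "(\<Prod>j<m. (var j 1 + const s * var m (N j)) ^ lk (sgl i 1) j) =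
      (\<Prod>j<m. if j = i then var j 1 + const s * var m (N j) else 1)"
    by (intro prod.cong refl) (auto simp: lookup_single when_def)
  also have "\<dots> = var i 1 + const s * var m (N i)"
    using i by (simp add: prod.delta)
  finally show ?thesis
    using i unfolding mpow_def[of "sgl i 1"] shear_single
    by (simp add: hi_single mpow_def)
qed

lemma shear_var_last: "shear m N s (var m k) = var m k"
  unfolding mpow_def by (rule shear_hi) (simp add: hi_single)

lemma shear_inverse: "shear m N (- s) (shear m N s p) = (p :: 'a::comm_ring_1 mpol)"
proof (rule additive_eq_on_terms[where f = "\<lambda>p. shear m N (- s) (shear m N s p)" and h = "\<lambda>p. p"])
  note hom = ringhomD[OF ringhom_shear]
  fix \<gamma> and c :: 'a
  have v: "shear m N (- s) (var i 1 + const s * var m (N i)) = (var i 1 :: 'a mpol)" if "i < m" for i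
  proof -
    have "const (- s) = - (const s :: 'a mpol)"
      by (simp add: const_def single_uminus)
    then show ?thesis
      by (simp only: hom shear_var_less[OF that] shear_const shear_var_last) (simp add: algebra_simps)
  qed
  have "shear m N (- s) (shear m N s (sgl \<gamma> c)) = (\<Prod>i<m. (var i 1) ^ lk \<gamma> i) * sgl (hi m \<gamma>) c"
    unfolding shear_single[of m N s] hom(3,7,9) shear_hi[OF hi_idem]
    by (intro arg_cong2[where f = "(*)"] prod.cong refl) (simp only: v lessThan_iff)
  also have "(\<Prod>i<m. (var i 1) ^ lk \<gamma> i) = (mpow (\<Sum>i<m. sgl i (lk \<gamma> i)) :: 'a mpol)"
    unfolding mpow_sum var_power ..
  also have "(\<Sum>i<m. sgl i (lk \<gamma> i)) = lo m \<gamma>"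
    by (rule poly_mapping_eqI) (simp add: lookup_sum lookup_single when_def sum.delta')
  also have "mpow (lo m \<gamma>) * sgl (hi m \<gamma>) c = sgl \<gamma> c"
    by (simp add: mpow_def mult_single lo_plus_hi)
  finally show "shear m N (- s) (shear m N s (sgl \<gamma> c)) = sgl \<gamma> c" .
qed (simp_all add: ringhomD[OF ringhom_shear])

lemma var_in_polys [simp]: "i < n \<Longrightarrow> var i k \<in> polys n"
  by (intro polys_mpow) (auto simp: in_expos_iff lookup_single when_def)

lemma shear_free:
  assumes "p \<in> free (Suc m) B"
  shows "shear m N s p \<in> free (Suc m) B"
  unfolding shear_def lext_def
proof (rule submod_sum[OF submod_free])
  fix \<gamma> assume \<gamma>: "\<gamma> \<in> supp p"
  let ?P = "\<Prod>i<m. (var i 1 + const s * var m (N i)) ^ lk \<gamma> i"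
  have P: "?P \<in> polys (Suc m)"
    by (intro polys_prod polys_power polys_add polys_mult polys_const var_in_polys) auto
  have "hi (Suc m) (hi m \<gamma>) = hi (Suc m) \<gamma>"
    by (rule poly_mapping_eqI) simp
  then have "sgl (hi m \<gamma>) (lk p \<gamma>) \<in> free (Suc m) B"
    using assms \<gamma> unfolding free_def by auto
  then show "?P * sgl (hi m \<gamma>) (lk p \<gamma>) \<in> free (Suc m) B"
    by (rule submodD(3)[OF submod_free P])
qed

lemma shear_polys: "p \<in> polys (Suc m) \<Longrightarrow> shear m N s p \<in> polys (Suc m)"
  using shear_free[of p m "{0}"] unfolding free_zero_basis .

lemma shear_rspan: "shear m N s ` rspan (Suc m) S = rspan (Suc m) (shear m N s ` S)"
proof -
  note hom = ringhomD[OF ringhom_shear]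
  have 1: "shear m N s ` rspan (Suc m) S \<subseteq> rspan (Suc m) (shear m N s ` S)" for s and S :: "'a mpol set"
  proof (rule image_subsetI)
    fix p assume "p \<in> rspan (Suc m) S"
    then show "shear m N s p \<in> rspan (Suc m) (shear m N s ` S)"
      by (induction p rule: rspan.induct) (auto simp: hom shear_polys intro: rspan.rspan_step)
  qed
  have "p \<in> shear m N s ` rspan (Suc m) S" if "p \<in> rspan (Suc m) (shear m N s ` S)" for p
  proof -
    have "shear m N (- s) ` shear m N s ` S = S"
      by (simp add: image_image shear_inverse)
    then have "shear m N (- s) p \<in> rspan (Suc m) S"
      using 1[of "- s" "shear m N s ` S"] that by auto
    then show ?thesis
      using shear_inverse[of m N "- s" p] by (intro image_eqI[of _ _ "shear m N (- s) p"]) simp_all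
  qed
  then show ?thesis using 1 by blast
qed

section \<open>Degree in the last variable\<close>

definition low_deg :: "nat \<Rightarrow> nat \<Rightarrow> 'a::comm_ring_1 mpol \<Rightarrow> bool" where
  "low_deg m d r \<longleftrightarrow> (\<forall>\<gamma>\<in>supp r. lk \<gamma> m < d)"

lemma low_deg_add: "low_deg m d p \<Longrightarrow> low_deg m d q \<Longrightarrow> low_deg m d (p + q)"
  unfolding low_deg_def using Poly_Mapping.keys_add[of p q] by blast

lemma low_deg_uminus: "low_deg m d p \<Longrightarrow> low_deg m d (- p)"
  unfolding low_deg_def by simp

lemma low_deg_diff: "low_deg m d p \<Longrightarrow> low_deg m d q \<Longrightarrow> low_deg m d (p - q)"
  using low_deg_add[of m d p "- q"] low_deg_uminus[of m d q] by simp

lemma low_deg_0 [simp]: "low_deg m d 0"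
  by (simp add: low_deg_def)

lemma low_deg_sum: "(\<And>i. i \<in> I \<Longrightarrow> low_deg m d (f i)) \<Longrightarrow> low_deg m d (sum f I)"
  by (induction I rule: infinite_finite_induct) (auto intro: low_deg_add)

lemma low_deg_mono: "low_deg m d p \<Longrightarrow> d \<le> e \<Longrightarrow> low_deg m e p"
  unfolding low_deg_def by fastforce

lemma low_deg_mult: "low_deg m a p \<Longrightarrow> low_deg m (Suc b) q \<Longrightarrow> low_deg m (a + b) (p * q)"
  unfolding low_deg_def
proof
  fix \<gamma> assume p: "\<forall>\<gamma>\<in>supp p. lk \<gamma> m < a" and q: "\<forall>\<gamma>\<in>supp q. lk \<gamma> m < Suc b"
    and "\<gamma> \<in> supp (p * q)"
  then obtain x y where xy: "x \<in> supp p" "y \<in> supp q" "\<gamma> = x + y"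
    using Poly_Mapping.keys_mult[of p q] by blast
  then have "lk x m < a" "lk y m < Suc b" using p q by blast+
  then show "lk \<gamma> m < a + b" unfolding xy(3) lookup_add by simp
qed

lemma low_deg_const_mult: "low_deg m d p \<Longrightarrow> low_deg m d (const c * p)"
  unfolding low_deg_def const_def using keys_single_mult[of 0 c p] by auto

lemma low_deg_var: "low_deg m (Suc d) (var m d :: 'a::comm_ring_1 mpol)"
  unfolding low_deg_def mpow_def by simp

definition monic_at :: "nat \<Rightarrow> nat \<Rightarrow> 'a::comm_ring_1 mpol \<Rightarrow> bool" where
  "monic_at m d p \<longleftrightarrow> low_deg m d (p - var m d)"

lemma monic_at_mult:
  assumes "monic_at m a p" "monic_at m b q"
  shows "monic_at m (a + b) (p * q)"
proof -
  let ?r = "p - var m a" and ?s = "q - var m b"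
  have r: "low_deg m a ?r" and s: "low_deg m b ?s" using assms unfolding monic_at_def .
  have "p * q - var m (a + b) = ?r * var m b + ?s * var m a + ?r * ?s"
    by (simp add: var_add algebra_simps)
  moreover have "low_deg m (a + b) (?r * var m b)" by (rule low_deg_mult[OF r low_deg_var])
  moreover have "low_deg m (a + b) (?s * var m a)"
    using low_deg_mult[OF s low_deg_var, of a] by (simp add: add.commute)
  moreover have "low_deg m (a + b) (?r * ?s)"
    by (rule low_deg_mult[OF r low_deg_mono[OF s]]) simp
  ultimately show ?thesis unfolding monic_at_def by (metis low_deg_add)
qed

lemma monic_at_1: "monic_at m 0 1"
  unfolding monic_at_def by simp

lemma monic_at_power: "monic_at m d p \<Longrightarrow> monic_at m (k * d) (p ^ k)"
  by (induction k) (simp_all add: monic_at_1 monic_at_mult)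

lemma monic_at_prod: "(\<And>i. i \<in> I \<Longrightarrow> monic_at m (d i) (p i)) \<Longrightarrow> monic_at m (sum d I) (prod p I)"
  by (induction I rule: infinite_finite_induct) (simp_all add: monic_at_1 monic_at_mult)

lemma digits_unique:
  fixes a b :: "nat \<Rightarrow> nat"
  assumes "\<And>i. i < k \<Longrightarrow> a i < E" "\<And>i. i < k \<Longrightarrow> b i < E" "(\<Sum>i<k. a i * E ^ i) = (\<Sum>i<k. b i * E ^ i)" "i < k"
  shows "a i = b i"
  using assms
proof (induction k arbitrary: a b i)
  case (Suc k)
  have split: "(\<Sum>i<Suc k. c i * E ^ i) = c 0 + E * (\<Sum>i<k. c (Suc i) * E ^ i)" for c :: "nat \<Rightarrow> nat"
    unfolding sum.lessThan_Suc_shift by (simp add: sum_distrib_left mult_ac)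
  have eq: "a 0 + E * (\<Sum>i<k. a (Suc i) * E ^ i) = b 0 + E * (\<Sum>i<k. b (Suc i) * E ^ i)"
    using Suc.prems(3) unfolding split .
  have ab: "a 0 < E" "b 0 < E" using Suc.prems(1,2) by auto
  have 0: "a 0 = b 0"
    using arg_cong[OF eq, of "\<lambda>x. x mod E"] ab by simp
  have "(\<Sum>i<k. a (Suc i) * E ^ i) = (\<Sum>i<k. b (Suc i) * E ^ i)"
    using eq ab unfolding 0 by simp
  then have "a (Suc j) = b (Suc j)" if "j < k" for j
    using Suc.IH[of "\<lambda>i. a (Suc i)" "\<lambda>i. b (Suc i)" j] Suc.prems(1,2) that by simp
  then show ?case using 0 Suc.prems(4) by (cases i) auto
qed simp

text \<open>
  The powers of a base larger than all exponents: the weighted degree then has the exponents as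
  its digits.
\<close>

lemma separating_weights:
  assumes "finite F" "F \<subseteq> expos (Suc m)"
  obtains N :: "nat \<Rightarrow> nat" where "\<And>i. N i > 0" "inj_on (\<lambda>\<gamma>. (\<Sum>i<m. lk \<gamma> i * N i) + lk \<gamma> m) F"
proof -
  define E where "E = Suc (Max (insert 0 (\<Union>\<gamma>\<in>F. lk \<gamma> ` {..m})))"
  have fin: "finite (\<Union>\<gamma>\<in>F. lk \<gamma> ` {..m})" using assms(1) by blast
  have bound: "lk \<gamma> i < E" if "\<gamma> \<in> F" "i \<le> m" for \<gamma> i
  proof -
    have "lk \<gamma> i \<le> Max (insert 0 (\<Union>\<gamma>\<in>F. lk \<gamma> ` {..m}))"
      using fin that by (intro Max_ge) auto
    then show ?thesis unfolding E_def by simp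
  qed
  let ?d = "\<lambda>\<gamma> i. if i = 0 then lk \<gamma> m else lk \<gamma> (i - 1)"
  have repr: "(\<Sum>i<m. lk \<gamma> i * E ^ Suc i) + lk \<gamma> m = (\<Sum>i<Suc m. ?d \<gamma> i * E ^ i)" for \<gamma> :: expo
    unfolding sum.lessThan_Suc_shift by simp
  show ?thesis
  proof (rule that[of "\<lambda>i. E ^ Suc i"])
    show "E ^ Suc i > 0" for i unfolding E_def by simp
    show "inj_on (\<lambda>\<gamma>. (\<Sum>i<m. lk \<gamma> i * E ^ Suc i) + lk \<gamma> m) F"
    proof (rule inj_onI)
      fix x y assume xy: "x \<in> F" "y \<in> F" "(\<Sum>i<m. lk x i * E ^ Suc i) + lk x m = (\<Sum>i<m. lk y i * E ^ Suc i) + lk y m"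
      have d: "?d x i = ?d y i" if "i < Suc m" for i
      proof (rule digits_unique[of "Suc m" "?d x" E "?d y", OF _ _ _ that])
        show "?d x j < E" if "j < Suc m" for j using that bound[OF xy(1)] by auto
        show "?d y j < E" if "j < Suc m" for j using that bound[OF xy(2)] by auto
        show "(\<Sum>i<Suc m. ?d x i * E ^ i) = (\<Sum>i<Suc m. ?d y i * E ^ i)"
          using xy(3) unfolding repr .
      qed
      show "x = y"
      proof (rule poly_mapping_eqI)
        fix i
        consider "i < m" | "i = m" | "i > m" by linarith
        then show "lk x i = lk y i"
        proof cases
          case 1
          then show ?thesis using d[of "Suc i"] by simp
        next
          case 2
          then show ?thesis using d[of 0] by simp
        next
          case 3
          then show ?thesis using assms(2) xy(1,2) in_expos_iff[of _ "Suc m"] by (metis Suc_leI subsetD)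
        qed
      qed
    qed
  qed
qed

text \<open>
  Nagata's change of variables. It needs every coefficient to be a unit, since the term that
  dominates after the change can be any of them.
\<close>

lemma shear_monic:
  fixes g :: "'a::comm_ring_1 mpol"
  assumes "g \<in> polys (Suc m)" "g \<noteq> 0" "\<And>\<gamma>. \<gamma> \<in> supp g \<Longrightarrow> lk g \<gamma> dvd 1"
  obtains N d u where "u dvd 1" "low_deg m d (shear m N 1 g - const u * var m d)"
proof -
  let ?K = "supp g"
  obtain N where N: "\<And>i. N i > 0" and inj: "inj_on (\<lambda>\<gamma>. (\<Sum>i<m. lk \<gamma> i * N i) + lk \<gamma> m) ?K"
    using separating_weights[of ?K m] assms(1) unfolding polys_def by auto
  define w where "w \<gamma> = (\<Sum>i<m. lk \<gamma> i * N i) + lk \<gamma> m" for \<gamma>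
  have fin: "finite (w ` ?K)" and ne: "w ` ?K \<noteq> {}" using assms(2) by auto
  obtain \<gamma> where \<gamma>: "\<gamma> \<in> ?K" "w \<gamma> = Max (w ` ?K)" using Max_in[OF fin ne] by auto
  have less: "w \<delta> < w \<gamma>" if "\<delta> \<in> ?K - {\<gamma>}" for \<delta>
  proof -
    have "w \<delta> \<le> w \<gamma>" using fin that unfolding \<gamma>(2) by (intro Max_ge) auto
    moreover have "w \<delta> \<noteq> w \<gamma>" using inj that \<gamma>(1) unfolding inj_on_def w_def by blast
    ultimately show ?thesis by simp
  qed
  have mono: "monic_at m (w \<delta>) ((\<Prod>i<m. (var i 1 + const 1 * var m (N i)) ^ lk \<delta> i) * var m (lk \<delta> m) :: 'a mpol)" for \<delta>
    unfolding w_def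
  proof (intro monic_at_mult monic_at_prod monic_at_power)
    fix i assume i: "i \<in> {..<m}"
    have "low_deg m (N i) (var i 1 :: 'a mpol)"
      using i N[of i] unfolding low_deg_def mpow_def by (auto simp: lookup_single when_def)
    then show "monic_at m (N i) (var i 1 + const 1 * var m (N i) :: 'a mpol)"
      unfolding monic_at_def by simp
  qed (simp add: monic_at_def)
  have tm: "shear m N 1 (sgl \<delta> c) = const c * ((\<Prod>i<m. (var i 1 + const 1 * var m (N i)) ^ lk \<delta> i) * var m (lk \<delta> m))"
    if "\<delta> \<in> ?K" for \<delta> and c :: 'a
  proof -
    have "hi m \<delta> = sgl m (lk \<delta> m)"
      using assms(1) that in_expos_iff[of \<delta> "Suc m"] unfolding polys_def
      by (intro poly_mapping_eqI) (auto simp: lookup_single when_def)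
    then show ?thesis unfolding shear_single by (simp add: single_eq_const_mpow mult_ac)
  qed
  have diff: "low_deg m (w \<delta>) (shear m N 1 (sgl \<delta> c) - const c * var m (w \<delta>))" if "\<delta> \<in> ?K" for \<delta> and c :: 'a
    using low_deg_const_mult[OF mono[of \<delta>, unfolded monic_at_def], of c] unfolding tm[OF that] by (simp add: algebra_simps)
  have low: "low_deg m (w \<gamma>) (shear m N 1 (sgl \<delta> c))" if "\<delta> \<in> ?K - {\<gamma>}" for \<delta> and c :: 'a
  proof -
    have "low_deg m (Suc (w \<delta>)) (shear m N 1 (sgl \<delta> c) - const c * var m (w \<delta>) + const c * var m (w \<delta>))"
      using that by (intro low_deg_add low_deg_const_mult low_deg_var low_deg_mono[OF diff]) auto
    then show ?thesis using less[OF that] by (auto intro: low_deg_mono)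
  qed
  have "g = (\<Sum>\<delta>\<in>?K. sgl \<delta> (lk g \<delta>))" by (rule mpol_sum_single)
  also have "\<dots> = sgl \<gamma> (lk g \<gamma>) + (\<Sum>\<delta>\<in>?K - {\<gamma>}. sgl \<delta> (lk g \<delta>))"
    using \<gamma>(1) by (intro sum.remove) auto
  finally have "shear m N 1 g = shear m N 1 (sgl \<gamma> (lk g \<gamma>) + (\<Sum>\<delta>\<in>?K - {\<gamma>}. sgl \<delta> (lk g \<delta>)))"
    by (rule arg_cong[of _ _ "shear m N 1"])
  also have "\<dots> = shear m N 1 (sgl \<gamma> (lk g \<gamma>)) + (\<Sum>\<delta>\<in>?K - {\<gamma>}. shear m N 1 (sgl \<delta> (lk g \<delta>)))"
    by (simp only: ringhomD(2,8)[OF ringhom_shear])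
  finally have sg: "shear m N 1 g = \<dots>" .
  have "shear m N 1 g - const (lk g \<gamma>) * var m (w \<gamma>) =
     (shear m N 1 (sgl \<gamma> (lk g \<gamma>)) - const (lk g \<gamma>) * var m (w \<gamma>)) + (\<Sum>\<delta>\<in>?K - {\<gamma>}. shear m N 1 (sgl \<delta> (lk g \<delta>)))"
    unfolding sg by (simp only: add_diff_eq diff_add_eq)
  moreover have "low_deg m (w \<gamma>) \<dots>"
    by (intro low_deg_add low_deg_sum diff low \<gamma>(1))
  ultimately have "low_deg m (w \<gamma>) (shear m N 1 g - const (lk g \<gamma>) * var m (w \<gamma>))"
    by (simp only:)
  with assms(3)[OF \<gamma>(1)] show ?thesis by (rule that)
qed

section \<open>Division by a monic polynomial\<close>

lemma monic_division:
  fixes h :: "'a::comm_ring_1 mpol"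
  assumes h: "monic_at m d h" "h \<in> polys (Suc m)" and p: "p \<in> free (Suc m) B"
  shows "\<exists>q\<in>free (Suc m) B. \<exists>r\<in>free (Suc m) B. p = h * q + r \<and> low_deg m d r"
proof -
  let ?D = "{p. \<exists>q\<in>free (Suc m) B. \<exists>r\<in>free (Suc m) B. p = h * q + r \<and> low_deg m d r}"
  have D0: "0 \<in> ?D"
    using submodD(1)[OF submod_free] by (intro CollectI bexI[of _ 0]) auto
  have Dadd: "x + y \<in> ?D" if x: "x \<in> ?D" and y: "y \<in> ?D" for x y
  proof -
    obtain q r where 1: "q \<in> free (Suc m) B" "r \<in> free (Suc m) B" "x = h * q + r" "low_deg m d r" using x by blast
    obtain q' r' where 2: "q' \<in> free (Suc m) B" "r' \<in> free (Suc m) B" "y = h * q' + r'" "low_deg m d r'" using y by blast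
    have "x + y = h * (q + q') + (r + r')" unfolding 1 2 by (simp add: algebra_simps)
    then show ?thesis using 1 2 submodD(2)[OF submod_free] low_deg_add by (intro CollectI bexI[of _ "q + q'"] bexI[of _ "r + r'"]) auto
  qed
  have Dsum: "sum f I \<in> ?D" if "\<And>i. i \<in> I \<Longrightarrow> f i \<in> ?D" for f and I :: "expo set"
    using that by (induction I rule: infinite_finite_induct) (use D0 Dadd in \<open>auto simp del: mem_Collect_eq\<close>)
  have Dsingle: "sgl \<gamma> c \<in> ?D" if "hi (Suc m) \<gamma> \<in> B" for \<gamma> and c :: 'a
    using that
  proof (induction "lk \<gamma> m" arbitrary: \<gamma> c rule: less_induct)
    case less
    have f: "sgl \<gamma> c \<in> free (Suc m) B" using less.prems unfolding free_def by simp
    show ?case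
    proof (cases "lk \<gamma> m < d")
      case True
      then have "low_deg m d (sgl \<gamma> c)" unfolding low_deg_def by simp
      then show ?thesis using f submodD(1)[OF submod_free]
        by (intro CollectI bexI[of _ 0] bexI[of _ "sgl \<gamma> c"]) auto
    next
      case False
      let ?X = "sgl m d"
      define \<delta> where "\<delta> = \<gamma> - ?X"
      have \<gamma>: "\<gamma> = ?X + \<delta>"
        unfolding \<delta>_def using False by (intro poly_mapping_eqI) (auto simp: lookup_add lookup_minus lookup_single when_def)
      have hi\<delta>: "hi (Suc m) \<delta> = hi (Suc m) \<gamma>" unfolding \<gamma> by (simp add: hi_single)
      let ?s = "sgl \<delta> c" and ?r = "h - var m d"
      have sf: "?s \<in> free (Suc m) B" using less.prems hi\<delta> unfolding free_def by simp
      have rf: "?r \<in> polys (Suc m)" by (rule polys_diff[OF h(2)]) simp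
      have eq: "sgl \<gamma> c = h * ?s + - (?r * ?s)"
        unfolding \<gamma> by (simp add: algebra_simps mpow_def mult_single)
      have low: "low_deg m (lk \<gamma> m) (- (?r * ?s))"
      proof -
        have "low_deg m (Suc (lk \<delta> m)) ?s" unfolding low_deg_def by simp
        then have "low_deg m (d + lk \<delta> m) (?r * ?s)"
          using low_deg_mult[OF h(1)[unfolded monic_at_def]] by blast
        then show ?thesis unfolding \<gamma> by (intro low_deg_uminus) (simp add: lookup_add)
      qed
      have rsf: "- (?r * ?s) \<in> free (Suc m) B"
        using submodD(3)[OF submod_free rf sf] submodD(4)[OF submod_free] by blast
      have "(\<Sum>\<kappa>\<in>supp (- (?r * ?s)). sgl \<kappa> (lk (- (?r * ?s)) \<kappa>)) \<in> ?D"
      proof (rule Dsum)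
        fix \<kappa> assume \<kappa>: "\<kappa> \<in> supp (- (?r * ?s))"
        show "sgl \<kappa> (lk (- (?r * ?s)) \<kappa>) \<in> ?D"
        proof (rule less.hyps)
          show "lk \<kappa> m < lk \<gamma> m" using low \<kappa> unfolding low_deg_def by blast
          show "hi (Suc m) \<kappa> \<in> B" using rsf \<kappa> unfolding free_def by blast
        qed
      qed
      then have "- (?r * ?s) \<in> ?D" by (simp only: mpol_sum_single[symmetric])
      moreover have "h * ?s \<in> ?D" using sf submodD(1)[OF submod_free]
        by (intro CollectI bexI[of _ ?s] bexI[of _ 0]) auto
      ultimately show ?thesis unfolding eq using Dadd by blast
    qed
  qed
  have "(\<Sum>\<kappa>\<in>supp p. sgl \<kappa> (lk p \<kappa>)) \<in> ?D"
    using p by (intro Dsum Dsingle) (auto simp: free_def)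
  then have "p \<in> ?D" by (simp only: mpol_sum_single[symmetric])
  then show ?thesis by (rule CollectD)
qed

lemma monic_multiple_low_deg:
  fixes h :: "'a::comm_ring_1 mpol"
  assumes h: "monic_at m d h" and low: "low_deg m d (h * q)"
  shows "q = 0"
proof (rule ccontr)
  assume "q \<noteq> 0"
  then have fin: "finite ((\<lambda>\<gamma>. lk \<gamma> m) ` supp q)" and ne: "(\<lambda>\<gamma>. lk \<gamma> m) ` supp q \<noteq> {}"
    by auto
  obtain \<gamma> where \<gamma>: "\<gamma> \<in> supp q" "lk \<gamma> m = Max ((\<lambda>\<gamma>. lk \<gamma> m) ` supp q)"
    using Max_in[OF fin ne] by auto
  have q: "low_deg m (Suc (lk \<gamma> m)) q"
    unfolding low_deg_def \<gamma>(2) less_Suc_eq_le using fin by (auto intro: Max_ge)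
  let ?X = "sgl m d"
  have "low_deg m (d + lk \<gamma> m) ((h - var m d) * q)"
    by (rule low_deg_mult[OF h[unfolded monic_at_def] q])
  then have "?X + \<gamma> \<notin> supp ((h - var m d) * q)"
    unfolding low_deg_def by (auto simp: lookup_add)
  then have "lk ((h - var m d) * q) (?X + \<gamma>) = 0" by (simp add: in_keys_iff)
  moreover have "lk (var m d * q) (?X + \<gamma>) = lk q \<gamma>"
    unfolding mpow_def by (simp add: lookup_single_mult)
  moreover have "h * q = var m d * q + (h - var m d) * q" by (simp add: algebra_simps)
  ultimately have "lk (h * q) (?X + \<gamma>) = lk q \<gamma>" by (simp only: lookup_add) simp
  then have "?X + \<gamma> \<in> supp (h * q)" using \<gamma>(1) by (simp add: in_keys_iff)
  then show False using low unfolding low_deg_def by (auto simp: lookup_add)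
qed

section \<open>Torsion of finitely presented modules is bounded\<close>

locale archimedean_valuation_domain = valuation_domain V for V :: "'a::idom itself" +
  assumes archimedean: "(a::'a) \<noteq> 0 \<Longrightarrow> \<not> b dvd 1 \<Longrightarrow> \<exists>k. a dvd b ^ k"

text \<open>
  The quotient \<open>L / M\<close> as a finitely presented module over \<^term>\<open>polys n\<close>, which acts through \<open>\<rho>\<close>. The map
  \<open>\<Psi>\<close> sends a free module of finite rank onto it with finitely generated kernel. Both \<open>M\<close> and \<open>L\<close> are
  modules over a larger ring \<open>D\<close>, whose elements thereby act as endomorphisms. While the number
  of variables decreases, \<open>D\<close> and \<open>M\<close> stay the same and \<open>L\<close> shrinks; only the coordinates \<open>\<rho>\<close>, \<open>\<Psi>\<close>
  are replaced.
\<close>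

locale presentation =
  fixes D :: "'a::idom mpol set" and n :: nat and \<rho> :: "'a mpol \<Rightarrow> 'a mpol" and B :: "expo set"
    and \<Psi> :: "'a mpol \<Rightarrow> 'a mpol" and M L :: "'a mpol set"
  assumes D_one: "1 \<in> D"
    and D_add: "x \<in> D \<Longrightarrow> y \<in> D \<Longrightarrow> x + y \<in> D"
    and D_mult: "x \<in> D \<Longrightarrow> y \<in> D \<Longrightarrow> x * y \<in> D"
    and D_uminus: "x \<in> D \<Longrightarrow> - x \<in> D"
    and M_zero: "0 \<in> M"
    and M_add: "x \<in> M \<Longrightarrow> y \<in> M \<Longrightarrow> x + y \<in> M"
    and M_mult: "d \<in> D \<Longrightarrow> x \<in> M \<Longrightarrow> d * x \<in> M"
    and L_add: "x \<in> L \<Longrightarrow> y \<in> L \<Longrightarrow> x + y \<in> L"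
    and L_mult: "d \<in> D \<Longrightarrow> x \<in> L \<Longrightarrow> d * x \<in> L"
    and M_L: "M \<subseteq> L"
    and B_fin: "finite B"
    and B_hi: "\<beta> \<in> B \<Longrightarrow> hi n \<beta> = \<beta>"
    and hom: "ringhom \<rho>"
    and \<rho>_D: "a \<in> polys n \<Longrightarrow> \<rho> a \<in> D"
    and \<Psi>_add: "\<Psi> (p + q) = \<Psi> p + \<Psi> q"
    and \<Psi>_mult: "a \<in> polys n \<Longrightarrow> \<Psi> (a * p) = \<rho> a * \<Psi> p"
    and \<Psi>_L: "p \<in> free n B \<Longrightarrow> \<Psi> p \<in> L"
    and generates: "x \<in> L \<Longrightarrow> \<exists>q\<in>free n B. x - \<Psi> q \<in> M"
    and relations_fgm: "fgm n {q \<in> free n B. \<Psi> q \<in> M}"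
begin

lemma D_zero: "0 \<in> D"
  using D_add[OF D_one D_uminus[OF D_one]] by simp

lemma D_power: "x \<in> D \<Longrightarrow> x ^ k \<in> D"
  by (induction k) (simp_all add: D_one D_mult)

lemma D_sum: "(\<And>i. i \<in> I \<Longrightarrow> h i \<in> D) \<Longrightarrow> sum h I \<in> D"
  by (induction I rule: infinite_finite_induct) (simp_all add: D_zero D_add)

lemma M_uminus: "x \<in> M \<Longrightarrow> - x \<in> M"
  using M_mult[OF D_uminus[OF D_one], of x] by simp

lemma M_diff: "x \<in> M \<Longrightarrow> y \<in> M \<Longrightarrow> x - y \<in> M"
  using M_add[of x "- y"] M_uminus[of y] by simp

lemma M_sum: "(\<And>i. i \<in> I \<Longrightarrow> h i \<in> M) \<Longrightarrow> sum h I \<in> M"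
  by (induction I rule: infinite_finite_induct) (simp_all add: M_zero M_add)

lemma M_congD: "x - y \<in> M \<Longrightarrow> y \<in> M \<Longrightarrow> x \<in> M"
  using M_add[of "x - y" y] by simp

lemma M_congD': "x - y \<in> M \<Longrightarrow> x \<in> M \<Longrightarrow> y \<in> M"
  using M_diff[of x "x - y"] by simp

lemma \<Psi>_0: "\<Psi> 0 = 0"
  using \<Psi>_add[of 0 0] unfolding add_0_right add_cancel_right_right .

lemma \<Psi>_sum: "\<Psi> (sum h I) = (\<Sum>i\<in>I. \<Psi> (h i))"
  by (rule additive_sum[of \<Psi>, OF \<Psi>_0 \<Psi>_add])

lemma mult_cong: "x - y \<in> M \<Longrightarrow> d \<in> D \<Longrightarrow> d * x - d * y \<in> M"
  using M_mult[of d "x - y"] by (simp add: algebra_simps)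

text \<open>The difference of the two powers is divisible by \<open>P\<close>.\<close>

lemma power_modulo_annihilator:
  assumes "P \<in> D" "Z \<in> D" "\<And>x. x \<in> L \<Longrightarrow> P * x \<in> M" "x \<in> L"
  shows "(P + Z) ^ e * x - Z ^ e * x \<in> M"
proof (induction e)
  case (Suc e)
  have "(P + Z) ^ Suc e * x - Z ^ Suc e * x = (P + Z) * ((P + Z) ^ e * x - Z ^ e * x) + Z ^ e * (P * x)"
    by (simp add: algebra_simps)
  also have "\<dots> \<in> M"
    by (rule M_add[OF M_mult[OF D_add[OF assms(1,2)] Suc.IH] M_mult[OF D_power[OF assms(2)] assms(3)[OF assms(4)]]])
  finally show ?case .
qed (simp add: M_zero)

text \<open>
  Every term of the expanded power contains \<open>p ^ e\<close> or \<open>q ^ j\<close>.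
\<close>

lemma power_sum_torsion:
  assumes "p \<in> D" "q \<in> D" "p ^ e * y \<in> M" "q ^ j * y \<in> M"
  shows "(p + q) ^ (e + j) * y \<in> M"
  using assms(3,4)
proof (induction "e + j" arbitrary: e j y)
  case 0
  then show ?case by simp
next
  case (Suc k)
  show ?case
  proof (cases "e = 0 \<or> j = 0")
    case True
    then have "y \<in> M" using Suc.prems by auto
    then show ?thesis using assms by (intro M_mult D_power D_add)
  next
    case False
    then obtain e' j' where ej: "e = Suc e'" "j = Suc j'" by (meson not0_implies_Suc)
    have "(p + q) ^ (e' + j) * (p * y) \<in> M"
    proof (rule Suc.hyps)
      show "p ^ e' * (p * y) \<in> M" using Suc.prems(1) unfolding ej by (simp add: mult_ac)
      show "q ^ j * (p * y) \<in> M" using M_mult[OF assms(1) Suc.prems(2)] by (simp add: mult_ac)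
    qed (use Suc.hyps(2) ej in simp)
    moreover have "(p + q) ^ (e + j') * (q * y) \<in> M"
    proof (rule Suc.hyps)
      show "q ^ j' * (q * y) \<in> M" using Suc.prems(2) unfolding ej by (simp add: mult_ac)
      show "p ^ e * (q * y) \<in> M" using M_mult[OF assms(2) Suc.prems(1)] by (simp add: mult_ac)
    qed (use Suc.hyps(2) ej in simp)
    moreover have "(p + q) ^ (e + j) * y = (p + q) ^ (e' + j) * (p * y) + (p + q) ^ (e + j') * (q * y)"
      unfolding ej by (simp add: algebra_simps)
    ultimately show ?thesis using M_add by simp
  qed
qed

end

lemma basis_map_mpow:
  assumes "finite B" "\<beta> \<in> B" "hi n \<beta> = \<beta>"
  shows "basis_map n B y (mpow \<beta>) = y \<beta>"
proof -
  have "basis_map n B y (mpow \<beta>) = (\<Sum>\<gamma>\<in>B. if \<beta> = \<gamma> then y \<gamma> else 0)"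
    unfolding basis_map_def using cpart_mult_mpow[OF polys_1 assms(3), where 'a = 'a]
    by (intro sum.cong refl) simp
  then show ?thesis using assms(1,2) by simp
qed

lemma free_eq_rspan:
  assumes "finite B" "\<And>\<beta>. \<beta> \<in> B \<Longrightarrow> hi n \<beta> = \<beta>"
  shows "(free n B :: 'a::comm_ring_1 mpol set) = rspan n (mpow ` B)"
proof
  show "rspan n (mpow ` B) \<subseteq> free n B"
    using assms(2) by (intro rspan_least[OF submod_free]) (auto intro: mpow_in_free)
  show "(free n B :: 'a mpol set) \<subseteq> rspan n (mpow ` B)"
  proof
    fix p :: "'a mpol" assume "p \<in> free n B"
    then have "p = (\<Sum>\<beta>\<in>B. cpart n \<beta> p * mpow \<beta>)" by (rule free_expand[OF assms(1)])
    moreover have "(\<Sum>\<beta>\<in>B. cpart n \<beta> p * mpow \<beta>) \<in> rspan n (mpow ` B)"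
      by (rule rspan_lincomb[OF cpart_in_polys rspan_base]) simp
    ultimately show "p \<in> rspan n (mpow ` B)" by (rule ssubst)
  qed
qed

lemma free_cover:
  assumes "finite G"
  obtains B and \<Theta> :: "'a::comm_ring_1 mpol \<Rightarrow> 'a mpol" where "finite B" "\<And>\<beta>. \<beta> \<in> B \<Longrightarrow> hi n \<beta> = \<beta>" "linear_over n \<Theta>"
    "\<Theta> ` free n B = rspan n G"
proof -
  obtain j :: "'a mpol \<Rightarrow> expo" where j: "inj_on j G" "\<And>s. s \<in> G \<Longrightarrow> hi n (j s) = j s"
    using fresh_basis[OF assms, of "{}" n] by auto
  let ?B = "j ` G" and ?y = "inv_into G j"
  have B: "finite ?B" "\<And>\<beta>. \<beta> \<in> ?B \<Longrightarrow> hi n \<beta> = \<beta>" using assms j(2) by auto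
  have "basis_map n ?B ?y ` mpow ` ?B = (\<lambda>s. basis_map n ?B ?y (mpow (j s))) ` G"
    by (simp add: image_image)
  also have "\<dots> = (\<lambda>s. s) ` G"
  proof (rule image_cong[OF refl])
    show "basis_map n ?B ?y (mpow (j s)) = s" if "s \<in> G" for s
      using basis_map_mpow[OF B(1), of "j s" n ?y] j that by simp
  qed
  finally have "basis_map n ?B ?y ` free n ?B = rspan n G"
    by (simp add: free_eq_rspan[OF B, where 'a = 'a] rspan_image[OF linear_basis_map])
  with B linear_basis_map[of n ?B ?y] show ?thesis by (rule that)
qed

context valuation_domain
begin

text \<open>
  The kernel of \<open>g\<close> is finitely generated by coherence, and so are the relations between its
  generators.
\<close>

lemma presentation_torsion_submodule:
  assumes "presentation D n \<rho> B \<Psi> M L" and g: "g \<in> polys n"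
  shows "\<exists>B' \<Psi>'. presentation D n \<rho> B' \<Psi>' M {x \<in> L. \<rho> g * x \<in> (M :: 'a mpol set)}"
proof -
  interpret presentation D n \<rho> B \<Psi> M L by fact
  define K where "K = {q \<in> free n B. \<Psi> q \<in> M}"
  define Q where "Q = {q \<in> free n B. g * q \<in> K}"
  have "fgm n Q"
    unfolding Q_def K_def by (rule fgm_preimage[OF B_fin linear_mult relations_fgm])
  then obtain G where G: "finite G" "Q = rspan n G" unfolding fgm_def by (elim exE conjE)
  obtain B' and \<Theta> :: "'a mpol \<Rightarrow> 'a mpol" where \<Theta>: "finite B'" "\<And>\<beta>. \<beta> \<in> B' \<Longrightarrow> hi n \<beta> = \<beta>" "linear_over n \<Theta>" "\<Theta> ` free n B' = Q"
    using free_cover[OF G(1), of n] unfolding G(2) by metis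
  have \<Theta>_free: "\<Theta> p \<in> free n B \<and> g * \<Theta> p \<in> K" if "p \<in> free n B'" for p
    using \<Theta>(4) that unfolding Q_def by blast
  have "presentation D n \<rho> B' (\<lambda>p. \<Psi> (\<Theta> p)) M {x \<in> L. \<rho> g * x \<in> M}"
  proof (unfold_locales)
    show "x + y \<in> {x \<in> L. \<rho> g * x \<in> M}" if "x \<in> {x \<in> L. \<rho> g * x \<in> M}" "y \<in> {x \<in> L. \<rho> g * x \<in> M}" for x y
      using that M_add L_add by (simp add: distrib_left)
    show "d * x \<in> {x \<in> L. \<rho> g * x \<in> M}" if "d \<in> D" "x \<in> {x \<in> L. \<rho> g * x \<in> M}" for d x
      using that L_mult M_mult[of d "\<rho> g * x"] by (simp add: mult_ac)
    show "M \<subseteq> {x \<in> L. \<rho> g * x \<in> M}" using M_L M_mult[OF \<rho>_D[OF g]] by blast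
    show "\<Psi> (\<Theta> (p + q)) = \<Psi> (\<Theta> p) + \<Psi> (\<Theta> q)" for p q
      by (simp add: linear_overD[OF \<Theta>(3)] \<Psi>_add)
    show "\<Psi> (\<Theta> (a * p)) = \<rho> a * \<Psi> (\<Theta> p)" if "a \<in> polys n" for a p
      using that by (simp add: linear_overD[OF \<Theta>(3)] \<Psi>_mult)
    show "\<Psi> (\<Theta> p) \<in> {x \<in> L. \<rho> g * x \<in> M}" if "p \<in> free n B'" for p
      using \<Theta>_free[OF that] \<Psi>_L \<Psi>_mult[OF g] unfolding K_def by auto
    show "\<exists>q\<in>free n B'. x - \<Psi> (\<Theta> q) \<in> M" if x: "x \<in> {x \<in> L. \<rho> g * x \<in> M}" for x
    proof -
      obtain q where q: "q \<in> free n B" "x - \<Psi> q \<in> M" using generates x by blast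
      have "\<rho> g * \<Psi> q \<in> M"
        using M_congD'[OF mult_cong[OF q(2) \<rho>_D[OF g]]] x by blast
      then have "q \<in> Q"
        using q(1) submodD(3)[OF submod_free g q(1)] \<Psi>_mult[OF g] unfolding Q_def K_def by simp
      then obtain p where "q = \<Theta> p" "p \<in> free n B'" unfolding \<Theta>(4)[symmetric] by (rule imageE)
      then show ?thesis using q(2) by blast
    qed
    have "{q \<in> free n B'. \<Psi> (\<Theta> q) \<in> M} = {q \<in> free n B'. \<Theta> q \<in> K}"
      using \<Theta>_free unfolding K_def by blast
    then show "fgm n {q \<in> free n B'. \<Psi> (\<Theta> q) \<in> M}"
      using fgm_preimage[OF \<Theta>(1,3) relations_fgm] unfolding K_def by simp
  qed (use \<Theta>(1,2) in \<open>auto intro: D_one D_add D_mult D_uminus M_zero M_add M_mult hom \<rho>_D\<close>)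
  then show ?thesis by blast
qed

end

text \<open>
  A change of variables affects only the coordinates of the module.
\<close>

lemma presentation_shear:
  assumes "presentation D (Suc m) \<rho> B \<Psi> M L"
  shows "presentation D (Suc m) (\<lambda>p. \<rho> (shear m N s p)) B (\<lambda>p. \<Psi> (shear m N s p)) M (L :: 'a::idom mpol set)"
proof -
  interpret presentation D "Suc m" \<rho> B \<Psi> M L by fact
  have inv: "shear m N s (shear m N (- s) p) = p" for p :: "'a mpol"
    using shear_inverse[of m N "- s" p] by simp
  show ?thesis
  proof (unfold_locales)
    show "ringhom (\<lambda>p. \<rho> (shear m N s p))"
      by (rule ringhom_compose[OF hom ringhom_shear])
    show "\<rho> (shear m N s a) \<in> D" if "a \<in> polys (Suc m)" for a
      by (rule \<rho>_D[OF shear_polys[OF that]])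
    show "\<Psi> (shear m N s (p + q)) = \<Psi> (shear m N s p) + \<Psi> (shear m N s q)" for p q
      by (simp add: ringhomD[OF ringhom_shear] \<Psi>_add)
    show "\<Psi> (shear m N s (a * p)) = \<rho> (shear m N s a) * \<Psi> (shear m N s p)" if "a \<in> polys (Suc m)" for a p
      using \<Psi>_mult[OF shear_polys[OF that]] by (simp add: ringhomD[OF ringhom_shear])
    show "\<Psi> (shear m N s p) \<in> L" if "p \<in> free (Suc m) B" for p
      by (rule \<Psi>_L[OF shear_free[OF that]])
    show "\<exists>q\<in>free (Suc m) B. x - \<Psi> (shear m N s q) \<in> M" if x: "x \<in> L" for x
    proof -
      obtain q where "q \<in> free (Suc m) B" "x - \<Psi> q \<in> M" using generates[OF x] by blast
      then show ?thesis using inv shear_free[of q m B N "- s"] by (intro bexI[of _ "shear m N (- s) q"]) simp_all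
    qed
    obtain S where S: "finite S" "{q \<in> free (Suc m) B. \<Psi> q \<in> M} = rspan (Suc m) S"
      using relations_fgm unfolding fgm_def by (elim exE conjE)
    have "{q \<in> free (Suc m) B. \<Psi> (shear m N s q) \<in> M} = shear m N (- s) ` {q \<in> free (Suc m) B. \<Psi> q \<in> M}"
    proof (intro equalityI subsetI)
      fix q assume "q \<in> {q \<in> free (Suc m) B. \<Psi> (shear m N s q) \<in> M}"
      then show "q \<in> shear m N (- s) ` {q \<in> free (Suc m) B. \<Psi> q \<in> M}"
        using shear_free by (intro image_eqI[of _ _ "shear m N s q"]) (auto simp: shear_inverse)
    next
      fix q assume "q \<in> shear m N (- s) ` {q \<in> free (Suc m) B. \<Psi> q \<in> M}"
      then show "q \<in> {q \<in> free (Suc m) B. \<Psi> (shear m N s q) \<in> M}"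
        using shear_free by (auto simp: inv)
    qed
    then have "{q \<in> free (Suc m) B. \<Psi> (shear m N s q) \<in> M} = rspan (Suc m) (shear m N (- s) ` S)"
      unfolding S(2) shear_rspan .
    then show "fgm (Suc m) {q \<in> free (Suc m) B. \<Psi> (shear m N s q) \<in> M}"
      using S(1) unfolding fgm_def by blast
  qed (fact D_one D_add D_mult D_uminus M_zero M_add M_mult L_add L_mult M_L B_fin B_hi)+
qed

lemma hi_Suc: "hi m \<gamma> = hi (Suc m) \<gamma> + sgl m (lk \<gamma> m)"
  by (rule poly_mapping_eqI) (auto simp: lookup_add lookup_single when_def)

lemma hi_Suc_hi: "hi (Suc m) (hi m \<gamma>) = hi (Suc m) \<gamma>"
  by (rule poly_mapping_eqI) simp

definition expand_basis :: "nat \<Rightarrow> nat \<Rightarrow> expo set \<Rightarrow> expo set" where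
  "expand_basis m d B = (\<lambda>(\<beta>, j). \<beta> + sgl m j) ` (B \<times> {..<d})"

text \<open>
  Polynomials of degree less than \<open>d\<close> in the variable \<open>X\<^sub>m\<close> form a free module over the polynomials in the
  variables before it, the basis being multiplied by the powers of \<open>X\<^sub>m\<close> below \<open>d\<close>.
\<close>

lemma free_expand_basis:
  assumes "\<And>\<beta>. \<beta> \<in> B \<Longrightarrow> hi (Suc m) \<beta> = \<beta>"
  shows "free m (expand_basis m d B) = {p \<in> free (Suc m) B. low_deg m d p}"
proof -
  have "hi m \<gamma> \<in> expand_basis m d B \<longleftrightarrow> hi (Suc m) \<gamma> \<in> B \<and> lk \<gamma> m < d" for \<gamma>
  proof
    assume "hi m \<gamma> \<in> expand_basis m d B"
    then obtain \<beta> j where bj: "\<beta> \<in> B" "j < d" "hi m \<gamma> = \<beta> + sgl m j"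
      unfolding expand_basis_def by auto
    have "hi (Suc m) \<gamma> = hi (Suc m) (\<beta> + sgl m j)"
      using bj(3) hi_Suc_hi by metis
    also have "\<dots> = \<beta>" using assms[OF bj(1)] by (simp add: hi_single)
    finally have 1: "hi (Suc m) \<gamma> = \<beta>" .
    have "lk \<beta> m = 0" using assms[OF bj(1)] lookup_hi[of "Suc m" \<beta> m] by simp
    then have "lk (hi m \<gamma>) m = j" unfolding bj(3) by (simp add: lookup_add)
    then show "hi (Suc m) \<gamma> \<in> B \<and> lk \<gamma> m < d" using 1 bj(1,2) by simp
  next
    assume "hi (Suc m) \<gamma> \<in> B \<and> lk \<gamma> m < d"
    then show "hi m \<gamma> \<in> expand_basis m d B"
      unfolding expand_basis_def hi_Suc[of m \<gamma>] by (intro image_eqI[of _ _ "(hi (Suc m) \<gamma>, lk \<gamma> m)"]) auto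
  qed
  then show ?thesis unfolding free_def low_deg_def by blast
qed

text \<open>
  Division with remainder by \<open>h\<close>, which acts as zero, reduces both generators and relations to degree
  less than \<open>d\<close> in the last variable.
\<close>

lemma presentation_monic_descent:
  fixes h :: "'a::idom mpol"
  assumes "presentation D (Suc m) \<rho> B \<Psi> M L"
    and h: "h \<in> polys (Suc m)" "monic_at m d h" and kill: "\<And>x. x \<in> L \<Longrightarrow> \<rho> h * x \<in> M"
  shows "presentation D m \<rho> (expand_basis m d B) \<Psi> M L"
proof -
  interpret presentation D "Suc m" \<rho> B \<Psi> M L by fact
  let ?F = "free (Suc m) B" and ?B = "expand_basis m d B"
  have fb: "free m ?B = {p \<in> ?F. low_deg m d p}"
    by (rule free_expand_basis) (rule B_hi)
  have sub: "a \<in> polys (Suc m)" if "a \<in> polys m" for a :: "'a mpol"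
    using polys_mono[of m "Suc m"] that by auto
  have h\<Psi>: "\<Psi> (h * q) \<in> M" if "q \<in> ?F" for q
    using kill[OF \<Psi>_L[OF that]] \<Psi>_mult[OF h(1)] by simp
  show ?thesis
  proof (unfold_locales)
    show "finite ?B" unfolding expand_basis_def using B_fin by simp
    show "hi m \<beta> = \<beta>" if \<beta>: "\<beta> \<in> ?B" for \<beta>
    proof -
      obtain \<gamma> j where "\<gamma> \<in> B" "\<beta> = \<gamma> + sgl m j" using \<beta> unfolding expand_basis_def by auto
      moreover have "hi m \<gamma> = \<gamma>" if \<gamma>: "hi (Suc m) \<gamma> = \<gamma>"
      proof (rule poly_mapping_eqI)
        show "lk (hi m \<gamma>) k = lk \<gamma> k" for k
          using lookup_hi[of "Suc m" \<gamma> k] \<gamma> by auto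
      qed
      ultimately show ?thesis using B_hi by (simp add: hi_single)
    qed
    show "\<rho> a \<in> D" if "a \<in> polys m" for a by (rule \<rho>_D[OF sub[OF that]])
    show "\<Psi> (a * p) = \<rho> a * \<Psi> p" if "a \<in> polys m" for a p by (rule \<Psi>_mult[OF sub[OF that]])
    show "\<Psi> p \<in> L" if "p \<in> free m ?B" for p using that unfolding fb by (blast intro: \<Psi>_L)
    show "\<exists>q\<in>free m ?B. x - \<Psi> q \<in> M" if x: "x \<in> L" for x
    proof -
      obtain q where q: "q \<in> ?F" "x - \<Psi> q \<in> M" using generates[OF x] by blast
      obtain q' r where r: "q' \<in> ?F" "r \<in> ?F" "q = h * q' + r" "low_deg m d r"
        using monic_division[OF h(2,1) q(1)] by blast
      have eq: "x - \<Psi> r = (x - \<Psi> q) + \<Psi> (h * q')" unfolding r(3) \<Psi>_add by simp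
      have "x - \<Psi> r \<in> M" unfolding eq by (rule M_add[OF q(2) h\<Psi>[OF r(1)]])
      then show ?thesis using r fb by blast
    qed
    show "fgm m {q \<in> free m ?B. \<Psi> q \<in> M}"
    proof -
      define K where "K = {q \<in> ?F. \<Psi> q \<in> M}"
      obtain S where S: "finite S" "K = rspan (Suc m) S"
        using relations_fgm unfolding fgm_def K_def by (elim exE conjE)
      have SK: "s \<in> K" if "s \<in> S" for s using rspan_base[OF that] S(2) by blast
      have SF: "s \<in> ?F" if "s \<in> S" for s using SK[OF that] unfolding K_def by blast
      have "\<exists>r. \<forall>x\<in>S \<times> {..<d}. \<exists>q\<in>?F. r x \<in> ?F \<and> var m (snd x) * fst x = h * q + r x \<and> low_deg m d (r x)"
      proof (rule bchoice, rule ballI)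
        fix x assume "x \<in> S \<times> {..<d}"
        then have "var m (snd x) * fst x \<in> ?F"
          using SF by (intro submodD(3)[OF submod_free var_in_polys]) auto
        then show "\<exists>r. \<exists>q\<in>?F. r \<in> ?F \<and> var m (snd x) * fst x = h * q + r \<and> low_deg m d r"
          using monic_division[OF h(2,1)] by blast
      qed
      then obtain r where r: "\<forall>x\<in>S \<times> {..<d}. \<exists>q\<in>?F. r x \<in> ?F \<and> var m (snd x) * fst x = h * q + r x \<and> low_deg m d (r x)" ..
      let ?R = "r ` (S \<times> {..<d})"
      have RK: "?R \<subseteq> {q \<in> free m ?B. \<Psi> q \<in> M}"
      proof (rule image_subsetI)
        fix x assume x: "x \<in> S \<times> {..<d}"
        then obtain q where q: "q \<in> ?F" "r x \<in> ?F" "var m (snd x) * fst x = h * q + r x" "low_deg m d (r x)"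
          using r by blast
        have "\<Psi> (var m (snd x) * fst x) \<in> M"
          using x SK \<Psi>_mult[of "var m (snd x)" "fst x"] M_mult[OF \<rho>_D] unfolding K_def by auto
        then have "\<Psi> (h * q) + \<Psi> (r x) \<in> M" unfolding q(3) \<Psi>_add .
        then have "\<Psi> (r x) \<in> M" using M_diff[OF _ h\<Psi>[OF q(1)]] by fastforce
        then show "r x \<in> {q \<in> free m ?B. \<Psi> q \<in> M}" using q(2,4) unfolding fb by blast
      qed
      have subK: "submod m {q \<in> free m ?B. \<Psi> q \<in> M}"
      proof (rule submodI)
        show "0 \<in> {q \<in> free m ?B. \<Psi> q \<in> M}" using submodD(1)[OF submod_free] \<Psi>_0 M_zero by simp
        show "p + q \<in> {q \<in> free m ?B. \<Psi> q \<in> M}" if "p \<in> {q \<in> free m ?B. \<Psi> q \<in> M}" "q \<in> {q \<in> free m ?B. \<Psi> q \<in> M}" for p q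
          using that submodD(2)[OF submod_free, of p m ?B q] \<Psi>_add M_add by simp
        show "a * p \<in> {q \<in> free m ?B. \<Psi> q \<in> M}" if "a \<in> polys m" "p \<in> {q \<in> free m ?B. \<Psi> q \<in> M}" for a p
          using that submodD(3)[OF submod_free, of a m p ?B] \<Psi>_mult[OF sub] M_mult[OF \<rho>_D[OF sub]] by simp
      qed
      \<comment> \<open>up to multiples of \<open>h\<close>, every relation is a combination of the remainders in \<open>?R\<close>\<close>
      define W where "W = {w + h * q | w q. w \<in> rspan m ?R \<and> q \<in> ?F}"
      have WI: "w + h * q \<in> W" if "w \<in> rspan m ?R" "q \<in> ?F" for w q
        unfolding W_def using that by blast
      have W0: "0 \<in> W" using WI[OF rspan_zero submodD(1)[OF submod_free]] by simp
      have Wadd: "x + y \<in> W" if x: "x \<in> W" and y: "y \<in> W" for x y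
      proof -
        obtain w q where 1: "x = w + h * q" "w \<in> rspan m ?R" "q \<in> ?F" using x unfolding W_def by blast
        obtain w' q' where 2: "y = w' + h * q'" "w' \<in> rspan m ?R" "q' \<in> ?F" using y unfolding W_def by blast
        have "x + y = (w + w') + h * (q + q')" unfolding 1 2 by (simp add: algebra_simps)
        then show ?thesis
          using WI[OF submodD(2)[OF submod_rspan 1(2) 2(2)] submodD(2)[OF submod_free 1(3) 2(3)]] by simp
      qed
      have Wmult: "a * x \<in> W" if a: "a \<in> polys m" and x: "x \<in> W" for a x
      proof -
        obtain w q where 1: "x = w + h * q" "w \<in> rspan m ?R" "q \<in> ?F" using x unfolding W_def by blast
        have "a * x = a * w + h * (a * q)" unfolding 1 by (simp add: algebra_simps)
        then show ?thesis
          using WI[OF submodD(3)[OF submod_rspan a 1(2)] submodD(3)[OF submod_free sub[OF a] 1(3)]] by simp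
      qed
      have Wsub: "submod m W" by (rule submodI[OF W0 Wadd Wmult])
      have KW: "K \<subseteq> W"
      proof
        fix p assume "p \<in> K"
        then have "p \<in> rspan (Suc m) S" using S(2) by simp
        then show "p \<in> W"
        proof (induction p rule: rspan.induct)
          case (rspan_step a s p)
          have a: "a \<in> free (Suc m) {0}" using rspan_step.hyps(1) unfolding free_zero_basis .
          obtain q \<rho>' where q: "q \<in> free (Suc m) {0}" "\<rho>' \<in> free (Suc m) {0}" "a = h * q + \<rho>'" "low_deg m d \<rho>'"
            using monic_division[OF h(2,1) a] by blast
          have "q * s \<in> ?F" using q(1) SF[OF rspan_step.hyps(2)] unfolding free_zero_basis by (rule submodD(3)[OF submod_free])
          then have 1: "h * (q * s) \<in> W" using WI[OF rspan_zero] by fastforce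
          have fb0: "\<rho>' \<in> free m (expand_basis m d {0})"
            using q(2,4) free_expand_basis[of "{0}" m d, where 'a = 'a] by simp
          have fin0: "finite (expand_basis m d {0})" unfolding expand_basis_def by simp
          have "\<rho>' * s = (\<Sum>\<beta>\<in>expand_basis m d {0}. cpart m \<beta> \<rho>' * (mpow \<beta> * s))"
            using arg_cong[OF free_expand[OF fin0 fb0], of "\<lambda>x. x * s"] by (simp add: sum_distrib_right mult.assoc)
          also have "\<dots> \<in> W"
          proof (rule submod_sum[OF Wsub], rule Wmult[OF cpart_in_polys])
            fix \<beta> assume "\<beta> \<in> expand_basis m d {0}"
            then obtain j where j: "j < d" "\<beta> = sgl m j" unfolding expand_basis_def by auto
            then have sj: "(s, j) \<in> S \<times> {..<d}" using rspan_step.hyps(2) by simp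
            then obtain q' where q': "q' \<in> ?F" "var m j * s = h * q' + r (s, j)" using r by fastforce
            have "r (s, j) + h * q' \<in> W" using WI[OF rspan_base q'(1)] sj by blast
            then show "mpow \<beta> * s \<in> W" using q'(2) j(2) by (simp add: add.commute)
          qed
          finally have 2: "\<rho>' * s \<in> W" .
          have "a * s + p = (h * (q * s) + \<rho>' * s) + p" unfolding q(3) by (simp add: algebra_simps)
          then show ?case using Wadd[OF Wadd[OF 1 2] rspan_step.IH] by simp
        qed (rule W0)
      qed
      have "{q \<in> free m ?B. \<Psi> q \<in> M} \<subseteq> rspan m ?R"
      proof
        fix p assume p: "p \<in> {q \<in> free m ?B. \<Psi> q \<in> M}"
        then have "p \<in> W" using KW fb unfolding K_def by blast
        then obtain w q where w: "p = w + h * q" "w \<in> rspan m ?R" "q \<in> ?F" unfolding W_def by blast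
        have "w \<in> free m ?B" using w(2) rspan_least[OF subK RK] by blast
        then have "low_deg m d (p - w)" using p unfolding fb by (blast intro: low_deg_diff)
        then have "low_deg m d (h * q)" unfolding w(1) by simp
        then have "q = 0" by (rule monic_multiple_low_deg[OF h(2)])
        then show "p \<in> rspan m ?R" using w by simp
      qed
      then show ?thesis using S(1) by (intro fgmI[OF _ subK RK]) auto
    qed
  qed (fact D_one D_add D_mult D_uminus M_zero M_add M_mult L_add L_mult M_L hom \<Psi>_add)+
qed

context archimedean_valuation_domain
begin

text \<open>
  Splitting off the coefficients that are not units, which act nilpotently, makes a primitive
  annihilator monic after a change of variables, so that the last variable can be dropped.
\<close>

lemma presentation_primitive_descent:
  fixes g :: "'a mpol"
  assumes pres: "presentation D (Suc m) \<rho> B \<Psi> M L"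
    and g: "g \<in> polys (Suc m)" "primitive g" and kill: "\<And>x. x \<in> L \<Longrightarrow> \<rho> g * x \<in> M"
    and c: "c \<noteq> 0" "\<And>x. x \<in> L \<Longrightarrow> \<rho> (const c) * x \<in> M"
  shows "\<exists>\<rho>' B' \<Psi>'. presentation D m \<rho>' B' \<Psi>' M L \<and> (\<forall>a. \<rho>' (const a) = \<rho> (const a))"
proof -
  interpret presentation D "Suc m" \<rho> B \<Psi> M L by fact
  \<comment> \<open>the part of \<open>g\<close> whose coefficients are units\<close>
  define g1 where "g1 = (\<Sum>\<gamma>\<in>{\<gamma> \<in> supp g. lk g \<gamma> dvd 1}. sgl \<gamma> (lk g \<gamma>))"
  define g2 where "g2 = g1 - g"
  have lk1: "lk g1 \<gamma> = (if lk g \<gamma> dvd 1 then lk g \<gamma> else 0)" for \<gamma>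
    unfolding g1_def by (auto simp: lookup_sum lookup_single when_def sum.delta in_keys_iff)
  have lk2: "lk g2 \<gamma> = (if lk g \<gamma> dvd 1 then 0 else - lk g \<gamma>)" for \<gamma>
    unfolding g2_def lookup_minus lk1 by simp
  have g1: "g1 \<in> polys (Suc m)"
    using g(1) unfolding g1_def by (intro polys_sum polys_single) (auto simp: polys_def)
  have g2: "g2 \<in> polys (Suc m)"
    unfolding g2_def by (rule polys_diff[OF g1 g(1)])
  have g1_0: "g1 \<noteq> 0"
    using g(2) lk1 unfolding primitive_def by (metis lookup_zero dvd_0_left zero_neq_one)
  have g1_unit: "lk g1 \<gamma> dvd 1" if "\<gamma> \<in> supp g1" for \<gamma>
    using that unfolding in_keys_iff lk1 by (auto split: if_splits)
  obtain b q where bq: "g2 = const b * q" "q \<in> polys (Suc m)" "\<not> b dvd 1"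
  proof (cases "g2 = 0")
    case True
    then show ?thesis using that[of 0 0] by simp
  next
    case False
    then obtain b q where b: "b \<noteq> 0" "g2 = const b * q" "primitive q" "supp q \<subseteq> supp g2"
      using content by (metis (no_types))
    have q: "q \<in> polys (Suc m)" using b(4) g2 unfolding polys_def by blast
    obtain \<gamma> where "lk q \<gamma> dvd 1" using b(3) unfolding primitive_def ..
    moreover have "\<not> lk g2 \<gamma> dvd 1" unfolding lk2 by simp
    ultimately have "\<not> b dvd 1" using b(2) mult_dvd_mono[of b 1 "lk q \<gamma>" 1] by auto
    then show ?thesis using that b(2) q by blast
  qed
  obtain e where "c dvd b ^ e" using archimedean[OF c(1) bq(3)] ..
  then obtain c' where c': "b ^ e = c * c'" by (rule dvdE)
  have kill1: "\<rho> (g1 ^ e) * x \<in> M" if x: "x \<in> L" for x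
  proof -
    have "\<rho> g1 = \<rho> g + \<rho> g2" unfolding g2_def by (simp add: ringhomD[OF hom])
    then have "\<rho> g1 ^ e * x - \<rho> g2 ^ e * x \<in> M"
      using power_modulo_annihilator[OF \<rho>_D[OF g(1)] \<rho>_D[OF g2] kill x] by simp
    moreover have "\<rho> g2 ^ e * x \<in> M"
    proof -
      have "\<rho> g2 ^ e = \<rho> (q ^ e) * \<rho> (const (b ^ e))"
        unfolding bq(1) const_power ringhomD(3,7)[OF hom] power_mult_distrib by (rule mult.commute)
      then have eq: "\<rho> g2 ^ e * x = (\<rho> (q ^ e) * \<rho> (const c')) * (\<rho> (const c) * x)"
        unfolding c' const_mult ringhomD(3)[OF hom] by (simp only: mult_ac)
      show ?thesis unfolding eq
        by (rule M_mult[OF D_mult[OF \<rho>_D[OF polys_power[OF bq(2)]] \<rho>_D[OF polys_const]] c(2)[OF x]])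
    qed
    ultimately show ?thesis unfolding ringhomD(7)[OF hom] by (rule M_congD)
  qed
  obtain N d u where u: "u dvd 1" "low_deg m d (shear m N 1 g1 - const u * var m d)"
    by (rule shear_monic[OF g1 g1_0 g1_unit])
  obtain w where w: "1 = u * w" using u(1) by (rule dvdE)
  have wu: "const w * (const u * p) = p" for p
  proof -
    have "w * u = 1" using w by (simp add: mult.commute)
    moreover have "const w * (const u * p) = const (w * u) * p" by (simp only: const_mult mult.assoc)
    ultimately show ?thesis by simp
  qed
  define h where "h = const w * shear m N 1 g1"
  have h: "monic_at m d h"
    using low_deg_const_mult[OF u(2), of w] unfolding monic_at_def h_def by (simp add: right_diff_distrib wu)
  have h_in: "h \<in> polys (Suc m)"
    unfolding h_def by (intro polys_mult polys_const shear_polys g1)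
  let ?\<rho> = "\<lambda>p. \<rho> (shear m N (- 1) p)" and ?\<Psi> = "\<lambda>p. \<Psi> (shear m N (- 1) p)"
  have "presentation D (Suc m) ?\<rho> B ?\<Psi> M L"
    by (rule presentation_shear[OF pres])
  moreover have "?\<rho> (h ^ e) * x \<in> M" if "x \<in> L" for x
  proof -
    have "shear m N (- 1) (h ^ e) = const (w ^ e) * g1 ^ e"
      unfolding h_def by (simp add: ringhomD[OF ringhom_shear] shear_const shear_inverse power_mult_distrib const_power)
    then have eq: "?\<rho> (h ^ e) * x = \<rho> (const (w ^ e)) * (\<rho> (g1 ^ e) * x)"
      by (simp only: ringhomD(3)[OF hom] mult.assoc)
    show ?thesis unfolding eq by (rule M_mult[OF \<rho>_D[OF polys_const] kill1[OF that]])
  qed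
  ultimately have "presentation D m ?\<rho> (expand_basis m (e * d) B) ?\<Psi> M L"
    using presentation_monic_descent[OF _ polys_power[OF h_in] monic_at_power[OF h]] by blast
  moreover have "\<forall>a. ?\<rho> (const a) = \<rho> (const a)" by (simp add: shear_const)
  ultimately show ?thesis by (intro exI conjI)
qed

end

context presentation
begin

text \<open>
  Elements of \<open>D\<close> that are a power of \<open>f\<close> times an element that acts on \<open>f\<close>-torsion like a primitive
  polynomial, up to a term that is nilpotent on modules killed by a nonzero constant.
\<close>

definition almost_primitive :: "'a mpol \<Rightarrow> 'a mpol \<Rightarrow> bool" where
  "almost_primitive f \<pi> \<longleftrightarrow> (\<exists>s a \<theta> b w. a \<in> polys n \<and> primitive a \<and> \<theta> \<in> D \<and> w \<in> D \<and> \<not> b dvd 1 \<and>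
     \<pi> = f ^ s * (\<rho> a + f * \<theta>) + \<rho> (const b) * w)"

end

context archimedean_valuation_domain
begin

lemma almost_primitive_mult:
  fixes f :: "'a mpol"
  assumes "presentation D n \<rho> B \<Psi> M L" "f \<in> D"
    "presentation.almost_primitive D n \<rho> f \<pi>1" "presentation.almost_primitive D n \<rho> f \<pi>2"
  shows "presentation.almost_primitive D n \<rho> f (\<pi>1 * \<pi>2)"
proof -
  interpret presentation D n \<rho> B \<Psi> M L by fact
  obtain s a \<theta> b w where 1: "a \<in> polys n" "primitive a" "\<theta> \<in> D" "w \<in> D" "\<not> b dvd 1"
      "\<pi>1 = f ^ s * (\<rho> a + f * \<theta>) + \<rho> (const b) * w"
    using assms(3) unfolding almost_primitive_def by (elim exE conjE)
  obtain s' a' \<theta>' b' w' where 2: "a' \<in> polys n" "primitive a'" "\<theta>' \<in> D" "w' \<in> D" "\<not> b' dvd 1"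
      "\<pi>2 = f ^ s' * (\<rho> a' + f * \<theta>') + \<rho> (const b') * w'"
    using assms(4) unfolding almost_primitive_def by (elim exE conjE)
  \<comment> \<open>the two nilpotent constants have a common divisor that is still not a unit\<close>
  obtain d x x' where d: "b = d * x" "b' = d * x'" "\<not> d dvd 1"
  proof (cases "b dvd b'")
    case True
    then obtain y where "b' = b * y" by (rule dvdE)
    then show ?thesis using that[of b 1 y] 1(5) by simp
  next
    case False
    then have "b' dvd b" using dvd_linear by blast
    then obtain y where "b = b' * y" by (rule dvdE)
    then show ?thesis using that[of b' y 1] 2(5) by simp
  qed
  let ?u = "\<rho> a + f * \<theta>" and ?u' = "\<rho> a' + f * \<theta>'"
  let ?w = "\<rho> (const x) * w * (f ^ s' * ?u') + \<rho> (const x') * w' * (f ^ s * ?u) + \<rho> (const b) * w * \<rho> (const x') * w'"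
  let ?\<theta> = "\<rho> a * \<theta>' + \<rho> a' * \<theta> + f * \<theta> * \<theta>'"
  have "\<pi>1 * \<pi>2 = f ^ (s + s') * (\<rho> (a * a') + f * ?\<theta>) + \<rho> (const d) * ?w"
    unfolding 1(6) 2(6) d(1,2) const_mult ringhomD(3)[OF hom] power_add by (simp add: algebra_simps)
  moreover have "?w \<in> D" "?\<theta> \<in> D"
    by (intro D_add D_mult D_power \<rho>_D polys_const assms(2) 1(1,3,4) 2(1,3,4))+
  ultimately show ?thesis
    unfolding almost_primitive_def using polys_mult[OF 1(1) 2(1)] primitive_mult[OF 1(2) 2(2)] d(3) by blast
qed

text \<open>
  In a module with \<open>r\<close> generators the \<open>r + 1\<close> vectors that represent \<open>y, f y, \<dots>, f\<^sup>r y\<close> are linearly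
  dependent. A relation divided by its content has a primitive coefficient. The first
  primitive coefficient is \<open>a\<close>, those before it contribute the nilpotent term, and those after it make
  up \<open>f \<theta>\<close>.
\<close>

lemma almost_primitive_annihilator_of_basis:
  fixes f :: "'a mpol"
  assumes "presentation D n \<rho> B \<Psi> M L" "f \<in> D" "\<beta> \<in> B"
  shows "\<exists>\<pi>\<in>D. presentation.almost_primitive D n \<rho> f \<pi> \<and> \<pi> * \<Psi> (mpow \<beta>) \<in> M"
proof -
  interpret presentation D n \<rho> B \<Psi> M L by fact
  let ?y = "\<Psi> (mpow \<beta>)" and ?I = "{..card B}"
  have "?y \<in> L" by (rule \<Psi>_L[OF mpow_in_free[OF B_hi[OF assms(3)] assms(3)]])
  then have "\<exists>q\<in>free n B. f ^ k * ?y - \<Psi> q \<in> M" for k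
    by (intro generates L_mult D_power assms(2))
  then have "\<exists>v. \<forall>k. v k \<in> free n B \<and> f ^ k * ?y - \<Psi> (v k) \<in> M"
    by (intro choice allI) blast
  then obtain v where v: "\<forall>k. v k \<in> free n B \<and> f ^ k * ?y - \<Psi> (v k) \<in> M" ..
  obtain a0 where a0: "\<forall>i\<in>?I. a0 i \<in> polys n" "\<exists>i\<in>?I. a0 i \<noteq> 0" "(\<Sum>i\<in>?I. a0 i * v i) = 0"
    using free_dependent[OF B_fin, of ?I v n] v by auto
  obtain c a where a: "c \<noteq> 0" "\<forall>i\<in>?I. a0 i = const c * a i \<and> supp (a i) \<subseteq> supp (a0 i)" "\<exists>i\<in>?I. primitive (a i)"
    using family_content[of ?I a0, OF _ a0(2)] by auto
  have a_in: "a i \<in> polys n" if "i \<in> ?I" for i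
    using a(2) a0(1) that unfolding polys_def by blast
  have "const c * (\<Sum>i\<in>?I. a i * v i) = (\<Sum>i\<in>?I. a0 i * v i)"
    unfolding sum_distrib_left using a(2) by (intro sum.cong refl) (simp add: mult.assoc)
  then have rel: "(\<Sum>i\<in>?I. a i * v i) = 0" using a0(3) a(1) by simp
  define \<pi> where "\<pi> = (\<Sum>i\<in>?I. \<rho> (a i) * f ^ i)"
  have "\<pi> \<in> D" unfolding \<pi>_def by (intro D_sum D_mult D_power assms(2) \<rho>_D a_in)
  have "\<pi> * ?y = (\<Sum>i\<in>?I. \<rho> (a i) * (f ^ i * ?y - \<Psi> (v i))) + (\<Sum>i\<in>?I. \<rho> (a i) * \<Psi> (v i))"
    unfolding \<pi>_def sum_distrib_right sum.distrib[symmetric] by (intro sum.cong refl) (simp add: algebra_simps)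
  also have "(\<Sum>i\<in>?I. \<rho> (a i) * \<Psi> (v i)) = \<Psi> (\<Sum>i\<in>?I. a i * v i)"
    unfolding \<Psi>_sum using a_in by (intro sum.cong refl) (simp add: \<Psi>_mult)
  also have "\<dots> = 0" unfolding rel by (rule \<Psi>_0)
  finally have "\<pi> * ?y = (\<Sum>i\<in>?I. \<rho> (a i) * (f ^ i * ?y - \<Psi> (v i)))" by simp
  also have "\<dots> \<in> M"
    by (rule M_sum, rule M_mult[OF \<rho>_D[OF a_in] conjunct2[OF spec[OF v]]])
  finally have ann: "\<pi> * ?y \<in> M" .
  define s where "s = (LEAST i. i \<in> ?I \<and> primitive (a i))"
  have s: "s \<in> ?I \<and> primitive (a s)" unfolding s_def by (rule LeastI_ex) (use a(3) in blast)
  have below: "\<not> primitive (a i)" if "i < s" for i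
    using not_less_Least[of i "\<lambda>i. i \<in> ?I \<and> primitive (a i)"] that s unfolding s_def by auto
  obtain b r where br: "\<not> b dvd 1" "\<And>i. i < s \<Longrightarrow> a i = const b * r i" "\<And>i. i < s \<Longrightarrow> r i \<in> polys n"
  proof (cases "\<exists>i\<in>{..<s}. a i \<noteq> 0")
    case True
    then obtain b r where b: "\<forall>i\<in>{..<s}. a i = const b * r i \<and> supp (r i) \<subseteq> supp (a i)" "\<exists>i\<in>{..<s}. primitive (r i)"
      using family_content[of "{..<s}" a] by auto
    obtain i \<gamma> where i: "i < s" "lk (r i) \<gamma> dvd 1" using b(2) unfolding primitive_def by blast
    have "\<not> lk (a i) \<gamma> dvd 1" using below[OF i(1)] unfolding primitive_def by blast
    then have "\<not> b dvd 1" using b(1) i mult_dvd_mono[of b 1 "lk (r i) \<gamma>" 1] by auto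
    moreover have "r i \<in> polys n" if "i < s" for i
    proof -
      have "supp (r i) \<subseteq> supp (a i)" using b(1) that by blast
      moreover have "a i \<in> polys n" using a_in that s by auto
      ultimately show ?thesis unfolding polys_def by blast
    qed
    ultimately show ?thesis using that[of b r] b(1) by blast
  next
    case False
    then show ?thesis using that[of 0 "\<lambda>_. 0"] by auto
  qed
  let ?w = "\<Sum>i<s. \<rho> (r i) * f ^ i" and ?\<theta> = "\<Sum>i\<in>{s<..card B}. \<rho> (a i) * f ^ (i - Suc s)"
  have I: "?I = {..<s} \<union> ({s} \<union> {s<..card B})" using s by auto
  have "\<pi> = (\<Sum>i<s. \<rho> (a i) * f ^ i) + (\<rho> (a s) * f ^ s + (\<Sum>i\<in>{s<..card B}. \<rho> (a i) * f ^ i))"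
    unfolding \<pi>_def I by (subst sum.union_disjoint; auto)+
  also have "(\<Sum>i<s. \<rho> (a i) * f ^ i) = \<rho> (const b) * ?w"
    unfolding sum_distrib_left using br(2) by (intro sum.cong refl) (simp add: ringhomD(3)[OF hom] mult.assoc)
  also have "(\<Sum>i\<in>{s<..card B}. \<rho> (a i) * f ^ i) = f ^ s * (f * ?\<theta>)"
    unfolding sum_distrib_left
  proof (intro sum.cong refl)
    fix i assume "i \<in> {s<..card B}"
    then have "i = s + (1 + (i - Suc s))" by auto
    then have "f ^ i = f ^ s * (f * f ^ (i - Suc s))" by (metis power_add power_one_right)
    then show "\<rho> (a i) * f ^ i = f ^ s * (f * (\<rho> (a i) * f ^ (i - Suc s)))" by (simp add: mult_ac)
  qed
  finally have "\<pi> = f ^ s * (\<rho> (a s) + f * ?\<theta>) + \<rho> (const b) * ?w" by (simp add: algebra_simps)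
  moreover have "?w \<in> D" by (intro D_sum D_mult D_power assms(2) \<rho>_D br(3)) simp
  moreover have "?\<theta> \<in> D" by (intro D_sum D_mult D_power assms(2) \<rho>_D a_in) simp
  ultimately have "almost_primitive f \<pi>"
    unfolding almost_primitive_def using a_in s br(1) by blast
  then show ?thesis using ann \<open>\<pi> \<in> D\<close> by blast
qed

lemma almost_primitive_annihilator:
  fixes f :: "'a mpol"
  assumes "presentation D n \<rho> B \<Psi> M L" "f \<in> D"
  shows "\<exists>\<pi>\<in>D. presentation.almost_primitive D n \<rho> f \<pi> \<and> (\<forall>x\<in>L. \<pi> * x \<in> M)"
proof -
  interpret presentation D n \<rho> B \<Psi> M L by fact
  have "\<exists>\<pi>\<in>D. almost_primitive f \<pi> \<and> (\<forall>\<beta>\<in>B0. \<pi> * \<Psi> (mpow \<beta>) \<in> M)" if "B0 \<subseteq> B" for B0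
    using finite_subset[OF that B_fin] that
  proof (induction B0 rule: finite_induct)
    case empty
    have "almost_primitive f 1"
      unfolding almost_primitive_def
      by (intro exI[of _ 0] exI[of _ 1] exI[of _ 0] exI[of _ 0] exI[of _ 0]) (simp add: D_zero ringhomD[OF hom])
    then show ?case using D_one by blast
  next
    case (insert \<beta> B0)
    obtain \<pi> where 1: "\<pi> \<in> D" "almost_primitive f \<pi>" "\<forall>\<beta>\<in>B0. \<pi> * \<Psi> (mpow \<beta>) \<in> M" using insert by blast
    obtain \<pi>' where 2: "\<pi>' \<in> D" "almost_primitive f \<pi>'" "\<pi>' * \<Psi> (mpow \<beta>) \<in> M"
      using almost_primitive_annihilator_of_basis[OF assms, of \<beta>] insert.prems by blast
    have "\<pi> * \<pi>' * \<Psi> (mpow \<gamma>) \<in> M" if \<gamma>: "\<gamma> \<in> insert \<beta> B0" for \<gamma>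
    proof (cases "\<gamma> = \<beta>")
      case True
      then show ?thesis using M_mult[OF 1(1) 2(3)] by (simp add: mult.assoc)
    next
      case False
      then have "\<pi> * \<Psi> (mpow \<gamma>) \<in> M" using 1(3) \<gamma> by blast
      then have "\<pi>' * (\<pi> * \<Psi> (mpow \<gamma>)) \<in> M" by (rule M_mult[OF 2(1)])
      then show ?thesis by (simp add: mult_ac)
    qed
    then show ?case using almost_primitive_mult[OF assms 1(2) 2(2)] D_mult[OF 1(1) 2(1)] by blast
  qed
  then obtain \<pi> where \<pi>: "\<pi> \<in> D" "almost_primitive f \<pi>" "\<forall>\<beta>\<in>B. \<pi> * \<Psi> (mpow \<beta>) \<in> M" by blast
  have "\<pi> * x \<in> M" if x: "x \<in> L" for x
  proof -
    obtain q where q: "q \<in> free n B" "x - \<Psi> q \<in> M" using generates[OF x] by blast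
    have "\<Psi> q = (\<Sum>\<beta>\<in>B. \<rho> (cpart n \<beta> q) * \<Psi> (mpow \<beta>))"
      using arg_cong[OF free_expand[OF B_fin q(1)], of \<Psi>] by (simp add: \<Psi>_sum \<Psi>_mult cpart_in_polys)
    then have "\<pi> * \<Psi> q = (\<Sum>\<beta>\<in>B. \<rho> (cpart n \<beta> q) * (\<pi> * \<Psi> (mpow \<beta>)))" by (simp add: sum_distrib_left mult_ac)
    also have "\<dots> \<in> M"
      by (rule M_sum, rule M_mult[OF \<rho>_D[OF cpart_in_polys] bspec[OF \<pi>(3)]])
    finally have "\<pi> * \<Psi> q \<in> M" .
    then show ?thesis using M_congD[OF mult_cong[OF q(2) \<pi>(1)]] by blast
  qed
  then show ?thesis using \<pi> by blast
qed

text \<open>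
  Let \<open>x\<close> be torsion and \<open>u = \<rho> a + f \<theta>\<close>. A power of \<open>f ^ s * u\<close> kills \<open>x\<close>, because it differs from a
  multiple of the annihilator \<open>\<pi>\<close> by a power of the nilpotent term. Hence \<open>y = f ^ (s * e) * x\<close> is killed
  by powers of \<open>u\<close> and of \<open>f\<close>, and so by a power of \<open>\<rho> a = u - f \<theta>\<close>, which is primitive.
\<close>

lemma torsion_generic_bound:
  fixes f :: "'a mpol"
  assumes "presentation D n \<rho> B \<Psi> M L" and f: "f \<in> D"
    and c: "c \<noteq> 0" "\<And>x. x \<in> L \<Longrightarrow> \<rho> (const c) * x \<in> M"
  shows "\<exists>k g. g \<in> polys n \<and> primitive g \<and> (\<forall>x\<in>L. \<forall>j. f ^ j * x \<in> M \<longrightarrow> \<rho> g * (f ^ k * x) \<in> M)"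
proof -
  interpret presentation D n \<rho> B \<Psi> M L by fact
  obtain \<pi> where \<pi>: "\<pi> \<in> D" "almost_primitive f \<pi>" "\<forall>x\<in>L. \<pi> * x \<in> M"
    using almost_primitive_annihilator[OF assms(1) f] by blast
  obtain s a \<theta> b w where 1: "a \<in> polys n" "primitive a" "\<theta> \<in> D" "w \<in> D" "\<not> b dvd 1"
      "\<pi> = f ^ s * (\<rho> a + f * \<theta>) + \<rho> (const b) * w"
    using \<pi>(2) unfolding almost_primitive_def by (elim exE conjE)
  obtain e where "c dvd b ^ e" using archimedean[OF c(1) 1(5)] ..
  then obtain c' where c': "b ^ e = c * c'" by (rule dvdE)
  define K where "K = {q \<in> free n B. \<Psi> q \<in> M}"
  obtain S where S: "finite S" "K = rspan n S" using relations_fgm unfolding fgm_def K_def by (elim exE conjE)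
  have "rspan n S \<subseteq> free n B" unfolding S(2)[symmetric] K_def by blast
  from primitive_saturation[OF B_fin S(1) this] obtain g where g: "g \<in> polys n" "primitive g"
      "\<forall>q\<in>free n B. \<forall>u\<in>polys n. primitive u \<longrightarrow> u * q \<in> K \<longrightarrow> g * q \<in> K" unfolding S(2) by blast
  let ?u = "\<rho> a + f * \<theta>" and ?z = "- (\<rho> (const b) * w)"
  have uD: "?u \<in> D" and zD: "?z \<in> D"
    by (intro D_add D_mult D_uminus \<rho>_D polys_const 1 f)+
  have "\<rho> g * (f ^ (s * e) * x) \<in> M" if x: "x \<in> L" and fx: "f ^ j * x \<in> M" for x j
  proof -
    let ?y = "f ^ (s * e) * x"
    have yL: "?y \<in> L" by (intro L_mult D_power f x)
    have "\<pi> + ?z = f ^ s * ?u" unfolding 1(6) by simp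
    then have "(f ^ s * ?u) ^ e * x - ?z ^ e * x \<in> M"
      using power_modulo_annihilator[OF \<pi>(1) zD _ x] \<pi>(3) by simp
    moreover have "?z ^ e * x \<in> M"
    proof -
      have "?z ^ e = (- w) ^ e * \<rho> (const (b ^ e))"
        by (simp add: const_power ringhomD(7)[OF hom] power_mult_distrib[symmetric] mult.commute)
      then have eq: "?z ^ e * x = ((- w) ^ e * \<rho> (const c')) * (\<rho> (const c) * x)"
        unfolding c' const_mult ringhomD(3)[OF hom] by (simp add: mult_ac)
      show ?thesis unfolding eq
        by (rule M_mult[OF D_mult[OF D_power[OF D_uminus[OF 1(4)]] \<rho>_D[OF polys_const]] c(2)[OF x]])
    qed
    ultimately have ux: "(f ^ s * ?u) ^ e * x \<in> M" by (rule M_congD)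
    have "?u ^ e * ?y = (f ^ s * ?u) ^ e * x"
      unfolding power_mult power_mult_distrib by (simp only: mult_ac)
    then have u: "?u ^ e * ?y \<in> M" using ux by (rule ssubst)
    have "(- (f * \<theta>)) ^ j = (- \<theta>) ^ j * f ^ j"
      by (simp add: power_mult_distrib[symmetric] mult.commute)
    then have eq: "(- (f * \<theta>)) ^ j * ?y = ((- \<theta>) ^ j * f ^ (s * e)) * (f ^ j * x)"
      by (simp only: mult_ac)
    have v: "(- (f * \<theta>)) ^ j * ?y \<in> M" unfolding eq
      by (rule M_mult[OF D_mult[OF D_power[OF D_uminus[OF 1(3)]] D_power[OF f]] fx])
    have "(?u + - (f * \<theta>)) ^ (e + j) * ?y \<in> M"
      by (rule power_sum_torsion[OF uD D_uminus[OF D_mult[OF f 1(3)]] u v])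
    then have prim: "\<rho> (a ^ (e + j)) * ?y \<in> M" by (simp add: ringhomD(7)[OF hom])
    obtain q where q: "q \<in> free n B" "?y - \<Psi> q \<in> M" using generates[OF yL] by blast
    have aj: "a ^ (e + j) \<in> polys n" "primitive (a ^ (e + j))" using 1(1,2) polys_power primitive_power by blast+
    have "\<rho> (a ^ (e + j)) * \<Psi> q \<in> M"
      using M_congD'[OF mult_cong[OF q(2) \<rho>_D[OF aj(1)]] prim] .
    then have "a ^ (e + j) * q \<in> K"
      unfolding K_def using submodD(3)[OF submod_free aj(1) q(1)] \<Psi>_mult[OF aj(1)] by simp
    then have "g * q \<in> K" using g(3) q(1) aj by blast
    then have "\<rho> g * \<Psi> q \<in> M" unfolding K_def by (simp add: \<Psi>_mult[OF g(1)])
    then show ?thesis using M_congD[OF mult_cong[OF q(2) \<rho>_D[OF g(1)]]] by blast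
  qed
  then show ?thesis using g(1,2) by blast
qed

text \<open>
  The submodule killed by \<open>g\<close> loses a variable and is covered by the induction hypothesis. Without
  variables a primitive polynomial is a unit, which starts the induction.
\<close>

theorem bounded_torsion:
  fixes f :: "'a mpol"
  assumes "presentation D n \<rho> B \<Psi> M L" "f \<in> D" "c \<noteq> 0" "\<And>x. x \<in> L \<Longrightarrow> \<rho> (const c) * x \<in> M"
  shows "\<exists>k. \<forall>x\<in>L. \<forall>j. f ^ j * x \<in> M \<longrightarrow> f ^ k * x \<in> M"
  using assms
proof (induction n arbitrary: \<rho> B \<Psi> L)
  case 0
  interpret presentation D 0 \<rho> B \<Psi> M L by fact
  obtain k g where g: "g \<in> polys 0" "primitive g" "\<forall>x\<in>L. \<forall>j. f ^ j * x \<in> M \<longrightarrow> \<rho> g * (f ^ k * x) \<in> M"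
    using torsion_generic_bound[OF 0] by blast
  have "expos 0 = {0}" by (auto simp: expos_def)
  then have "g = sgl 0 (lk g 0)"
    using g(1) unfolding polys_def by (intro poly_mapping_eqI) (auto simp: lookup_single when_def in_keys_iff)
  then have gc: "g = const (lk g 0)" unfolding const_def .
  have "lk g \<gamma> = 0" if "\<gamma> \<noteq> 0" for \<gamma>
    using g(1) that \<open>expos 0 = {0}\<close> unfolding polys_def by (auto simp: in_keys_iff)
  then have "lk g 0 dvd 1" using g(2) unfolding primitive_def by (metis dvd_0_left_iff zero_neq_one)
  then obtain w where w: "1 = lk g 0 * w" by (rule dvdE)
  have "f ^ k * x \<in> M" if "x \<in> L" "f ^ j * x \<in> M" for x j
  proof -
    have "\<rho> (const w) * (\<rho> g * (f ^ k * x)) \<in> M"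
      using g(3) that by (intro M_mult[OF \<rho>_D[OF polys_const]]) blast
    moreover have "w * lk g 0 = 1" using w by (simp add: mult.commute)
    then have "const w * g = 1" by (subst gc) (simp flip: const_mult)
    then have "\<rho> (const w) * \<rho> g = 1" using ringhomD(1,3)[OF hom] by metis
    ultimately show ?thesis by (simp flip: mult.assoc)
  qed
  then show ?case by blast
next
  case (Suc m)
  interpret presentation D "Suc m" \<rho> B \<Psi> M L by fact
  obtain k g where g: "g \<in> polys (Suc m)" "primitive g" "\<forall>x\<in>L. \<forall>j. f ^ j * x \<in> M \<longrightarrow> \<rho> g * (f ^ k * x) \<in> M"
    using torsion_generic_bound[OF Suc.prems] by blast
  let ?L = "{x \<in> L. \<rho> g * x \<in> M}"
  obtain B' \<Psi>' where "presentation D (Suc m) \<rho> B' \<Psi>' M ?L"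
    using presentation_torsion_submodule[OF Suc.prems(1) g(1)] by blast
  then obtain \<rho>' B'' \<Psi>'' where p: "presentation D m \<rho>' B'' \<Psi>'' M ?L" "\<forall>a. \<rho>' (const a) = \<rho> (const a)"
    using presentation_primitive_descent[OF _ g(1,2) _ Suc.prems(3)] Suc.prems(4) by (metis (no_types, lifting) mem_Collect_eq)
  have "\<rho>' (const c) * x \<in> M" if "x \<in> ?L" for x
    using p(2) Suc.prems(4) that by simp
  then obtain l where l: "\<forall>x\<in>?L. \<forall>j. f ^ j * x \<in> M \<longrightarrow> f ^ l * x \<in> M"
    using Suc.IH[OF p(1) Suc.prems(2,3)] by blast
  have "f ^ (l + k) * x \<in> M" if x: "x \<in> L" "f ^ j * x \<in> M" for x j
  proof -
    have "f ^ k * x \<in> ?L" using g(3) x L_mult[OF D_power[OF Suc.prems(2)]] by blast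
    moreover have "f ^ j * (f ^ k * x) \<in> M"
      using M_mult[OF D_power[OF Suc.prems(2)] x(2), of k] by (simp add: mult_ac)
    ultimately have "f ^ l * (f ^ k * x) \<in> M" using l by blast
    then show ?thesis by (simp add: power_add mult.assoc)
  qed
  then show ?case by blast
qed

section \<open>Saturating ideals at a polynomial\<close>

text \<open>
  The largest of the exponents that work for the generators works everywhere.
\<close>

lemma fgm_uniform:
  assumes "fgm n P" "\<And>p. p \<in> P \<Longrightarrow> \<exists>k::nat. Q k p"
    and mono: "\<And>k l p. Q k p \<Longrightarrow> k \<le> l \<Longrightarrow> Q l p"
    and sub: "\<And>k. submod n {p. Q k p}"
  shows "\<exists>k. \<forall>p\<in>P. Q k (p :: 'a mpol)"
proof -
  obtain S where S: "finite S" "P = rspan n S" using assms(1) unfolding fgm_def by (elim exE conjE)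
  have "\<exists>k. \<forall>p\<in>T. Q k p" if "finite T" "T \<subseteq> S" for T
    using that
  proof (induction T rule: finite_induct)
    case (insert s T)
    obtain k where k: "\<forall>p\<in>T. Q k p" using insert by blast
    have "s \<in> P" using insert.prems S(2) rspan_base by blast
    then obtain l where l: "Q l s" using assms(2) by blast
    have "\<forall>p\<in>insert s T. Q (max k l) p"
      using k l mono[of k _ "max k l"] mono[of l s "max k l"] by auto
    then show ?case ..
  qed auto
  then obtain k where "\<forall>p\<in>S. Q k p" using S(1) by blast
  then have "rspan n S \<subseteq> {p. Q k p}" by (intro rspan_least[OF sub]) blast
  then show ?thesis unfolding S(2) by blast
qed

text \<open>
  An ideal \<open>I\<close> with \<open>V\<close>-saturation \<open>J\<close> contains \<open>c J\<close> for some constant \<open>c \<noteq> 0\<close>. The torsion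
  at \<open>f\<close> of \<open>J / I\<close> embeds into that of the ring modulo \<open>I + (c)\<close>, which is bounded, and above
  \<open>J\<close> everything is saturated.
\<close>

theorem saturation_at_polynomial_fgm:
  fixes I :: "'a mpol set"
  assumes I: "fgm n I" "I \<subseteq> polys n" and f: "f \<in> polys n"
  shows "fgm n {x \<in> polys n. \<exists>j. f ^ j * x \<in> I}"
proof -
  note Is = submodD[OF fgm_submod[OF I(1)]]
  note R = submodD[OF submod_polys]
  define J where "J = {x \<in> polys n. \<exists>a. a \<noteq> 0 \<and> const a * x \<in> I}"
  have J: "submod n J"
  proof (rule submodI)
    show "0 \<in> J" unfolding J_def using Is(1) by (auto intro: exI[of _ 1])
    show "p + q \<in> J" if pq: "p \<in> J" "q \<in> J" for p q
    proof -
      obtain a b where ab: "a \<noteq> 0" "const a * p \<in> I" "b \<noteq> 0" "const b * q \<in> I" using pq unfolding J_def by blast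
      have "const (a * b) * (p + q) = const b * (const a * p) + const a * (const b * q)"
        by (simp add: const_mult algebra_simps)
      also have "\<dots> \<in> I" by (rule Is(2)[OF Is(3)[OF polys_const ab(2)] Is(3)[OF polys_const ab(4)]])
      finally show ?thesis using pq ab(1,3) unfolding J_def by (auto intro!: polys_add exI[of _ "a * b"])
    qed
    show "r * p \<in> J" if r: "r \<in> polys n" and p: "p \<in> J" for r p
    proof -
      obtain a where a: "a \<noteq> 0" "const a * p \<in> I" using p unfolding J_def by blast
      have "const a * (r * p) \<in> I" using Is(3)[OF r a(2)] by (simp add: mult_ac)
      then show ?thesis using p a(1) r unfolding J_def by (auto intro: polys_mult)
    qed
  qed
  note Js = submodD[OF J]
  have satJ: "p \<in> J" if c: "c \<noteq> 0" and p: "const c * p \<in> J" for c p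
  proof -
    obtain a where a: "a \<noteq> 0" "const a * (const c * p) \<in> I" using p unfolding J_def by blast
    have "supp p \<subseteq> supp (const c * p)" using c by (auto simp: in_keys_iff)
    then have "p \<in> polys n" using p unfolding J_def polys_def by blast
    moreover have "const (a * c) * p \<in> I" using a(2) by (simp add: const_mult mult.assoc)
    moreover have "a * c \<noteq> 0" using a(1) c by simp
    ultimately show ?thesis unfolding J_def by blast
  qed
  have "J \<subseteq> free n {0}" unfolding free_zero_basis J_def by blast
  then have "fgm n J" using saturated_fgm[of "{0}" J n] J satJ by blast
  have IJ: "I \<subseteq> J" using I(2) unfolding J_def by (auto intro: exI[of _ 1])
  have "\<exists>c. c \<noteq> 0 \<and> (\<forall>p\<in>J. const c * p \<in> I)"
  proof -
    obtain T where T: "finite T" "J = rspan n T" using \<open>fgm n J\<close> unfolding fgm_def by (elim exE conjE)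
    have "\<exists>c. c \<noteq> 0 \<and> (\<forall>p\<in>T'. const c * p \<in> I)" if "finite T'" "T' \<subseteq> J" for T'
      using that
    proof (induction T' rule: finite_induct)
      case (insert s T')
      obtain c where c: "c \<noteq> 0" "\<forall>p\<in>T'. const c * p \<in> I" using insert by blast
      obtain a where a: "a \<noteq> 0" "const a * s \<in> I" using insert.prems unfolding J_def by blast
      have "const (a * c) * p \<in> I" if p: "p \<in> insert s T'" for p
      proof -
        have "const (a * c) * p = const a * (const c * p)" "const (a * c) * p = const c * (const a * p)"
          by (simp_all add: const_mult mult_ac)
        then show ?thesis using p c(2) a(2) Is(3)[OF polys_const] by (metis insertE)
      qed
      then show ?case using a(1) c(1) by (intro exI[of _ "a * c"]) auto
    qed (auto intro: exI[of _ 1])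
    from this[OF T(1)] obtain c where c: "c \<noteq> 0" "\<forall>p\<in>T. const c * p \<in> I" using T(2) rspan_base by blast
    have "submod n {p. const c * p \<in> I}"
    proof (rule submodI)
      show "a * p \<in> {p. const c * p \<in> I}" if "a \<in> polys n" "p \<in> {p. const c * p \<in> I}" for a p
        using Is(3)[of a "const c * p"] that by (simp add: mult_ac)
    qed (use Is in \<open>auto simp: distrib_left\<close>)
    then have "rspan n T \<subseteq> {p. const c * p \<in> I}" using c(2) by (intro rspan_least) auto
    then show ?thesis using c(1) T(2) by blast
  qed
  then obtain c where c: "c \<noteq> 0" "\<forall>p\<in>J. const c * p \<in> I" by blast
  have fk: "f ^ k \<in> polys n" for k by (rule polys_power[OF f])
  \<comment> \<open>the elements that a power of \<open>f\<close> sends into \<open>J\<close> form a saturated module, so one power works for all of them\<close>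
  define F where "F = {x \<in> polys n. \<exists>j. f ^ j * x \<in> J}"
  have up: "f ^ l * x \<in> J" if "f ^ k * x \<in> J" "k \<le> l" for k l x
    using Js(3)[OF fk that(1), of "l - k"] that(2) by (simp flip: mult.assoc power_add)
  have F: "submod n F"
  proof (rule submodI)
    show "0 \<in> F" unfolding F_def using Js(1) by simp
    show "p + q \<in> F" if pq: "p \<in> F" "q \<in> F" for p q
    proof -
      obtain i j where ij: "f ^ i * p \<in> J" "f ^ j * q \<in> J" using pq unfolding F_def by blast
      have "f ^ max i j * (p + q) \<in> J"
        unfolding distrib_left using up[OF ij(1), of "max i j"] up[OF ij(2), of "max i j"] by (intro Js(2)) simp_all
      then show ?thesis using pq unfolding F_def by (blast intro: polys_add)
    qed
    show "a * p \<in> F" if a: "a \<in> polys n" and p: "p \<in> F" for a p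
    proof -
      obtain j where "f ^ j * p \<in> J" using p unfolding F_def by blast
      then have "f ^ j * (a * p) \<in> J" by (subst mult.left_commute) (rule Js(3)[OF a])
      then show ?thesis using a p unfolding F_def by (blast intro: polys_mult)
    qed
  qed
  have satF: "p \<in> F" if a: "a \<noteq> 0" and p: "const a * p \<in> F" for a p
  proof -
    obtain j where j: "f ^ j * (const a * p) \<in> J" using p unfolding F_def by blast
    then have "f ^ j * p \<in> J" using satJ[OF a, of "f ^ j * p"] by (simp add: mult_ac)
    moreover have "supp p \<subseteq> supp (const a * p)" using a by (auto simp: in_keys_iff)
    then have "p \<in> polys n" using p unfolding F_def polys_def by blast
    ultimately show ?thesis unfolding F_def by blast
  qed
  have "F \<subseteq> free n {0}" unfolding free_zero_basis F_def by blast
  then have "fgm n F" using saturated_fgm[of "{0}" F n] F satF by blast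
  then have "\<exists>k. \<forall>p\<in>F. f ^ k * p \<in> J"
  proof (rule fgm_uniform[where Q = "\<lambda>k p. f ^ k * p \<in> J"])
    show "\<exists>k. f ^ k * p \<in> J" if "p \<in> F" for p using that unfolding F_def by blast
    show "submod n {p. f ^ k * p \<in> J}" for k
    proof (rule submodI)
      show "a * p \<in> {p. f ^ k * p \<in> J}" if "a \<in> polys n" "p \<in> {p. f ^ k * p \<in> J}" for a p
        using Js(3)[of a "f ^ k * p"] that by (simp add: mult_ac)
    qed (use Js in \<open>auto simp: distrib_left\<close>)
  qed (rule up)
  then obtain k0 where k0: "\<forall>p\<in>F. f ^ k0 * p \<in> J" ..
  \<comment> \<open>inside \<open>J\<close>, torsion modulo \<open>I\<close> is seen modulo \<open>I\<close> and \<open>c\<close>, where bounded torsion applies\<close>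
  obtain S where S: "finite S" "I = rspan n S" using I(1) unfolding fgm_def by (elim exE conjE)
  define M where "M = rspan n (insert (const c) S)"
  have Mp: "M \<subseteq> polys n"
    unfolding M_def using I(2) S(2) rspan_base by (intro rspan_least[OF submod_polys]) auto
  have cM: "const c \<in> M" unfolding M_def by (rule rspan_base) simp
  have "presentation (polys n) n (\<lambda>p. p) {0} (\<lambda>p. p) M (polys n)"
  proof (unfold_locales)
    have "{q \<in> free n {0}. q \<in> M} = M" using Mp unfolding free_zero_basis by blast
    then show "fgm n {q \<in> free n {0}. q \<in> M}" unfolding fgm_def M_def using S(1) by blast
    show "\<exists>q\<in>free n {0}. x - q \<in> M" if "x \<in> polys n" for x
      using that unfolding free_zero_basis M_def by (intro bexI[of _ x]) auto
  qed (use Mp in \<open>auto simp: M_def free_zero_basis ringhom_id intro: polys_add polys_mult polys_uminus submodD(2,3)[OF submod_rspan]\<close>)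
  then obtain k1 where k1: "\<forall>x\<in>polys n. \<forall>j. f ^ j * x \<in> M \<longrightarrow> f ^ k1 * x \<in> M"
    using bounded_torsion[of "polys n" n "\<lambda>p. p" "{0}" "\<lambda>p. p" M "polys n" f c] f c(1)
      submodD(3)[OF submod_rspan _ cM[unfolded M_def]] unfolding M_def[symmetric] by (auto simp: mult.commute)
  have M_sum: "\<exists>i\<in>I. \<exists>r\<in>polys n. p = i + const c * r" if "p \<in> M" for p
    using that unfolding M_def
  proof (induction p rule: rspan.induct)
    case rspan_zero
    show ?case using Is(1) by (intro bexI[of _ 0]) auto
  next
    case (rspan_step a s p)
    then obtain i r where ir: "i \<in> I" "r \<in> polys n" "p = i + const c * r" by blast
    show ?case
    proof (cases "s \<in> S")
      case True
      then have "a * s + i \<in> I" using S(2) rspan.rspan_step[OF rspan_step.hyps(1)] ir(1) by blast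
      moreover have "a * s + p = (a * s + i) + const c * r" unfolding ir(3) by simp
      ultimately show ?thesis using ir(2) by blast
    next
      case False
      then have "a * s + p = i + const c * (a + r)" using rspan_step.hyps(2) unfolding ir(3) by (simp add: algebra_simps)
      then show ?thesis using ir(1) polys_add[OF rspan_step.hyps(1) ir(2)] by blast
    qed
  qed
  have "{x \<in> polys n. \<exists>j. f ^ j * x \<in> I} = {x \<in> free n {0}. f ^ (k1 + k0) * x \<in> I}"
  proof -
    have "f ^ (k1 + k0) * x \<in> I" if x: "x \<in> polys n" and j: "f ^ j * x \<in> I" for x j
    proof -
      let ?y = "f ^ k0 * x"
      have yJ: "?y \<in> J" using k0 x j IJ unfolding F_def by blast
      have "f ^ j * ?y \<in> I" using Is(3)[OF fk j, of k0] by (simp add: mult_ac)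
      then have "f ^ j * ?y \<in> M" unfolding M_def S(2) using rspan_mono[of S "insert (const c) S" n] by blast
      then have "f ^ k1 * ?y \<in> M" using k1 polys_mult[OF fk x] by blast
      then obtain i r where ir: "i \<in> I" "r \<in> polys n" "f ^ k1 * ?y = i + const c * r" using M_sum by blast
      have "const c * r = f ^ k1 * ?y - i" using ir(3) by simp
      also have "\<dots> \<in> J" using Js(5)[OF Js(3)[OF fk yJ]] ir(1) IJ by blast
      finally have "r \<in> J" by (rule satJ[OF c(1)])
      then have "f ^ k1 * ?y \<in> I" unfolding ir(3) using c(2) ir(1) Is(2) by blast
      then show ?thesis by (simp add: power_add mult.assoc)
    qed
    then show ?thesis unfolding free_zero_basis by blast
  qed
  then show ?thesis by (rule ssubst) (rule fgm_preimage[OF _ linear_mult I(1)], simp)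
qed

end

section \<open>Initial modules for weights\<close>

definition piece :: "(expo \<Rightarrow> bool) \<Rightarrow> 'a::comm_ring_1 mpol \<Rightarrow> 'a mpol" where
  "piece P = lext (\<lambda>\<gamma> c. if P \<gamma> then sgl \<gamma> c else 0)"

lemma piece_0 [simp]: "piece P 0 = 0"
  by (simp add: piece_def)

lemma piece_add: "piece P (p + q) = piece P p + piece P q"
  unfolding piece_def by (rule lext_add) (auto simp: single_add)

lemma piece_single: "piece P (sgl \<gamma> c) = (if P \<gamma> then sgl \<gamma> c else 0)"
  unfolding piece_def by (subst lext_single) auto

lemma lookup_piece: "lk (piece P p) \<gamma> = (if P \<gamma> then lk p \<gamma> else 0)"
proof -
  have "lk (piece P p) \<gamma> = (\<Sum>\<delta>\<in>supp p. if \<delta> = \<gamma> then (if P \<gamma> then lk p \<gamma> else 0) else 0)"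
    unfolding piece_def lext_def lookup_sum by (intro sum.cong refl) (auto simp: lookup_single when_def)
  also have "\<dots> = (if P \<gamma> then lk p \<gamma> else 0)"
    by (simp add: sum.delta in_keys_iff)
  finally show ?thesis .
qed

lemma keys_piece: "supp (piece P p) = {\<gamma> \<in> supp p. P \<gamma>}"
  by (auto simp: in_keys_iff lookup_piece split: if_splits)

lemma piece_polys: "p \<in> polys n \<Longrightarrow> piece P p \<in> polys n"
  unfolding polys_def by (auto simp: keys_piece)

lemma piece_partition:
  assumes "finite E" "d ` supp p \<subseteq> E"
  shows "p = (\<Sum>e\<in>E. piece (\<lambda>\<gamma>. d \<gamma> = e) p)"
proof (rule poly_mapping_eqI)
  fix \<gamma>
  have "(\<Sum>e\<in>E. lk (piece (\<lambda>\<gamma>. d \<gamma> = e) p) \<gamma>) = (\<Sum>e\<in>E. if e = d \<gamma> then lk p \<gamma> else 0)"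
    by (intro sum.cong refl) (simp add: lookup_piece)
  also have "\<dots> = lk p \<gamma>"
  proof (cases "\<gamma> \<in> supp p")
    case True
    then have "d \<gamma> \<in> E" using assms(2) by blast
    then show ?thesis using assms(1) by simp
  next
    case False
    then have "lk p \<gamma> = 0" by (simp add: in_keys_iff)
    then show ?thesis by (simp add: sum.neutral)
  qed
  finally show "lk p \<gamma> = lk (\<Sum>e\<in>E. piece (\<lambda>\<gamma>. d \<gamma> = e) p) \<gamma>"
    by (simp add: lookup_sum)
qed

lemma piece_mult_form:
  fixes d :: "expo \<Rightarrow> int"
  assumes "\<And>\<alpha> \<beta>. d (\<alpha> + \<beta>) = d \<alpha> + d \<beta>" "\<And>\<alpha>. \<alpha> \<in> supp a \<Longrightarrow> d \<alpha> = e"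
  shows "piece (\<lambda>\<gamma>. d \<gamma> = e + x) (a * f) = a * piece (\<lambda>\<gamma>. d \<gamma> = x) (f :: 'a::comm_ring_1 mpol)"
proof (rule multiplicative_on_terms[where f = "piece (\<lambda>\<gamma>. d \<gamma> = e + x)" and h = "\<lambda>a. a" and k = "piece (\<lambda>\<gamma>. d \<gamma> = x)"])
  show "piece (\<lambda>\<gamma>. d \<gamma> = e + x) (sgl (\<gamma> + \<delta>) (b * c)) = sgl \<gamma> b * piece (\<lambda>\<gamma>. d \<gamma> = x) (sgl \<delta> c)"
    if "\<gamma> \<in> supp a" for \<gamma> \<delta> and b c :: 'a
    using assms(1)[of \<gamma> \<delta>] assms(2)[OF that] by (simp add: piece_single mult_single)
qed (simp_all add: piece_add)

definition wdeg :: "nat \<Rightarrow> (nat \<Rightarrow> int) \<Rightarrow> expo \<Rightarrow> int" where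
  "wdeg n w \<alpha> = (\<Sum>i<n. w i * int (lk \<alpha> i))"

lemma wdeg_add: "wdeg n w (\<alpha> + \<beta>) = wdeg n w \<alpha> + wdeg n w \<beta>"
  by (simp add: wdeg_def lookup_add sum.distrib distrib_left)

lemma wdeg_0 [simp]: "wdeg n w 0 = 0"
  by (simp add: wdeg_def)

lemma wdeg_lo [simp]: "wdeg n w (lo n \<alpha>) = wdeg n w \<alpha>"
  by (simp add: wdeg_def)

lemma wdeg_single_last [simp]: "wdeg n w (sgl n k) = 0"
  by (simp add: wdeg_def lookup_single when_def)

definition bound_deg :: "nat \<Rightarrow> (nat \<Rightarrow> int) \<Rightarrow> 'a::comm_ring_1 mpol \<Rightarrow> int \<Rightarrow> bool" where
  "bound_deg n w f d \<longleftrightarrow> (\<forall>\<alpha>\<in>supp f. wdeg n w \<alpha> \<le> d)"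

lemma bound_deg_exists: "\<exists>d. bound_deg n w f d"
proof
  show "bound_deg n w f (Max (insert 0 (wdeg n w ` supp f)))"
    unfolding bound_deg_def by (auto intro: Max_ge)
qed

lemma bound_deg_mono: "bound_deg n w f d \<Longrightarrow> d \<le> e \<Longrightarrow> bound_deg n w f e"
  unfolding bound_deg_def by force

lemma bound_deg_add: "bound_deg n w f d \<Longrightarrow> bound_deg n w g d \<Longrightarrow> bound_deg n w (f + g) d"
  unfolding bound_deg_def using Poly_Mapping.keys_add[of f g] by blast

lemma bound_deg_mult:
  assumes "bound_deg n w f d" "bound_deg n w g e"
  shows "bound_deg n w (f * g) (d + e)"
  unfolding bound_deg_def
proof
  fix \<gamma> assume "\<gamma> \<in> supp (f * g)"
  then obtain x y where xy: "x \<in> supp f" "y \<in> supp g" "\<gamma> = x + y"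
    using Poly_Mapping.keys_mult[of f g] by blast
  then have "wdeg n w x \<le> d" "wdeg n w y \<le> e" using assms unfolding bound_deg_def by blast+
  then show "wdeg n w \<gamma> \<le> d + e" unfolding xy(3) wdeg_add by simp
qed

text \<open>
  A bound \<open>d\<close> that is not attained gives the generator \<open>0\<close>, which spares the treatment of maxima; an
  attained one gives an initial form.
\<close>

definition initial :: "nat \<Rightarrow> (nat \<Rightarrow> int) \<Rightarrow> 'a::comm_ring_1 mpol set \<Rightarrow> 'a mpol set" where
  "initial n w I = rspan n {piece (\<lambda>\<alpha>. wdeg n w \<alpha> = d) f | f d. f \<in> I \<and> bound_deg n w f d}"

text \<open>
  Homogenization with the new variable \<open>X\<^sub>n\<close>. Its exponents \<open>d - wdeg n w \<alpha>\<close> are natural numbers as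
  soon as \<open>d\<close> bounds the degrees, whatever the signs of the weights.
\<close>

definition homogenize :: "nat \<Rightarrow> (nat \<Rightarrow> int) \<Rightarrow> int \<Rightarrow> 'a::comm_ring_1 mpol \<Rightarrow> 'a mpol" where
  "homogenize n w d = lext (\<lambda>\<alpha> c. sgl (\<alpha> + sgl n (nat (d - wdeg n w \<alpha>))) c)"

definition set_last_1 :: "nat \<Rightarrow> 'a::comm_ring_1 mpol \<Rightarrow> 'a mpol" where
  "set_last_1 n = lext (\<lambda>\<gamma> c. sgl (lo n \<gamma>) c)"

definition set_last_0 :: "nat \<Rightarrow> 'a::comm_ring_1 mpol \<Rightarrow> 'a mpol" where
  "set_last_0 n = piece (\<lambda>\<gamma>. lk \<gamma> n = 0)"

lemma homogenize_0 [simp]: "homogenize n w d 0 = 0"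
  by (simp add: homogenize_def)

lemma homogenize_add: "homogenize n w d (p + q) = homogenize n w d p + homogenize n w d q"
  unfolding homogenize_def by (rule lext_add) (auto simp: single_add)

lemma homogenize_single:
  "homogenize n w d (sgl \<alpha> c) = sgl (\<alpha> + sgl n (nat (d - wdeg n w \<alpha>))) c"
  unfolding homogenize_def by (subst lext_single) auto

lemma homogenize_sum: "homogenize n w d (sum f I) = (\<Sum>i\<in>I. homogenize n w d (f i))"
  by (rule additive_sum[of "homogenize n w d"]) (simp_all add: homogenize_add)

lemma homogenize_polys:
  assumes "f \<in> polys n"
  shows "homogenize n w d f \<in> polys (Suc n)"
  unfolding homogenize_def lext_def
proof (intro polys_sum polys_single expos_add)
  show "\<alpha> \<in> expos (Suc n)" if "\<alpha> \<in> supp f" for \<alpha>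
    using that assms expos_mono[of n "Suc n"] unfolding polys_def by auto
  show "sgl n k \<in> expos (Suc n)" for k
    by (auto simp: in_expos_iff lookup_single when_def)
qed

lemma homogenize_mult:
  assumes "bound_deg n w f d" "bound_deg n w g e"
  shows "homogenize n w (d + e) (f * g) = homogenize n w d f * homogenize n w e (g :: 'a::comm_ring_1 mpol)"
proof (rule multiplicative_on_terms[where f = "homogenize n w (d + e)" and h = "homogenize n w d" and k = "homogenize n w e"])
  fix \<gamma> \<delta> and a b :: 'a
  assume "\<gamma> \<in> supp f" "\<delta> \<in> supp g"
  then have "wdeg n w \<gamma> \<le> d" "wdeg n w \<delta> \<le> e" using assms unfolding bound_deg_def by blast+
  then have "nat (d + e - wdeg n w (\<gamma> + \<delta>)) = nat (d - wdeg n w \<gamma>) + nat (e - wdeg n w \<delta>)"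
    by (simp add: wdeg_add)
  then show "homogenize n w (d + e) (sgl (\<gamma> + \<delta>) (a * b)) =
      homogenize n w d (sgl \<gamma> a) * homogenize n w e (sgl \<delta> b)"
    by (simp add: homogenize_single mult_single single_add ac_simps)
qed (simp_all add: homogenize_add)

lemma homogenize_shift:
  assumes "bound_deg n w f d"
  shows "homogenize n w (d + int k) f = var n k * homogenize n w d (f :: 'a::comm_ring_1 mpol)"
proof (rule additive_eq_on_terms[where f = "homogenize n w (d + int k)" and h = "\<lambda>f. var n k * homogenize n w d f"])
  fix \<gamma> and c :: 'a
  assume "\<gamma> \<in> supp f"
  then have "wdeg n w \<gamma> \<le> d" using assms unfolding bound_deg_def by blast
  then have "nat (d + int k - wdeg n w \<gamma>) = k + nat (d - wdeg n w \<gamma>)" by simp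
  then show "homogenize n w (d + int k) (sgl \<gamma> c) = var n k * homogenize n w d (sgl \<gamma> c)"
    by (simp add: homogenize_single mpow_def mult_single single_add ac_simps)
qed (simp_all add: homogenize_add distrib_left)

lemma set_last_1_single: "set_last_1 n (sgl \<gamma> c) = sgl (lo n \<gamma>) c"
  unfolding set_last_1_def by (subst lext_single) auto

lemma ringhom_set_last_1: "ringhom (set_last_1 n :: 'a::comm_ring_1 mpol \<Rightarrow> 'a mpol)"
proof -
  have add: "set_last_1 n (p + q) = set_last_1 n p + set_last_1 n q" for p q :: "'a mpol"
    unfolding set_last_1_def by (rule lext_add) (auto simp: single_add)
  have zero: "set_last_1 n (0 :: 'a mpol) = 0" by (simp add: set_last_1_def)
  have "set_last_1 n (p * q) = set_last_1 n p * set_last_1 n q" for p q :: "'a mpol"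
    by (rule multiplicative_on_terms[where f = "set_last_1 n" and h = "set_last_1 n" and k = "set_last_1 n", OF zero add zero add zero add])
      (simp add: set_last_1_single mult_single)
  moreover have "set_last_1 n (1 :: 'a mpol) = 1"
    using set_last_1_single[of n 0 "1 :: 'a"] by simp
  ultimately show ?thesis unfolding ringhom_def using add by blast
qed

lemma ringhom_set_last_0: "ringhom (set_last_0 n :: 'a::comm_ring_1 mpol \<Rightarrow> 'a mpol)"
proof -
  have add: "set_last_0 n (p + q) = set_last_0 n p + set_last_0 n q" for p q :: "'a mpol"
    unfolding set_last_0_def by (rule piece_add)
  have zero: "set_last_0 n (0 :: 'a mpol) = 0" by (simp add: set_last_0_def)
  have "set_last_0 n (p * q) = set_last_0 n p * set_last_0 n q" for p q :: "'a mpol"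
    by (rule multiplicative_on_terms[where f = "set_last_0 n" and h = "set_last_0 n" and k = "set_last_0 n", OF zero add zero add zero add])
      (simp add: set_last_0_def piece_single mult_single lookup_add)
  moreover have "set_last_0 n (1 :: 'a mpol) = 1"
    using piece_single[of "\<lambda>\<gamma>. lk \<gamma> n = 0" 0 "1 :: 'a"] by (simp add: set_last_0_def)
  ultimately show ?thesis unfolding ringhom_def using add by blast
qed

lemma set_last_1_polys: "set_last_1 n p \<in> polys n"
  unfolding set_last_1_def lext_def by (intro polys_sum polys_single) simp

lemma set_last_0_polys:
  assumes "p \<in> polys (Suc n)"
  shows "set_last_0 n p \<in> polys n"
proof -
  have "\<gamma> \<in> expos n" if "\<gamma> \<in> expos (Suc n)" "lk \<gamma> n = 0" for \<gamma>
    using that unfolding in_expos_iff by (metis Suc_leI le_eq_less_or_eq)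
  then have "supp (set_last_0 n p) \<subseteq> expos n"
    using assms unfolding set_last_0_def keys_piece polys_def by blast
  then show ?thesis unfolding polys_def by (rule CollectI)
qed

lemma set_last_1_id: "f \<in> polys n \<Longrightarrow> set_last_1 n f = f"
proof -
  assume f: "f \<in> polys n"
  have "set_last_1 n f = (\<Sum>\<gamma>\<in>supp f. sgl \<gamma> (lk f \<gamma>))"
    unfolding set_last_1_def lext_def using f
    by (intro sum.cong refl) (auto simp: polys_def in_expos_iff_lo dest!: subsetD)
  then show ?thesis by (simp only: mpol_sum_single[symmetric])
qed

lemma set_last_1_homogenize:
  assumes "f \<in> polys n"
  shows "set_last_1 n (homogenize n w d f) = (f :: 'a::comm_ring_1 mpol)"
proof -
  have "set_last_1 n (homogenize n w d f) = set_last_1 n f"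
  proof (rule additive_eq_on_terms[where f = "\<lambda>f. set_last_1 n (homogenize n w d f)" and h = "set_last_1 n"])
    fix \<gamma> and c :: 'a
    have "lo n (sgl n k) = 0" for k :: nat
      by (rule poly_mapping_eqI) (auto simp: lookup_single when_def)
    then show "set_last_1 n (homogenize n w d (sgl \<gamma> c)) = set_last_1 n (sgl \<gamma> c)"
      by (simp add: homogenize_single set_last_1_single)
  qed (simp_all add: homogenize_add ringhomD[OF ringhom_set_last_1])
  then show ?thesis using set_last_1_id[OF assms] by simp
qed

lemma set_last_0_homogenize:
  assumes "f \<in> polys n" "bound_deg n w f d"
  shows "set_last_0 n (homogenize n w d f) = piece (\<lambda>\<alpha>. wdeg n w \<alpha> = d) (f :: 'a::comm_ring_1 mpol)"
proof (rule additive_eq_on_terms[where f = "\<lambda>f. set_last_0 n (homogenize n w d f)" and h = "piece (\<lambda>\<alpha>. wdeg n w \<alpha> = d)"])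
  fix \<gamma> and c :: 'a
  assume \<gamma>: "\<gamma> \<in> supp f"
  have "wdeg n w \<gamma> \<le> d" using assms(2) \<gamma> unfolding bound_deg_def by blast
  moreover have "lk \<gamma> n = 0" using assms(1) \<gamma> unfolding polys_def by (auto simp: in_expos_iff)
  ultimately show "set_last_0 n (homogenize n w d (sgl \<gamma> c)) = piece (\<lambda>\<alpha>. wdeg n w \<alpha> = d) (sgl \<gamma> c)"
    by (auto simp: homogenize_single set_last_0_def piece_single lookup_add)
qed (simp_all add: homogenize_add piece_add ringhomD[OF ringhom_set_last_0])

text \<open>
  The degree in which homogenizations are forms; the new variable has weight one.
\<close>

definition total_deg :: "nat \<Rightarrow> (nat \<Rightarrow> int) \<Rightarrow> expo \<Rightarrow> int" where
  "total_deg n w \<gamma> = wdeg n w \<gamma> + int (lk \<gamma> n)"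

lemma total_deg_add: "total_deg n w (\<alpha> + \<beta>) = total_deg n w \<alpha> + total_deg n w \<beta>"
  by (simp add: total_deg_def wdeg_add lookup_add)

abbreviation form :: "nat \<Rightarrow> (nat \<Rightarrow> int) \<Rightarrow> int \<Rightarrow> 'a::comm_ring_1 mpol \<Rightarrow> 'a mpol" where
  "form n w e \<equiv> piece (\<lambda>\<gamma>. total_deg n w \<gamma> = e)"

lemma homogenize_is_form:
  assumes "f \<in> polys n" "bound_deg n w f d" "\<gamma> \<in> supp (homogenize n w d f)"
  shows "total_deg n w \<gamma> = d"
proof -
  obtain \<alpha> where \<alpha>: "\<alpha> \<in> supp f" "\<gamma> = \<alpha> + sgl n (nat (d - wdeg n w \<alpha>))"
    using assms(3) keys_sum[of "\<lambda>\<alpha>. sgl (\<alpha> + sgl n (nat (d - wdeg n w \<alpha>))) (lk f \<alpha>)" "supp f"]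
    unfolding homogenize_def lext_def by (auto split: if_splits)
  have "wdeg n w \<alpha> \<le> d" using assms(2) \<alpha>(1) unfolding bound_deg_def by blast
  moreover have "lk \<alpha> n = 0" using assms(1) \<alpha>(1) unfolding polys_def by (auto simp: in_expos_iff)
  ultimately show ?thesis unfolding \<alpha>(2) total_deg_def by (simp add: wdeg_add lookup_add)
qed

text \<open>A term \<open>X\<^sup>\<alpha> t\<^sup>k\<close> of a form of degree \<open>e\<close> has \<open>wdeg n w \<alpha> = e - k\<close>, so the terms without \<open>t\<close> are those of top degree.\<close>

lemma set_last_0_form:
  assumes "p \<in> polys (Suc n)"
  shows "bound_deg n w (set_last_1 n (form n w e p)) e"
    "set_last_0 n (form n w e p) = piece (\<lambda>\<alpha>. wdeg n w \<alpha> = e) (set_last_1 n (form n w e (p :: 'a::comm_ring_1 mpol)))"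
proof -
  show "bound_deg n w (set_last_1 n (form n w e p)) e"
    unfolding bound_deg_def
  proof
    fix \<alpha> assume "\<alpha> \<in> supp (set_last_1 n (form n w e p))"
    then obtain \<gamma> where \<gamma>: "\<gamma> \<in> supp (form n w e p)" "\<alpha> = lo n \<gamma>"
      using keys_sum[of "\<lambda>\<gamma>. sgl (lo n \<gamma>) (lk (form n w e p) \<gamma>)" "supp (form n w e p)"]
      unfolding set_last_1_def lext_def by (auto split: if_splits)
    then have "total_deg n w \<gamma> = e" unfolding keys_piece by blast
    then show "wdeg n w \<alpha> \<le> e" unfolding \<gamma>(2) total_deg_def by simp
  qed
  show "set_last_0 n (form n w e p) = piece (\<lambda>\<alpha>. wdeg n w \<alpha> = e) (set_last_1 n (form n w e p))"
  proof (rule additive_eq_on_terms[where f = "\<lambda>p. set_last_0 n (form n w e p)" and h = "\<lambda>p. piece (\<lambda>\<alpha>. wdeg n w \<alpha> = e) (set_last_1 n (form n w e p))"])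
    fix \<gamma> and c :: 'a
    assume "\<gamma> \<in> supp p"
    then have "\<gamma> \<in> expos (Suc n)" using assms unfolding polys_def by blast
    then have "lo n \<gamma> = \<gamma>" if "lk \<gamma> n = 0"
      using that unfolding in_expos_iff_lo[symmetric] in_expos_iff by (metis Suc_leI le_eq_less_or_eq)
    then show "set_last_0 n (form n w e (sgl \<gamma> c)) = piece (\<lambda>\<alpha>. wdeg n w \<alpha> = e) (set_last_1 n (form n w e (sgl \<gamma> c)))"
      by (auto simp: piece_single set_last_0_def set_last_1_single total_deg_def ringhomD[OF ringhom_set_last_1])
  qed (simp_all add: piece_add ringhomD[OF ringhom_set_last_1] ringhomD[OF ringhom_set_last_0])
qed

lemma set_last_1_var: "set_last_1 n (var n j) = (1 :: 'a::comm_ring_1 mpol)"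
proof -
  have "lo n (sgl n j) = 0" by (rule poly_mapping_eqI) (auto simp: lookup_single when_def)
  then show ?thesis unfolding mpow_def set_last_1_single by simp
qed

context archimedean_valuation_domain
begin

text \<open>
  The homogenization of an ideal is the saturation at the new variable of the ideal generated by
  the homogenized generators; setting the new variable to zero gives the initial ideal.
\<close>

theorem initial_fgm:
  fixes I :: "'a mpol set"
  assumes I: "fgm n I" "I \<subseteq> polys n"
  shows "fgm n (initial n w I)"
proof -
  obtain S where S: "finite S" "I = rspan n S" using I(1) unfolding fgm_def by (elim exE conjE)
  have SI: "s \<in> I" if "s \<in> S" for s using rspan_base[OF that] S(2) by blast
  have Sp: "s \<in> polys n" if "s \<in> S" for s using SI[OF that] I(2) by blast
  have "\<exists>dg. \<forall>f :: 'a mpol. bound_deg n w f (dg f)" by (intro choice allI bound_deg_exists)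
  then obtain dg where dg: "\<forall>f :: 'a mpol. bound_deg n w f (dg f)" ..
  let ?hs = "\<lambda>s. homogenize n w (dg s) s"
  define J where "J = rspan (Suc n) (?hs ` S)"
  have Jp: "J \<subseteq> polys (Suc n)"
    unfolding J_def by (rule rspan_least[OF submod_polys]) (auto intro: homogenize_polys Sp)
  note Js = submodD[OF submod_rspan[of "Suc n" "?hs ` S"], folded J_def]
  define L where "L = {x \<in> polys (Suc n). \<exists>j. (var n 1) ^ j * x \<in> J}"
  have "fgm (Suc n) J" unfolding fgm_def J_def using S(1) by blast
  then have "fgm (Suc n) L"
    unfolding L_def using Jp by (rule saturation_at_polynomial_fgm) simp
  then obtain G where G: "finite G" "L = rspan (Suc n) G" unfolding fgm_def by (elim exE conjE)
  let ?Gen = "{piece (\<lambda>\<alpha>. wdeg n w \<alpha> = d) f | f d. f \<in> I \<and> bound_deg n w f d}"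
  have at0_span: "set_last_0 n q \<in> rspan n (set_last_0 n ` G)" if "q \<in> rspan (Suc n) G" for q
    using that by (induction q rule: rspan.induct)
      (auto simp: ringhomD[OF ringhom_set_last_0] intro: rspan_step set_last_0_polys)
  have top: "piece (\<lambda>\<alpha>. wdeg n w \<alpha> = d) f \<in> rspan n (set_last_0 n ` G)" if f: "f \<in> I" and d: "bound_deg n w f d" for f d
  proof -
    obtain a where a: "\<forall>s\<in>S. a s \<in> polys n" "f = (\<Sum>s\<in>S. a s * s)"
      using f unfolding S(2) rspan_finite_sum[OF S(1)] by (elim exE conjE)
    define e where "e = Max (insert d ((\<lambda>s. dg (a s) + dg s) ` S))"
    have e: "d \<le> e" "\<And>s. s \<in> S \<Longrightarrow> dg (a s) + dg s \<le> e"
      unfolding e_def using S(1) by (auto intro: Max_ge)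
    have "homogenize n w e f = (\<Sum>s\<in>S. homogenize n w (e - dg s) (a s) * ?hs s)"
      unfolding a(2) homogenize_sum
    proof (intro sum.cong refl)
      fix s assume s: "s \<in> S"
      have "bound_deg n w (a s) (e - dg s)"
        by (rule bound_deg_mono[OF spec[OF dg]]) (use e(2)[OF s] in simp)
      from homogenize_mult[OF this spec[OF dg, of s]]
      show "homogenize n w e (a s * s) = homogenize n w (e - dg s) (a s) * ?hs s" by simp
    qed
    also have "\<dots> \<in> J"
      unfolding J_def using a(1) by (intro rspan_lincomb homogenize_polys rspan_base) auto
    finally have "homogenize n w e f \<in> J" .
    moreover have "homogenize n w e f = var n (nat (e - d)) * homogenize n w d f"
      using homogenize_shift[OF d, of "nat (e - d)"] e(1) by simp
    ultimately have "(var n 1) ^ nat (e - d) * homogenize n w d f \<in> J" unfolding var_power by simp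
    moreover have fp: "f \<in> polys n" using f I(2) by blast
    ultimately have "homogenize n w d f \<in> L" unfolding L_def using homogenize_polys by blast
    then have "homogenize n w d f \<in> rspan (Suc n) G" unfolding G(2) .
    then have "set_last_0 n (homogenize n w d f) \<in> rspan n (set_last_0 n ` G)" by (rule at0_span)
    then show ?thesis unfolding set_last_0_homogenize[OF fp d] .
  qed
  have form_J: "form n w e p \<in> J" if "p \<in> J" for e p
    using that unfolding J_def
  proof (induction p rule: rspan.induct)
    case (rspan_step a h p)
    obtain s where s: "s \<in> S" "h = ?hs s" using rspan_step.hyps(2) by (rule imageE)
    have "form n w (dg s + (e - dg s)) (h * a) = h * form n w (e - dg s) a"
      unfolding s(2) by (rule piece_mult_form[OF total_deg_add homogenize_is_form[OF Sp[OF s(1)] spec[OF dg]]])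
    then have "form n w e (a * h) = form n w (e - dg s) a * h" by (simp add: mult.commute)
    moreover have "form n w (e - dg s) a * h \<in> rspan (Suc n) (?hs ` S)"
      by (rule submodD(3)[OF submod_rspan piece_polys[OF rspan_step.hyps(1)] rspan_base[OF rspan_step.hyps(2)]])
    ultimately show ?case unfolding piece_add using submodD(2)[OF submod_rspan _ rspan_step.IH] by simp
  qed simp
  have at1_J: "set_last_1 n p \<in> I" if "p \<in> J" for p
    using that unfolding J_def
  proof (induction p rule: rspan.induct)
    case (rspan_step a h p)
    obtain s where s: "s \<in> S" "h = ?hs s" using rspan_step.hyps(2) by (rule imageE)
    have "set_last_1 n (a * h + p) = set_last_1 n a * s + set_last_1 n p"
      unfolding s(2) by (simp add: ringhomD[OF ringhom_set_last_1] set_last_1_homogenize[OF Sp[OF s(1)]])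
    also have "\<dots> \<in> I"
      using rspan.rspan_step[OF set_last_1_polys s(1)] rspan_step.IH unfolding S(2) by blast
    finally show ?case .
  qed (simp add: ringhomD[OF ringhom_set_last_1] S(2))
  have sub: "submod n (initial n w I)" unfolding initial_def by (rule submod_rspan)
  have "set_last_0 n ` G \<subseteq> initial n w I"
  proof (rule image_subsetI)
    fix g assume "g \<in> G"
    then have "g \<in> L" using rspan_base G(2) by blast
    then obtain j where g: "g \<in> polys (Suc n)" "var n j * g \<in> J" unfolding L_def var_power by blast
    have part: "set_last_0 n (form n w e g) \<in> initial n w I" for e
    proof -
      have "total_deg n w \<alpha> = int j" if "\<alpha> \<in> supp (var n j :: 'a mpol)" for \<alpha>
        using that unfolding mpow_def total_deg_def by simp
      then have "form n w (int j + e) (var n j * g) = var n j * form n w e g"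
        by (rule piece_mult_form[OF total_deg_add])
      then have "var n j * form n w e g \<in> J" using form_J[OF g(2), of "int j + e"] by simp
      then have "set_last_1 n (form n w e g) \<in> I"
        using at1_J[of "var n j * form n w e g"] by (simp add: ringhomD[OF ringhom_set_last_1] set_last_1_var)
      then show ?thesis
        unfolding set_last_0_form(2)[OF g(1)] initial_def using set_last_0_form(1)[OF g(1)] by (intro rspan_base) blast
    qed
    have "g = (\<Sum>e\<in>total_deg n w ` supp g. form n w e g)"
      by (rule piece_partition) auto
    then have "set_last_0 n g = set_last_0 n (\<Sum>e\<in>total_deg n w ` supp g. form n w e g)"
      by (rule arg_cong)
    also have "\<dots> = (\<Sum>e\<in>total_deg n w ` supp g. set_last_0 n (form n w e g))"
      by (rule ringhomD(8)[OF ringhom_set_last_0])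
    also have "\<dots> \<in> initial n w I" by (rule submod_sum[OF sub part])
    finally show "set_last_0 n g \<in> initial n w I" .
  qed
  moreover have "initial n w I \<subseteq> rspan n (set_last_0 n ` G)"
    unfolding initial_def by (rule rspan_least[OF submod_rspan]) (use top in blast)
  ultimately show ?thesis using G(1) by (intro fgmI[OF _ sub]) auto
qed

end

lemma initial_polys: "I \<subseteq> polys n \<Longrightarrow> initial n w I \<subseteq> polys n"
  unfolding initial_def by (rule rspan_least[OF submod_polys]) (auto intro: piece_polys)

section \<open>Leading terms for orders given by integer weights\<close>

text \<open>
  Only lists of equal length are compared; the value on other lists is a convention.
\<close>

fun lex_le :: "int list \<Rightarrow> int list \<Rightarrow> bool" where
  "lex_le (x # xs) (y # ys) \<longleftrightarrow> x < y \<or> (x = y \<and> lex_le xs ys)"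
| "lex_le [] ys \<longleftrightarrow> True"
| "lex_le xs [] \<longleftrightarrow> True"

definition degs :: "nat \<Rightarrow> (nat \<Rightarrow> int) list \<Rightarrow> expo \<Rightarrow> int list" where
  "degs n ws \<alpha> = map (\<lambda>w. wdeg n w \<alpha>) ws"

lemma degs_Cons [simp]: "degs n (w # ws) \<alpha> = wdeg n w \<alpha> # degs n ws \<alpha>"
  by (simp add: degs_def)

lemma degs_Nil [simp]: "degs n [] \<alpha> = []"
  by (simp add: degs_def)

lemma length_degs [simp]: "length (degs n ws \<alpha>) = length ws"
  by (simp add: degs_def)

text \<open>
  Allowing every upper bound \<open>ds\<close>, attained or not, avoids maxima and keeps the generators stable
  under taking pieces; a bound that is not attained contributes zero.
\<close>

definition lex_initial :: "nat \<Rightarrow> (nat \<Rightarrow> int) list \<Rightarrow> 'a::comm_ring_1 mpol set \<Rightarrow> 'a mpol set" where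
  "lex_initial n ws I = rspan n {piece (\<lambda>\<alpha>. degs n ws \<alpha> = ds) f | f ds.
     f \<in> I \<and> length ds = length ws \<and> (\<forall>\<alpha>\<in>supp f. lex_le (degs n ws \<alpha>) ds)}"

lemma piece_True: "piece (\<lambda>_. True) f = f"
  by (rule poly_mapping_eqI) (simp add: lookup_piece)

lemma piece_piece: "piece P (piece Q f) = piece (\<lambda>\<alpha>. Q \<alpha> \<and> P \<alpha>) f"
  by (rule poly_mapping_eqI) (simp add: lookup_piece)

lemma lex_initial_Nil:
  assumes "submod n I"
  shows "lex_initial n [] I = I"
proof -
  have "{piece (\<lambda>\<alpha>. degs n [] \<alpha> = ds) f | f ds. f \<in> I \<and> length ds = length ([] :: (nat \<Rightarrow> int) list) \<and>
      (\<forall>\<alpha>\<in>supp f. lex_le (degs n [] \<alpha>) ds)} = I"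
    by (auto simp: piece_True)
  then have "lex_initial n [] I = rspan n I" unfolding lex_initial_def by simp
  also have "\<dots> = I"
    using rspan_least[OF assms subset_refl] rspan_base by blast
  finally show ?thesis .
qed

text \<open>
  Initial modules are graded, and their pieces are initial forms themselves: initial forms of the
  same degree \<open>d\<close> add up to the piece of degree \<open>d\<close> of a sum, because \<open>d\<close> bounds both summands.
\<close>

lemma initial_piece:
  fixes I :: "'a::comm_ring_1 mpol set"
  assumes I: "submod n I" and h: "h \<in> initial n w I"
  shows "\<exists>f\<in>I. bound_deg n w f d \<and> piece (\<lambda>\<alpha>. wdeg n w \<alpha> = d) h = piece (\<lambda>\<alpha>. wdeg n w \<alpha> = d) f"
  using h unfolding initial_def
proof (induction h rule: rspan.induct)
  case rspan_zero
  show ?case using submodD(1)[OF I] by (intro bexI[of _ 0]) (auto simp: bound_deg_def)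
next
  case (rspan_step a s p)
  obtain f0 e where s: "s = piece (\<lambda>\<alpha>. wdeg n w \<alpha> = e) f0" "f0 \<in> I" "bound_deg n w f0 e"
    using rspan_step.hyps(2) by blast
  obtain f where f: "f \<in> I" "bound_deg n w f d" "piece (\<lambda>\<alpha>. wdeg n w \<alpha> = d) p = piece (\<lambda>\<alpha>. wdeg n w \<alpha> = d) f"
    using rspan_step.IH by blast
  let ?a = "piece (\<lambda>\<alpha>. wdeg n w \<alpha> = d - e) a"
  have "piece (\<lambda>\<alpha>. wdeg n w \<alpha> = e + (d - e)) (s * a) = s * ?a"
    by (rule piece_mult_form[OF wdeg_add]) (auto simp: s(1) keys_piece)
  then have 1: "piece (\<lambda>\<alpha>. wdeg n w \<alpha> = d) (a * s) = ?a * s" by (simp add: mult.commute)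
  have "piece (\<lambda>\<alpha>. wdeg n w \<alpha> = (d - e) + e) (?a * f0) = ?a * piece (\<lambda>\<alpha>. wdeg n w \<alpha> = e) f0"
    by (rule piece_mult_form[OF wdeg_add]) (auto simp: keys_piece)
  then have 2: "piece (\<lambda>\<alpha>. wdeg n w \<alpha> = d) (?a * f0) = ?a * s" unfolding s(1) by simp
  have "bound_deg n w ?a (d - e)" unfolding bound_deg_def keys_piece by simp
  from bound_deg_mult[OF this s(3)] have 3: "bound_deg n w (?a * f0) d" by simp
  have 4: "?a * f0 \<in> I" by (rule submodD(3)[OF I piece_polys[OF rspan_step.hyps(1)] s(2)])
  show ?case
    using submodD(2)[OF I 4 f(1)] bound_deg_add[OF 3 f(2)] 1 2 f(3)
    by (intro bexI[of _ "?a * f0 + f"] conjI) (simp_all add: piece_add)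
qed

lemma piece_in_initial: "f \<in> I \<Longrightarrow> bound_deg n w f d \<Longrightarrow> piece (\<lambda>\<alpha>. wdeg n w \<alpha> = d) f \<in> initial n w I"
  unfolding initial_def by (rule rspan_base) blast

text \<open>
  Comparing weights lexicographically amounts to passing to initial modules weight by weight. For the
  harder inclusion, an element of the initial module is cut into pieces for the first weight,
  each of which comes from an element of \<open>I\<close> with the same top piece.
\<close>

lemma lex_initial_Cons:
  fixes I :: "'a::comm_ring_1 mpol set"
  assumes I: "submod n I"
  shows "lex_initial n (w # ws) I = lex_initial n ws (initial n w I)"
proof
  show "lex_initial n (w # ws) I \<subseteq> lex_initial n ws (initial n w I)"
    unfolding lex_initial_def[of n "w # ws"]
  proof (rule rspan_least, unfold lex_initial_def[of n ws], rule submod_rspan, rule subsetI)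
    fix p assume "p \<in> {piece (\<lambda>\<alpha>. degs n (w # ws) \<alpha> = ds) f | f ds.
       f \<in> I \<and> length ds = length (w # ws) \<and> (\<forall>\<alpha>\<in>supp f. lex_le (degs n (w # ws) \<alpha>) ds)}"
    then obtain f ds' where p: "p = piece (\<lambda>\<alpha>. degs n (w # ws) \<alpha> = ds') f" "f \<in> I" "length ds' = length (w # ws)"
        "\<forall>\<alpha>\<in>supp f. lex_le (degs n (w # ws) \<alpha>) ds'" by blast
    obtain d ds where ds: "ds' = d # ds" using p(3) by (cases ds') auto
    let ?g = "piece (\<lambda>\<alpha>. wdeg n w \<alpha> = d) f"
    have "bound_deg n w f d" using p(4) unfolding bound_deg_def ds by auto
    then have "?g \<in> initial n w I" by (rule piece_in_initial[OF p(2)])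
    moreover have "\<forall>\<alpha>\<in>supp ?g. lex_le (degs n ws \<alpha>) ds" using p(4) unfolding ds keys_piece by auto
    moreover have "p = piece (\<lambda>\<alpha>. degs n ws \<alpha> = ds) ?g" unfolding p(1) ds piece_piece by simp
    moreover have "length ds = length ws" using p(3) ds by simp
    ultimately show "p \<in> rspan n {piece (\<lambda>\<alpha>. degs n ws \<alpha> = ds) f | f ds.
       f \<in> initial n w I \<and> length ds = length ws \<and> (\<forall>\<alpha>\<in>supp f. lex_le (degs n ws \<alpha>) ds)}"
      by (intro rspan_base) blast
  qed
  show "lex_initial n ws (initial n w I) \<subseteq> lex_initial n (w # ws) I"
    unfolding lex_initial_def[of n ws]
  proof (rule rspan_least, unfold lex_initial_def[of n "w # ws"], rule submod_rspan, rule subsetI)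
    fix p assume "p \<in> {piece (\<lambda>\<alpha>. degs n ws \<alpha> = ds) f | f ds.
       f \<in> initial n w I \<and> length ds = length ws \<and> (\<forall>\<alpha>\<in>supp f. lex_le (degs n ws \<alpha>) ds)}"
    then obtain h ds where p: "p = piece (\<lambda>\<alpha>. degs n ws \<alpha> = ds) h" "h \<in> initial n w I" "length ds = length ws"
        "\<forall>\<alpha>\<in>supp h. lex_le (degs n ws \<alpha>) ds" by blast
    let ?E = "wdeg n w ` supp h"
    have "p = (\<Sum>d\<in>?E. piece (\<lambda>\<alpha>. wdeg n w \<alpha> = d) p)"
      by (rule piece_partition) (auto simp: p(1) keys_piece)
    also have "\<dots> \<in> rspan n {piece (\<lambda>\<alpha>. degs n (w # ws) \<alpha> = ds) f | f ds.
       f \<in> I \<and> length ds = length (w # ws) \<and> (\<forall>\<alpha>\<in>supp f. lex_le (degs n (w # ws) \<alpha>) ds)}"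
    proof (rule submod_sum[OF submod_rspan], rule rspan_base)
      fix d
      obtain f where f: "f \<in> I" "bound_deg n w f d" "piece (\<lambda>\<alpha>. wdeg n w \<alpha> = d) h = piece (\<lambda>\<alpha>. wdeg n w \<alpha> = d) f"
        using initial_piece[OF I p(2)] by blast
      have "piece (\<lambda>\<alpha>. wdeg n w \<alpha> = d) p = piece (\<lambda>\<alpha>. degs n ws \<alpha> = ds) (piece (\<lambda>\<alpha>. wdeg n w \<alpha> = d) h)"
        unfolding p(1) piece_piece by (rule arg_cong2[where f = piece]) auto
      also have "\<dots> = piece (\<lambda>\<alpha>. degs n (w # ws) \<alpha> = d # ds) f"
        unfolding f(3) piece_piece by simp
      finally have 1: "piece (\<lambda>\<alpha>. wdeg n w \<alpha> = d) p = piece (\<lambda>\<alpha>. degs n (w # ws) \<alpha> = d # ds) f" .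
      have 2: "lex_le (degs n (w # ws) \<alpha>) (d # ds)" if \<alpha>: "\<alpha> \<in> supp f" for \<alpha>
      proof (cases "wdeg n w \<alpha> = d")
        case True
        then have "\<alpha> \<in> supp (piece (\<lambda>\<alpha>. wdeg n w \<alpha> = d) h)"
          unfolding f(3) keys_piece using \<alpha> by blast
        then have "\<alpha> \<in> supp h" unfolding keys_piece by blast
        then show ?thesis using p(4) True by simp
      next
        case False
        then show ?thesis using f(2) \<alpha> unfolding bound_deg_def by force
      qed
      show "piece (\<lambda>\<alpha>. wdeg n w \<alpha> = d) p \<in> {piece (\<lambda>\<alpha>. degs n (w # ws) \<alpha> = ds) f | f ds.
         f \<in> I \<and> length ds = length (w # ws) \<and> (\<forall>\<alpha>\<in>supp f. lex_le (degs n (w # ws) \<alpha>) ds)}"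
        using 1 2 f(1) p(3) by (intro CollectI exI[of _ f] exI[of _ "d # ds"]) simp
    qed
    finally show "p \<in> rspan n {piece (\<lambda>\<alpha>. degs n (w # ws) \<alpha> = ds) f | f ds.
       f \<in> I \<and> length ds = length (w # ws) \<and> (\<forall>\<alpha>\<in>supp f. lex_le (degs n (w # ws) \<alpha>) ds)}" .
  qed
qed

lemma (in archimedean_valuation_domain) lex_initial_fgm:
  fixes I :: "'a mpol set"
  assumes "fgm n I" "I \<subseteq> polys n"
  shows "fgm n (lex_initial n ws I)"
  using assms
proof (induction ws arbitrary: I)
  case Nil
  then show ?case using lex_initial_Nil[OF fgm_submod] by metis
next
  case (Cons w ws)
  show ?case
    unfolding lex_initial_Cons[OF fgm_submod[OF Cons.prems(1)]]
    by (rule Cons.IH[OF initial_fgm[OF Cons.prems] initial_polys[OF Cons.prems(2)]])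
qed

section \<open>Ideals of the polynomial ring\<close>

lemma mpoly_ring_sel:
  "carrier (mpoly_ring n) = polys n" "x \<otimes>\<^bsub>mpoly_ring n\<^esub> y = x * y" "x \<oplus>\<^bsub>mpoly_ring n\<^esub> y = x + y"
  "\<zero>\<^bsub>mpoly_ring n\<^esub> = 0" "\<one>\<^bsub>mpoly_ring n\<^esub> = 1"
  unfolding mpoly_ring_def polys_def ring_of_type_algebra_def by simp_all

lemma ideal_iff_submod: "ideal I (mpoly_ring n) \<longleftrightarrow> I \<subseteq> polys n \<and> submod n (I :: 'a::comm_ring_1 mpol set)"
proof
  assume "ideal I (mpoly_ring n)"
  then interpret ideal I "mpoly_ring n" .
  show "I \<subseteq> polys n \<and> submod n I"
  proof (intro conjI submodI)
    show "I \<subseteq> polys n" using a_subset unfolding mpoly_ring_sel .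
    show "0 \<in> I" using additive_subgroup.zero_closed[OF is_additive_subgroup] unfolding mpoly_ring_sel .
    show "p + q \<in> I" if "p \<in> I" "q \<in> I" for p q
      using additive_subgroup.a_closed[OF is_additive_subgroup that] unfolding mpoly_ring_sel .
    show "a * p \<in> I" if "a \<in> polys n" "p \<in> I" for a p
      using I_l_closed[OF that(2), of a] that(1) unfolding mpoly_ring_sel .
  qed
next
  assume I: "I \<subseteq> polys n \<and> submod n I"
  interpret cring "mpoly_ring n :: 'a mpol ring" by (rule cring_mpoly_ring)
  show "ideal I (mpoly_ring n)"
  proof (rule idealI)
    show "ring (mpoly_ring n :: 'a mpol ring)" by (rule ring_axioms)
    show "subgroup I (add_monoid (mpoly_ring n))"
    proof (rule add.subgroupI)
      show "I \<subseteq> carrier (mpoly_ring n)" using I unfolding mpoly_ring_sel by blast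
      show "I \<noteq> {}" using I submodD(1) by blast
      show "\<ominus>\<^bsub>mpoly_ring n\<^esub> a \<in> I" if a: "a \<in> I" for a
      proof -
        have "\<ominus>\<^bsub>mpoly_ring n\<^esub> a = - a"
        proof (rule minus_equality)
          show "- a \<oplus>\<^bsub>mpoly_ring n\<^esub> a = \<zero>\<^bsub>mpoly_ring n\<^esub>" unfolding mpoly_ring_sel by simp
          show "a \<in> carrier (mpoly_ring n)" "- a \<in> carrier (mpoly_ring n)"
            using a I polys_uminus unfolding mpoly_ring_sel by blast+
        qed
        then show ?thesis using submodD(4)[OF conjunct2[OF I] a] by simp
      qed
      show "a \<oplus>\<^bsub>mpoly_ring n\<^esub> b \<in> I" if "a \<in> I" "b \<in> I" for a b
        using submodD(2)[OF conjunct2[OF I] that] unfolding mpoly_ring_sel .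
    qed
    show "x \<otimes>\<^bsub>mpoly_ring n\<^esub> a \<in> I" if "a \<in> I" "x \<in> carrier (mpoly_ring n)" for a x
      using submodD(3)[OF conjunct2[OF I], of x a] that unfolding mpoly_ring_sel by blast
    show "a \<otimes>\<^bsub>mpoly_ring n\<^esub> x \<in> I" if "a \<in> I" "x \<in> carrier (mpoly_ring n)" for a x
      using submodD(3)[OF conjunct2[OF I], of x a] that unfolding mpoly_ring_sel by (simp add: mult.commute)
  qed
qed

lemma rspan_subset_polys: "S \<subseteq> polys n \<Longrightarrow> rspan n S \<subseteq> polys n"
  by (rule rspan_least[OF submod_polys])

lemma genideal_eq_rspan:
  assumes "S \<subseteq> polys n"
  shows "genideal (mpoly_ring n) S = rspan n (S :: 'a::comm_ring_1 mpol set)"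
proof
  show "genideal (mpoly_ring n) S \<subseteq> rspan n S"
    unfolding genideal_def
    using ideal_iff_submod[of "rspan n S" n] submod_rspan[of n S] rspan_subset_polys[OF assms] rspan_base by blast
  show "rspan n S \<subseteq> genideal (mpoly_ring n) S"
    unfolding genideal_def using rspan_least[of n _ S] by (auto simp: ideal_iff_submod)
qed

lemma fin_gen_ideal_iff_fgm:
  assumes "I \<subseteq> polys n"
  shows "fin_gen_ideal (mpoly_ring n) I \<longleftrightarrow> fgm n (I :: 'a::comm_ring_1 mpol set)"
proof
  assume "fin_gen_ideal (mpoly_ring n) I"
  then obtain S where "finite S" "S \<subseteq> polys n" "I = genideal (mpoly_ring n) S"
    unfolding fin_gen_ideal_def mpoly_ring_sel by blast
  then show "fgm n I" unfolding fgm_def using genideal_eq_rspan[of S n] by blast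
next
  assume "fgm n I"
  then obtain S where S: "finite S" "I = rspan n S" unfolding fgm_def by (elim exE conjE)
  then have "S \<subseteq> polys n" using assms rspan_base by blast
  then show "fin_gen_ideal (mpoly_ring n) I"
    unfolding fin_gen_ideal_def mpoly_ring_sel using S genideal_eq_rspan[of S n] by blast
qed

section \<open>Leading ideals as initial ideals\<close>

definition weights_represent :: "nat \<Rightarrow> (nat \<Rightarrow> int) list \<Rightarrow> (expo \<Rightarrow> expo \<Rightarrow> bool) \<Rightarrow> bool" where
  "weights_represent n ws ord \<longleftrightarrow> inj_on (degs n ws) (expos n) \<and>
     (\<forall>\<alpha>\<in>expos n. \<forall>\<beta>\<in>expos n. ord \<alpha> \<beta> \<longleftrightarrow> degs n ws \<alpha> \<noteq> degs n ws \<beta> \<and> lex_le (degs n ws \<alpha>) (degs n ws \<beta>))"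

lemma lex_le_refl: "lex_le xs xs"
  by (induction xs) auto

lemma lex_le_total: "length xs = length ys \<Longrightarrow> lex_le xs ys \<or> lex_le ys xs"
  by (induction xs ys rule: list_induct2) auto

lemma lex_le_antisym: "length xs = length ys \<Longrightarrow> lex_le xs ys \<Longrightarrow> lex_le ys xs \<Longrightarrow> xs = ys"
  by (induction xs ys rule: list_induct2) auto

lemma lex_le_trans: "length xs = length ys \<Longrightarrow> length ys = length zs \<Longrightarrow> lex_le xs ys \<Longrightarrow> lex_le ys zs \<Longrightarrow> lex_le xs zs"
  by (induction xs ys zs rule: list_induct3) auto

lemma lex_le_maximum:
  assumes "finite A" "A \<noteq> {}"
  shows "\<exists>\<alpha>\<in>A. \<forall>\<beta>\<in>A. lex_le (degs n ws \<beta>) (degs n ws \<alpha>)"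
  using assms
proof (induction A rule: finite_ne_induct)
  case (singleton x)
  then show ?case by (simp add: lex_le_refl)
next
  case (insert x F)
  then obtain \<alpha> where \<alpha>: "\<alpha> \<in> F" "\<forall>\<beta>\<in>F. lex_le (degs n ws \<beta>) (degs n ws \<alpha>)" by blast
  show ?case
  proof (cases "lex_le (degs n ws x) (degs n ws \<alpha>)")
    case True
    then show ?thesis using \<alpha> by (intro bexI[of _ \<alpha>]) auto
  next
    case False
    then have x: "lex_le (degs n ws \<alpha>) (degs n ws x)" using lex_le_total[of "degs n ws x" "degs n ws \<alpha>"] by simp
    have "lex_le (degs n ws \<beta>) (degs n ws x)" if "\<beta> \<in> F" for \<beta>
      by (rule lex_le_trans[OF _ _ bspec[OF \<alpha>(2) that] x]) simp_all
    then show ?thesis using lex_le_refl by (intro bexI[of _ x]) auto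
  qed
qed

lemma lead_expo_props:
  assumes rep: "weights_represent n ws ord" and p: "p \<in> polys n" "p \<noteq> 0"
  shows "lead_expo ord p \<in> supp p"
    "\<And>\<beta>. \<beta> \<in> supp p \<Longrightarrow> lex_le (degs n ws \<beta>) (degs n ws (lead_expo ord p))"
proof -
  have "finite (supp p)" "supp p \<noteq> {}" using p(2) by auto
  from lex_le_maximum[OF this, of n ws] obtain \<alpha> where \<alpha>: "\<alpha> \<in> supp p"
    "\<forall>\<beta>\<in>supp p. lex_le (degs n ws \<beta>) (degs n ws \<alpha>)" by blast
  have ex: "\<gamma> \<in> expos n" if "\<gamma> \<in> supp p" for \<gamma> using p(1) that unfolding polys_def by blast
  have inj: "\<beta> = \<gamma>" if "\<beta> \<in> supp p" "\<gamma> \<in> supp p" "degs n ws \<beta> = degs n ws \<gamma>" for \<beta> \<gamma>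
    using rep ex that unfolding weights_represent_def inj_on_def by blast
  have ord: "ord \<beta> \<gamma> \<longleftrightarrow> degs n ws \<beta> \<noteq> degs n ws \<gamma> \<and> lex_le (degs n ws \<beta>) (degs n ws \<gamma>)"
    if "\<beta> \<in> supp p" "\<gamma> \<in> supp p" for \<beta> \<gamma>
    using rep ex that unfolding weights_represent_def by blast
  have "lead_expo ord p = \<alpha>"
    unfolding lead_expo_def
  proof (rule the_equality)
    show "\<alpha> \<in> supp p \<and> (\<forall>\<beta>\<in>supp p. \<beta> = \<alpha> \<or> ord \<beta> \<alpha>)"
      using \<alpha> ord inj by blast
    fix \<gamma> assume \<gamma>: "\<gamma> \<in> supp p \<and> (\<forall>\<beta>\<in>supp p. \<beta> = \<gamma> \<or> ord \<beta> \<gamma>)"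
    have "\<alpha> = \<gamma> \<or> ord \<alpha> \<gamma>" using \<gamma> \<alpha>(1) by blast
    then have "lex_le (degs n ws \<alpha>) (degs n ws \<gamma>)" using \<alpha>(1) \<gamma> ord lex_le_refl by auto
    moreover have "lex_le (degs n ws \<gamma>) (degs n ws \<alpha>)" using \<alpha>(2) \<gamma> by blast
    ultimately have "degs n ws \<alpha> = degs n ws \<gamma>" by (intro lex_le_antisym) simp_all
    then show "\<gamma> = \<alpha>" using inj \<alpha>(1) \<gamma> by blast
  qed
  then show "lead_expo ord p \<in> supp p"
    "\<And>\<beta>. \<beta> \<in> supp p \<Longrightarrow> lex_le (degs n ws \<beta>) (degs n ws (lead_expo ord p))"
    using \<alpha> by auto
qed

lemma lead_term_polys:
  assumes "weights_represent n ws ord" "p \<in> polys n" "p \<noteq> 0"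
  shows "lead_term ord p \<in> polys n"
proof -
  have "lead_expo ord p \<in> expos n" using lead_expo_props(1)[OF assms] assms(2) unfolding polys_def by blast
  then show ?thesis unfolding lead_term_def by simp
qed

lemma piece_lead_term:
  assumes rep: "weights_represent n ws ord" and p: "p \<in> polys n" "p \<noteq> 0"
  shows "piece (\<lambda>\<alpha>. degs n ws \<alpha> = degs n ws (lead_expo ord p)) p = lead_term ord p"
proof (rule poly_mapping_eqI)
  fix \<gamma>
  note lead = lead_expo_props[OF assms]
  show "lk (piece (\<lambda>\<alpha>. degs n ws \<alpha> = degs n ws (lead_expo ord p)) p) \<gamma> = lk (lead_term ord p) \<gamma>"
  proof (cases "\<gamma> \<in> supp p")
    case True
    then have "degs n ws \<gamma> = degs n ws (lead_expo ord p) \<longleftrightarrow> \<gamma> = lead_expo ord p"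
      using rep lead(1) p(1) unfolding weights_represent_def inj_on_def polys_def by blast
    then show ?thesis unfolding lookup_piece lead_term_def by (auto simp: lookup_single when_def)
  next
    case False
    then have "lk p \<gamma> = 0" "\<gamma> \<noteq> lead_expo ord p" using lead(1) by (auto simp: in_keys_iff)
    then show ?thesis unfolding lookup_piece lead_term_def by (simp add: lookup_single when_def)
  qed
qed

text \<open>
  On the exponents at hand the weights determine the exponent, so a top piece consists of a single
  term.
\<close>

lemma lead_ideal_eq_lex_initial:
  fixes I :: "'a::comm_ring_1 mpol set"
  assumes rep: "weights_represent n ws ord" and I: "I \<subseteq> polys n"
  shows "lead_ideal n ord I = lex_initial n ws I"
proof -
  let ?T = "{lead_term ord f | f. f \<in> I \<and> f \<noteq> 0}"
  have T: "?T \<subseteq> polys n" using lead_term_polys[OF rep] I by blast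
  have "rspan n ?T = lex_initial n ws I"
  proof
    show "rspan n ?T \<subseteq> lex_initial n ws I"
      unfolding lex_initial_def
    proof (rule rspan_least[OF submod_rspan], rule subsetI, rule rspan_base)
      fix p assume "p \<in> ?T"
      then obtain f where f: "p = lead_term ord f" "f \<in> I" "f \<noteq> 0" by blast
      then have fp: "f \<in> polys n" using I by blast
      show "p \<in> {piece (\<lambda>\<alpha>. degs n ws \<alpha> = ds) f | f ds. f \<in> I \<and> length ds = length ws \<and> (\<forall>\<alpha>\<in>supp f. lex_le (degs n ws \<alpha>) ds)}"
        using f(1,2) piece_lead_term[OF rep fp f(3)] lead_expo_props(2)[OF rep fp f(3)]
        by (intro CollectI exI[of _ f] exI[of _ "degs n ws (lead_expo ord f)"]) auto
    qed
    show "lex_initial n ws I \<subseteq> rspan n ?T"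
      unfolding lex_initial_def
    proof (rule rspan_least[OF submod_rspan], rule subsetI)
      fix p assume "p \<in> {piece (\<lambda>\<alpha>. degs n ws \<alpha> = ds) f | f ds. f \<in> I \<and> length ds = length ws \<and> (\<forall>\<alpha>\<in>supp f. lex_le (degs n ws \<alpha>) ds)}"
      then obtain f ds where f: "p = piece (\<lambda>\<alpha>. degs n ws \<alpha> = ds) f" "f \<in> I" "length ds = length ws" "\<forall>\<alpha>\<in>supp f. lex_le (degs n ws \<alpha>) ds"
        by blast
      have fp: "f \<in> polys n" using f(2) I by blast
      show "p \<in> rspan n ?T"
      proof (cases "p = 0")
        case False
        then obtain \<gamma> where "\<gamma> \<in> supp p" using keys_eq_empty by blast
        then have \<gamma>: "\<gamma> \<in> supp f" "degs n ws \<gamma> = ds" unfolding f(1) keys_piece by auto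
        then have f0: "f \<noteq> 0" by auto
        note lead = lead_expo_props[OF rep fp f0]
        have "degs n ws (lead_expo ord f) = ds"
          using lex_le_antisym[of "degs n ws (lead_expo ord f)" ds] f(3,4) lead(1) lead(2)[OF \<gamma>(1)] \<gamma>(2) by simp
        then have "p = lead_term ord f" using piece_lead_term[OF rep fp f0] f(1) by simp
        then show ?thesis using f(2) f0 by (intro rspan_base) blast
      qed simp
    qed
  qed
  then show ?thesis unfolding lead_ideal_def genideal_eq_rspan[OF T] .
qed

theorem (in archimedean_valuation_domain) lead_ideal_fin_gen:
  fixes I :: "'a mpol set"
  assumes "weights_represent n ws ord" "ideal I (mpoly_ring n)" "fin_gen_ideal (mpoly_ring n) I"
  shows "fin_gen_ideal (mpoly_ring n) (lead_ideal n ord I)"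
proof -
  have I: "I \<subseteq> polys n" using assms(2) unfolding ideal_iff_submod by blast
  have "fgm n I" using assms(3) unfolding fin_gen_ideal_iff_fgm[OF I] .
  then have fg: "fgm n (lead_ideal n ord I)"
    unfolding lead_ideal_eq_lex_initial[OF assms(1) I] using I by (rule lex_initial_fgm)
  have "lead_ideal n ord I \<subseteq> polys n"
    unfolding lead_ideal_eq_lex_initial[OF assms(1) I] lex_initial_def
    by (rule rspan_subset_polys) (use I in \<open>auto intro: piece_polys\<close>)
  then show ?thesis using fg by (simp add: fin_gen_ideal_iff_fgm)
qed

section \<open>Orders given by rational matrices and the lexicographic order\<close>

lemma totalp_imp_weights_inj:
  assumes "irreflp_on (expos n) ord" "totalp_on (expos n) ord"
    and "\<And>\<alpha> \<beta>. \<alpha> \<in> expos n \<Longrightarrow> \<beta> \<in> expos n \<Longrightarrow> ord \<alpha> \<beta> \<longleftrightarrow> degs n ws \<alpha> \<noteq> degs n ws \<beta> \<and> lex_le (degs n ws \<alpha>) (degs n ws \<beta>)"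
  shows "weights_represent n ws ord"
proof -
  have "inj_on (degs n ws) (expos n)"
  proof (rule inj_onI)
    fix x y assume xy: "x \<in> expos n" "y \<in> expos n" "degs n ws x = degs n ws y"
    then have "\<not> ord x y" "\<not> ord y x" using assms(3) by auto
    then show "x = y" using assms(2) xy(1,2) unfolding totalp_on_def by blast
  qed
  then show ?thesis using assms(3) unfolding weights_represent_def by blast
qed

lemma lex_le_map_iff:
  "map f is \<noteq> map g is \<and> lex_le (map f is) (map g is) \<longleftrightarrow>
     (\<exists>k<length is. (\<forall>j<k. f (is ! j) = g (is ! j)) \<and> f (is ! k) < g (is ! k))" for f g :: "'i \<Rightarrow> int"
proof (induction "is")
  case (Cons i "is")
  have "(\<exists>k<length (i # is). (\<forall>j<k. f ((i # is) ! j) = g ((i # is) ! j)) \<and> f ((i # is) ! k) < g ((i # is) ! k)) \<longleftrightarrow>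
      f i < g i \<or> f i = g i \<and> (\<exists>k<length is. (\<forall>j<k. f (is ! j) = g (is ! j)) \<and> f (is ! k) < g (is ! k))"
    unfolding length_Cons Ex_less_Suc2 by (auto simp: All_less_Suc2)
  then show ?case unfolding Cons.IH[symmetric] by auto
qed simp

lemma common_denominator:
  assumes "finite (A :: rat set)"
  shows "\<exists>N>0. \<forall>q\<in>A. \<exists>z. q * of_int N = of_int z"
  using assms
proof (induction A rule: finite_induct)
  case empty
  show ?case by (intro exI[of _ 1]) simp
next
  case (insert q A)
  obtain N where N: "N > 0" "\<forall>q\<in>A. \<exists>z. q * of_int N = of_int z" using insert.IH by blast
  obtain x y where xy: "quotient_of q = (x, y)" by force
  have y: "y > 0" "q = of_int x / of_int y"
    using quotient_of_denom_pos[OF xy] quotient_of_div[OF xy] by auto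
  have "\<exists>z. r * of_int (N * y) = of_int z" if r: "r \<in> insert q A" for r
  proof (cases "r = q")
    case True
    then have "r * of_int (N * y) = of_int (x * N)" using y by simp
    then show ?thesis ..
  next
    case False
    then obtain z where "r * of_int N = of_int z" using N(2) r by blast
    then have "r * of_int (N * y) = of_int (z * y)" by (simp flip: mult.assoc)
    then show ?thesis ..
  qed
  then show ?case using N(1) y(1) by (intro exI[of _ "N * y"]) simp
qed

lemma degs_lex_iff:
  "degs n (map z [0..<m]) \<alpha> \<noteq> degs n (map z [0..<m]) \<beta> \<and> lex_le (degs n (map z [0..<m]) \<alpha>) (degs n (map z [0..<m]) \<beta>) \<longleftrightarrow>
     (\<exists>i<m. (\<forall>k<i. wdeg n (z k) \<alpha> = wdeg n (z k) \<beta>) \<and> wdeg n (z i) \<alpha> < wdeg n (z i) \<beta>)"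
proof -
  have d: "degs n (map z [0..<m]) \<gamma> = map (\<lambda>i. wdeg n (z i) \<gamma>) [0..<m]" for \<gamma>
    by (simp add: degs_def)
  show ?thesis unfolding d lex_le_map_iff by auto
qed

text \<open>
  Rows of the matrix may be multiplied by positive numbers, so denominators can be cleared.
\<close>

lemma rational_order_weights:
  assumes "rational_monomial_order n ord"
  shows "\<exists>ws. weights_represent n ws ord"
proof -
  obtain m Q where Q: "Q \<in> carrier_mat m n"
      "\<forall>\<alpha>\<in>expos n. \<forall>\<beta>\<in>expos n. ord \<alpha> \<beta> \<longleftrightarrow> lex_less (Q *\<^sub>v expo_vec n \<alpha>) (Q *\<^sub>v expo_vec n \<beta>)"
    using assms unfolding rational_monomial_order_def by blast
  have ord: "irreflp_on (expos n) ord" "totalp_on (expos n) ord"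
    using assms unfolding rational_monomial_order_def monomial_order_def by blast+
  have "finite ((\<lambda>(i, j). Q $$ (i, j)) ` ({..<m} \<times> {..<n}))" by simp
  from common_denominator[OF this] obtain N where N: "N > 0"
    "\<forall>q\<in>(\<lambda>(i, j). Q $$ (i, j)) ` ({..<m} \<times> {..<n}). \<exists>z. q * of_int N = of_int z" by blast
  define z where "z i j = (SOME z. Q $$ (i, j) * of_int N = of_int z)" for i j
  have z: "Q $$ (i, j) * of_int N = of_int (z i j)" if "i < m" "j < n" for i j
  proof -
    have "\<exists>z. Q $$ (i, j) * of_int N = of_int z" using N(2) that by force
    then show ?thesis unfolding z_def by (rule someI_ex)
  qed
  have row: "(Q *\<^sub>v expo_vec n \<alpha>) $ i * of_int N = of_int (wdeg n (z i) \<alpha>)" if i: "i < m" for i \<alpha>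
  proof -
    have eq: "(Q *\<^sub>v expo_vec n \<alpha>) $ i = (\<Sum>j\<in>{0..<n}. Q $$ (i, j) * of_nat (lk \<alpha> j))"
      using Q(1) i unfolding expo_vec_def by (auto simp: scalar_prod_def intro!: sum.cong)
    have "(Q *\<^sub>v expo_vec n \<alpha>) $ i * of_int N = (\<Sum>j\<in>{0..<n}. (Q $$ (i, j) * of_int N) * of_nat (lk \<alpha> j))"
      unfolding eq sum_distrib_right by (intro sum.cong refl) (simp only: mult_ac)
    also have "\<dots> = (\<Sum>j\<in>{0..<n}. of_int (z i j) * of_nat (lk \<alpha> j))"
      using z[OF i] by (intro sum.cong refl) simp
    also have "\<dots> = of_int (wdeg n (z i) \<alpha>)"
      unfolding wdeg_def by (simp add: lessThan_atLeast0)
    finally show ?thesis .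
  qed
  have cmp: "(Q *\<^sub>v expo_vec n \<alpha>) $ i = (Q *\<^sub>v expo_vec n \<beta>) $ i \<longleftrightarrow> wdeg n (z i) \<alpha> = wdeg n (z i) \<beta>"
    "(Q *\<^sub>v expo_vec n \<alpha>) $ i < (Q *\<^sub>v expo_vec n \<beta>) $ i \<longleftrightarrow> wdeg n (z i) \<alpha> < wdeg n (z i) \<beta>" if i: "i < m" for i \<alpha> \<beta>
  proof -
    have pos: "(0::rat) < of_int N" using N(1) by simp
    have "(Q *\<^sub>v expo_vec n \<alpha>) $ i = (Q *\<^sub>v expo_vec n \<beta>) $ i \<longleftrightarrow>
        (Q *\<^sub>v expo_vec n \<alpha>) $ i * of_int N = (Q *\<^sub>v expo_vec n \<beta>) $ i * of_int N"
      using pos by simp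
    then show "(Q *\<^sub>v expo_vec n \<alpha>) $ i = (Q *\<^sub>v expo_vec n \<beta>) $ i \<longleftrightarrow> wdeg n (z i) \<alpha> = wdeg n (z i) \<beta>"
      unfolding row[OF i] by simp
    have "(Q *\<^sub>v expo_vec n \<alpha>) $ i < (Q *\<^sub>v expo_vec n \<beta>) $ i \<longleftrightarrow>
        (Q *\<^sub>v expo_vec n \<alpha>) $ i * of_int N < (Q *\<^sub>v expo_vec n \<beta>) $ i * of_int N"
      using pos by (simp add: mult_less_cancel_right)
    then show "(Q *\<^sub>v expo_vec n \<alpha>) $ i < (Q *\<^sub>v expo_vec n \<beta>) $ i \<longleftrightarrow> wdeg n (z i) \<alpha> < wdeg n (z i) \<beta>"
      unfolding row[OF i] by simp
  qed
  have lex: "lex_less (Q *\<^sub>v expo_vec n \<alpha>) (Q *\<^sub>v expo_vec n \<beta>) \<longleftrightarrow>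
      (\<exists>i<m. (\<forall>k<i. wdeg n (z k) \<alpha> = wdeg n (z k) \<beta>) \<and> wdeg n (z i) \<alpha> < wdeg n (z i) \<beta>)" for \<alpha> \<beta>
  proof -
    let ?u = "Q *\<^sub>v expo_vec n \<alpha>" and ?v = "Q *\<^sub>v expo_vec n \<beta>"
    have dim: "dim_vec (?v - ?u) = m" using Q(1) by simp
    have idx: "(?v - ?u) $ i = ?v $ i - ?u $ i" if "i < m" for i using Q(1) that by simp
    have "((\<forall>k<i. (?v - ?u) $ k = 0) \<and> (?v - ?u) $ i > 0) \<longleftrightarrow>
        ((\<forall>k<i. wdeg n (z k) \<alpha> = wdeg n (z k) \<beta>) \<and> wdeg n (z i) \<alpha> < wdeg n (z i) \<beta>)" if i: "i < m" for i
    proof -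
      have "(?v - ?u) $ k = 0 \<longleftrightarrow> wdeg n (z k) \<alpha> = wdeg n (z k) \<beta>" if "k < i" for k
        using cmp(1)[of k \<alpha> \<beta>] idx[of k] i that by auto
      moreover have "(?v - ?u) $ i > 0 \<longleftrightarrow> wdeg n (z i) \<alpha> < wdeg n (z i) \<beta>"
        using cmp(2)[OF i, of \<alpha> \<beta>] idx[OF i] by simp
      ultimately show ?thesis by blast
    qed
    then show ?thesis unfolding lex_less_def dim by blast
  qed
  have "weights_represent n (map z [0..<m]) ord"
    by (rule totalp_imp_weights_inj[OF ord]) (use Q(2) lex degs_lex_iff in simp)
  then show ?thesis ..
qed

definition unit_weights :: "nat \<Rightarrow> (nat \<Rightarrow> int) list" where
  "unit_weights n = map (\<lambda>i j. if j = i then 1 else 0) [0..<n]"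

lemma wdeg_unit: "i < n \<Longrightarrow> wdeg n (\<lambda>j. if j = i then 1 else 0) \<alpha> = int (lk \<alpha> i)"
proof -
  assume i: "i < n"
  have "wdeg n (\<lambda>j. if j = i then 1 else 0) \<alpha> = (\<Sum>j<n. if j = i then int (lk \<alpha> j) else 0)"
    unfolding wdeg_def by (intro sum.cong refl) simp
  then show ?thesis using i by simp
qed

lemma expos_eqI: "\<alpha> \<in> expos n \<Longrightarrow> \<beta> \<in> expos n \<Longrightarrow> (\<And>i. i < n \<Longrightarrow> lk \<alpha> i = lk \<beta> i) \<Longrightarrow> \<alpha> = \<beta>"
  by (rule poly_mapping_eqI) (metis in_expos_iff not_less)

lemma lex_order_weights: "weights_represent n (unit_weights n) lex_order"
  unfolding weights_represent_def
proof (intro conjI ballI)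
  show "inj_on (degs n (unit_weights n)) (expos n)"
  proof (rule inj_onI)
    fix x y assume xy: "x \<in> expos n" "y \<in> expos n" "degs n (unit_weights n) x = degs n (unit_weights n) y"
    show "x = y"
    proof (rule expos_eqI[OF xy(1,2)])
      fix i assume i: "i < n"
      have "degs n (unit_weights n) x ! i = degs n (unit_weights n) y ! i" using xy(3) by simp
      then show "lk x i = lk y i" using i by (simp add: degs_def unit_weights_def wdeg_unit)
    qed
  qed
  fix \<alpha> \<beta> assume ab: "\<alpha> \<in> expos n" "\<beta> \<in> expos n"
  have "lex_order \<alpha> \<beta> \<longleftrightarrow> (\<exists>i<n. (\<forall>k<i. lk \<alpha> k = lk \<beta> k) \<and> lk \<alpha> i < lk \<beta> i)"
    unfolding lex_order_def using ab unfolding in_expos_iff by (metis less_nat_zero_code not_le_imp_less)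
  also have "\<dots> \<longleftrightarrow> degs n (unit_weights n) \<alpha> \<noteq> degs n (unit_weights n) \<beta> \<and> lex_le (degs n (unit_weights n) \<alpha>) (degs n (unit_weights n) \<beta>)"
    unfolding unit_weights_def degs_lex_iff by (intro ex_cong1 conj_cong refl) (auto simp: wdeg_unit)
  finally show "lex_order \<alpha> \<beta> \<longleftrightarrow> degs n (unit_weights n) \<alpha> \<noteq> degs n (unit_weights n) \<beta> \<and> lex_le (degs n (unit_weights n) \<alpha>) (degs n (unit_weights n) \<beta>)" .
qed

lemma expos_1_eqI: "\<alpha> \<in> expos 1 \<Longrightarrow> \<beta> \<in> expos 1 \<Longrightarrow> lk \<alpha> 0 = lk \<beta> 0 \<Longrightarrow> \<alpha> = \<beta>"
  by (rule expos_eqI) auto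

lemma lex_order_1: "\<alpha> \<in> expos 1 \<Longrightarrow> \<beta> \<in> expos 1 \<Longrightarrow> lex_order \<alpha> \<beta> \<longleftrightarrow> lk \<alpha> 0 < lk \<beta> 0"
proof -
  assume ab: "\<alpha> \<in> expos 1" "\<beta> \<in> expos 1"
  have "lk \<beta> i = 0" if "i > 0" for i using ab(2) that unfolding in_expos_iff by simp
  then show ?thesis unfolding lex_order_def by (metis less_nat_zero_code gr0I)
qed

lemma rational_monomial_order_lex_1: "rational_monomial_order 1 lex_order"
  unfolding rational_monomial_order_def
proof (intro conjI)
  show "monomial_order 1 lex_order"
    unfolding monomial_order_def
  proof (intro conjI ballI allI impI)
    show "irreflp_on (expos 1) lex_order" by (rule irreflp_onI) (simp add: lex_order_1)
    show "transp_on (expos 1) lex_order" by (rule transp_onI) (simp add: lex_order_1)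
    show "totalp_on (expos 1) lex_order"
    proof (rule totalp_onI)
      fix x y :: expo assume xy: "x \<in> expos 1" "y \<in> expos 1" "x \<noteq> y"
      then have "lk x 0 \<noteq> lk y 0" using expos_1_eqI by blast
      then show "lex_order x y \<or> lex_order y x"
        unfolding lex_order_1[OF xy(1,2)] lex_order_1[OF xy(2,1)] by linarith
    qed
    show "\<alpha> = 0 \<or> lex_order 0 \<alpha>" if "\<alpha> \<in> expos 1" for \<alpha>
      using that expos_1_eqI[OF that, of 0] by (auto simp: lex_order_1)
    show "lex_order (\<alpha> + \<gamma>) (\<beta> + \<gamma>)" if "\<alpha> \<in> expos 1" "\<beta> \<in> expos 1" "\<gamma> \<in> expos 1" "lex_order \<alpha> \<beta>" for \<alpha> \<beta> \<gamma>
      using that by (simp add: lex_order_1 expos_add lookup_add)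
    show "\<exists>\<alpha>\<in>A. \<forall>\<beta>\<in>A. \<beta> = \<alpha> \<or> lex_order \<alpha> \<beta>" if A: "A \<subseteq> expos 1 \<and> A \<noteq> {}" for A
    proof -
      obtain x where "x \<in> A" using A by blast
      then obtain \<alpha> where \<alpha>: "\<alpha> \<in> A" "\<forall>\<beta>. \<beta> \<in> A \<longrightarrow> lk \<alpha> 0 \<le> lk \<beta> 0"
        using ex_has_least_nat[of "\<lambda>\<alpha>. \<alpha> \<in> A" x "\<lambda>\<alpha>. lk \<alpha> 0"] by blast
      have "\<beta> = \<alpha> \<or> lex_order \<alpha> \<beta>" if "\<beta> \<in> A" for \<beta>
      proof -
        have e: "\<alpha> \<in> expos 1" "\<beta> \<in> expos 1" using A \<alpha>(1) that by blast+
        show ?thesis using \<alpha>(2) that expos_1_eqI[OF e(2,1)] lex_order_1[OF e] by (metis le_neq_implies_less)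
      qed
      then show ?thesis using \<alpha>(1) by blast
    qed
  qed
  let ?Q = "mat 1 1 (\<lambda>_. 1) :: rat mat"
  have row: "(?Q *\<^sub>v expo_vec 1 \<alpha>) $ 0 = of_nat (lk \<alpha> 0)" for \<alpha>
    by (simp add: expo_vec_def scalar_prod_def)
  have "lex_less (?Q *\<^sub>v expo_vec 1 \<alpha>) (?Q *\<^sub>v expo_vec 1 \<beta>) \<longleftrightarrow> lk \<alpha> 0 < lk \<beta> 0" for \<alpha> \<beta>
    unfolding lex_less_def using row[of \<alpha>] row[of \<beta>] by (simp add: less_Suc_eq)
  then show "\<exists>m. \<exists>Q\<in>carrier_mat m 1. \<forall>\<alpha>\<in>expos 1. \<forall>\<beta>\<in>expos 1.
      lex_order \<alpha> \<beta> \<longleftrightarrow> lex_less (Q *\<^sub>v expo_vec 1 \<alpha>) (Q *\<^sub>v expo_vec 1 \<beta>)"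
    by (intro exI[of _ 1] bexI[of _ ?Q]) (simp_all add: lex_order_1)
qed

section \<open>Krull dimension at most one\<close>

lemma type_ring_sel:
  "carrier (ring_of_type_algebra :: 'a::comm_ring_1 ring) = UNIV"
  "x \<otimes>\<^bsub>ring_of_type_algebra\<^esub> y = x * y" "x \<oplus>\<^bsub>ring_of_type_algebra\<^esub> y = x + y"
  "\<zero>\<^bsub>ring_of_type_algebra\<^esub> = 0" "\<one>\<^bsub>ring_of_type_algebra\<^esub> = 1"
  unfolding ring_of_type_algebra_def by simp_all

lemma primeideal_type_ring_iff:
  "primeideal P (ring_of_type_algebra :: 'a::comm_ring_1 ring) \<longleftrightarrow>
     0 \<in> P \<and> (\<forall>x\<in>P. \<forall>y\<in>P. x + y \<in> P) \<and> (\<forall>x\<in>P. \<forall>y. x * y \<in> P) \<and> 1 \<notin> P \<and>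
     (\<forall>x y. x * y \<in> P \<longrightarrow> x \<in> P \<or> y \<in> P)"
proof
  assume "primeideal P (ring_of_type_algebra :: 'a ring)"
  then interpret primeideal P "ring_of_type_algebra :: 'a ring" .
  have "1 \<notin> P"
  proof
    assume "1 \<in> P"
    then have "x \<in> P" for x using I_l_closed[of 1 x] unfolding type_ring_sel by simp
    then show False using I_notcarr unfolding type_ring_sel by blast
  qed
  moreover have "0 \<in> P" using additive_subgroup.zero_closed[OF is_additive_subgroup] unfolding type_ring_sel .
  moreover have "x + y \<in> P" if "x \<in> P" "y \<in> P" for x y
    using additive_subgroup.a_closed[OF is_additive_subgroup that] unfolding type_ring_sel .
  moreover have "x * y \<in> P" if "x \<in> P" for x y
    using I_r_closed[OF that, of y] unfolding type_ring_sel by blast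
  moreover have "x \<in> P \<or> y \<in> P" if "x * y \<in> P" for x y
    using I_prime[of x y] that unfolding type_ring_sel by blast
  ultimately show "0 \<in> P \<and> (\<forall>x\<in>P. \<forall>y\<in>P. x + y \<in> P) \<and> (\<forall>x\<in>P. \<forall>y. x * y \<in> P) \<and> 1 \<notin> P \<and>
     (\<forall>x y. x * y \<in> P \<longrightarrow> x \<in> P \<or> y \<in> P)" by blast
next
  assume P: "0 \<in> P \<and> (\<forall>x\<in>P. \<forall>y\<in>P. x + y \<in> P) \<and> (\<forall>x\<in>P. \<forall>y. x * y \<in> P) \<and> 1 \<notin> P \<and>
     (\<forall>x y. x * y \<in> P \<longrightarrow> x \<in> P \<or> y \<in> P)"
  interpret cring "ring_of_type_algebra :: 'a ring" by (rule cring_from_type_algebra)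
  have neg: "- a \<in> P" if "a \<in> P" for a
  proof -
    have "a * (- 1) \<in> P" using P that by blast
    then show ?thesis by simp
  qed
  show "primeideal P (ring_of_type_algebra :: 'a ring)"
  proof (rule primeidealI)
    show "ideal P (ring_of_type_algebra :: 'a ring)"
    proof (rule idealI)
      show "ring (ring_of_type_algebra :: 'a ring)" by (rule ring_axioms)
      show "subgroup P (add_monoid (ring_of_type_algebra :: 'a ring))"
      proof (rule add.subgroupI)
        show "\<ominus>\<^bsub>ring_of_type_algebra\<^esub> a \<in> P" if a: "a \<in> P" for a
        proof -
          have "\<ominus>\<^bsub>ring_of_type_algebra\<^esub> a = - a"
            by (rule minus_equality) (simp_all add: type_ring_sel)
          then show ?thesis using neg[OF a] by simp
        qed
      qed (use P in \<open>auto simp: type_ring_sel\<close>)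
    qed (use P in \<open>auto simp: type_ring_sel mult.commute\<close>)
    show "cring (ring_of_type_algebra :: 'a ring)" by (rule cring_from_type_algebra)
  qed (use P in \<open>auto simp: type_ring_sel\<close>)
qed

context valuation_domain
begin

text \<open>
  In a chain of three primes, take \<open>a\<close> in the middle one but not in the first, and \<open>b\<close> in the last but
  not in the middle one. A power of \<open>b\<close> divisible by \<open>a\<close> would lie in the middle prime.
\<close>

lemma archimedean_imp_krull_dim_le_1:
  assumes arch: "\<And>a b :: 'a. a \<noteq> 0 \<Longrightarrow> \<not> b dvd 1 \<Longrightarrow> \<exists>k. a dvd b ^ k"
  shows "krull_dim TYPE('a) \<le> 1"
  unfolding krull_dim_def
proof (rule Sup_least)
  fix x assume "x \<in> {enat k | k. \<exists>P :: nat \<Rightarrow> 'a set.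
     (\<forall>i\<le>k. primeideal (P i) ring_of_type_algebra) \<and> (\<forall>i<k. P i \<subset> P (Suc i))}"
  then obtain k and P :: "nat \<Rightarrow> 'a set" where k: "x = enat k"
    and P: "\<forall>i\<le>k. primeideal (P i) ring_of_type_algebra" "\<forall>i<k. P i \<subset> P (Suc i)" by blast
  have "k \<le> 1"
  proof (rule ccontr)
    assume k2: "\<not> k \<le> 1"
    have pr: "primeideal (P i) ring_of_type_algebra" if "i \<le> 2" for i using P(1) k2 that by simp
    have "P 0 \<subset> P 1" "P 1 \<subset> P 2" using P(2) k2 by (auto simp: numeral_2_eq_2)
    then obtain a b where ab: "a \<in> P 1" "a \<notin> P 0" "b \<in> P 2" "b \<notin> P 1" by blast
    have a0: "a \<noteq> 0" using ab(2) pr[of 0] unfolding primeideal_type_ring_iff by auto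
    have b1: "\<not> b dvd 1"
    proof
      assume "b dvd 1"
      then obtain y where y: "1 = b * y" by (rule dvdE)
      have "b * y \<in> P 2" "1 \<notin> P 2"
        using ab(3) pr[of 2] unfolding primeideal_type_ring_iff by blast+
      then show False using y by simp
    qed
    obtain l where "a dvd b ^ l" using arch[OF a0 b1] ..
    then obtain y where "b ^ l = a * y" by (rule dvdE)
    then have "b ^ l \<in> P 1" using ab(1) pr[of 1] unfolding primeideal_type_ring_iff by auto
    moreover have "b ^ l \<notin> P 1" for l
    proof (induction l)
      case 0
      show ?case using pr[of 1] unfolding primeideal_type_ring_iff by simp
    next
      case (Suc l)
      have "b \<in> P 1 \<or> b ^ l \<in> P 1" if "b * b ^ l \<in> P 1"
        using pr[of 1] that unfolding primeideal_type_ring_iff by simp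
      then show ?case using Suc ab(4) by (simp only: power_Suc) blast
    qed
    ultimately show False by blast
  qed
  then show "x \<le> 1" unfolding k one_enat_def by simp
qed

text \<open>If no power of \<open>b\<close> is divisible by \<open>a\<close>, the common multiples of all powers of \<open>b\<close> form a middle prime.\<close>

lemma krull_dim_le_1_imp_archimedean:
  assumes dim: "krull_dim TYPE('a) \<le> 1" and a: "(a::'a) \<noteq> 0" and b: "\<not> b dvd 1"
  shows "\<exists>k. a dvd b ^ k"
proof (rule ccontr)
  assume no: "\<nexists>k. a dvd b ^ k"
  have ba: "b ^ k dvd a" for k using no dvd_linear[of a "b ^ k"] by blast
  have b0: "b \<noteq> 0" using no by (metis dvd_0_right power_one_right)
  define P :: "nat \<Rightarrow> 'a set" where
    "P i = (if i = 0 then {0} else if i = 1 then {x. \<forall>k. b ^ k dvd x} else {x. \<not> x dvd 1})" for i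
  have P0: "P 0 = {0}" and P1: "P 1 = {x. \<forall>k. b ^ k dvd x}" and P2: "P 2 = {x. \<not> x dvd 1}"
    unfolding P_def by simp_all
  have "primeideal (P 0) ring_of_type_algebra"
    unfolding P0 primeideal_type_ring_iff by auto
  moreover have "primeideal (P 1) ring_of_type_algebra"
    unfolding P1 primeideal_type_ring_iff
  proof (intro conjI allI ballI impI)
    show "1 \<notin> {x. \<forall>k. b ^ k dvd x}" using b by (auto intro: exI[of _ 1])
    fix x y assume xy: "x * y \<in> {x. \<forall>k. b ^ k dvd x}"
    show "x \<in> {x. \<forall>k. b ^ k dvd x} \<or> y \<in> {x. \<forall>k. b ^ k dvd x}"
    proof (rule ccontr)
      assume "\<not> (x \<in> {x. \<forall>k. b ^ k dvd x} \<or> y \<in> {x. \<forall>k. b ^ k dvd x})"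
      then obtain i j where "\<not> b ^ i dvd x" "\<not> b ^ j dvd y" by blast
      then have "x dvd b ^ i" "y dvd b ^ j" using dvd_linear by blast+
      then have "x * y dvd b ^ (i + j)" unfolding power_add by (rule mult_dvd_mono)
      moreover have "b ^ Suc (i + j) dvd x * y" using xy by blast
      ultimately have "b * b ^ (i + j) dvd 1 * b ^ (i + j)" by (metis dvd_trans power_Suc mult_1)
      then have "b dvd 1" unfolding dvd_mult_cancel_right using b0 by simp
      then show False using b by blast
    qed
  qed auto
  moreover have "primeideal (P 2) ring_of_type_algebra"
    unfolding P2 primeideal_type_ring_iff
  proof (intro conjI allI ballI impI)
    show "x * y \<in> {x. \<not> x dvd 1}" if "x \<in> {x. \<not> x dvd 1}" for x y :: 'a
      using that by (auto dest: dvd_mult_left)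
    show "x \<in> {x. \<not> x dvd 1} \<or> y \<in> {x. \<not> x dvd 1}" if "x * y \<in> {x. \<not> x dvd 1}" for x y :: 'a
      using that mult_dvd_mono[of x 1 y 1] by auto
  qed (use nonunit_add in auto)
  ultimately have "\<forall>i\<le>2. primeideal (P i) ring_of_type_algebra"
    by (metis One_nat_def le_SucE le_zero_eq numeral_2_eq_2)
  moreover have "P 0 \<subset> P 1" unfolding P0 P1 using a ba by auto
  moreover have "P 1 \<subset> P 2"
  proof -
    have "b \<notin> P 1"
    proof
      assume "b \<in> P 1"
      then have "b ^ 2 dvd b" unfolding P1 by blast
      then have "b * b dvd 1 * b" by (simp add: power2_eq_square)
      then have "b dvd 1" unfolding dvd_mult_cancel_right using b0 by simp
      then show False using b by blast
    qed
    moreover have "P 1 \<subseteq> P 2"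
    proof
      fix x assume "x \<in> P 1"
      then have "b ^ 1 dvd x" unfolding P1 by blast
      then show "x \<in> P 2" unfolding P2 using b dvd_trans[of b x 1] by auto
    qed
    moreover have "b \<in> P 2" unfolding P2 using b by simp
    ultimately show ?thesis by blast
  qed
  ultimately have "enat 2 \<in> {enat k | k. \<exists>P :: nat \<Rightarrow> 'a set.
     (\<forall>i\<le>k. primeideal (P i) ring_of_type_algebra) \<and> (\<forall>i<k. P i \<subset> P (Suc i))}"
    by (intro CollectI exI[of _ 2] conjI refl exI[of _ P]) (auto simp: numeral_2_eq_2 less_Suc_eq)
  then have "enat 2 \<le> krull_dim TYPE('a)" unfolding krull_dim_def by (rule Sup_upper)
  then have "enat 2 \<le> 1" using dim by (rule order_trans)
  then show False by (simp add: one_enat_def)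
qed

section \<open>Necessity of the dimension bound\<close>

lemma lookup_mult_0: "lk (p * q) 0 = lk p 0 * lk (q :: 'a mpol) 0"
proof (rule multiplicative_on_terms[where f = "\<lambda>p. lk p 0" and h = "\<lambda>p. lk p 0" and k = "\<lambda>p. lk p 0"])
  fix \<gamma> \<delta> :: expo and c d :: 'a
  have "\<gamma> + \<delta> = 0 \<longleftrightarrow> \<gamma> = 0 \<and> \<delta> = 0"
    by (auto simp: poly_mapping_eq_iff lookup_add fun_eq_iff)
  then show "lk (sgl (\<gamma> + \<delta>) (c * d)) 0 = lk (sgl \<gamma> c) 0 * lk (sgl \<delta> d) 0"
    by (auto simp: lookup_single when_def)
qed (simp_all add: lookup_add)

text \<open>
  With \<open>b ^ k dvd a\<close> for all \<open>k\<close>, the constants in the ideal generated by \<open>a\<close> and \<open>1 + b X\<close> are the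
  elements that some power of \<open>b\<close> multiplies into \<open>(a)\<close>. They form an ideal closed under division
  by \<open>b\<close>, which cannot be principal; but it is the constant part of the leading ideal.
\<close>

theorem lead_ideal_lex_not_fin_gen:
  assumes a: "(a::'a) \<noteq> 0" and b: "\<not> b dvd 1" and ba: "\<And>k. b ^ k dvd a"
  shows "\<exists>I :: 'a mpol set. ideal I (mpoly_ring 1) \<and> fin_gen_ideal (mpoly_ring 1) I \<and>
    \<not> fin_gen_ideal (mpoly_ring 1) (lead_ideal 1 lex_order I)"
proof -
  let ?X = "var 0 1 :: 'a mpol"
  define u where "u = 1 + const b * ?X"
  define I where "I = rspan 1 {const a, u}"
  note rep = lex_order_weights[of 1]
  have u: "u \<in> polys 1" unfolding u_def by (intro polys_add polys_mult polys_const polys_1 var_in_polys) simp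
  have gens: "{const a, u} \<subseteq> polys 1" using u by simp
  have Ip: "I \<subseteq> polys 1" unfolding I_def by (rule rspan_subset_polys[OF gens])
  have Is: "submod 1 I" unfolding I_def by (rule submod_rspan)
  have Ifg: "fgm 1 I" unfolding fgm_def I_def by (intro exI[of _ "{const a, u}"]) simp
  have aI: "const a \<in> I" and uI: "u \<in> I" unfolding I_def by (rule rspan_base, simp)+
  have X: "?X \<in> polys 1" by simp
  have b0: "b \<noteq> 0" using ba[of 1] a by auto
  \<comment> \<open>division by \<open>b\<close> inside \<open>I\<close>: \<open>c = c u - X (c b)\<close>\<close>
  have in_I: "const c \<in> I" if "a dvd c * b ^ k" for c k
    using that
  proof (induction k arbitrary: c)
    case 0
    then have "a dvd c" by simp
    then obtain y where "c = a * y" by (rule dvdE)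
    then show ?case using submodD(3)[OF Is polys_const aI, of y] by (simp add: const_mult mult.commute)
  next
    case (Suc k)
    then have "const (c * b) \<in> I" by (intro Suc.IH) (simp add: mult_ac)
    then have "const c * u - ?X * const (c * b) \<in> I"
      by (intro submodD(5)[OF Is] submodD(3)[OF Is polys_const uI] submodD(3)[OF Is X])
    moreover have "const c * u - ?X * const (c * b) = const c"
      unfolding u_def const_mult by (simp add: algebra_simps)
    ultimately show ?case by simp
  qed
  have from_I: "\<exists>k. a dvd d * b ^ k" if d: "const d \<in> I" for d
  proof -
    obtain p q where pq: "const d = p * const a + q * u"
    proof -
      have "\<exists>p q. x = p * const a + q * u" if "x \<in> I" for x
        using that unfolding I_def
      proof (induction x rule: rspan.induct)
        case rspan_zero
        show ?case by (intro exI[of _ 0]) simp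
      next
        case (rspan_step c s x)
        then obtain p q where x: "x = p * const a + q * u" by blast
        consider "s = const a" | "s = u" using rspan_step.hyps(2) by blast
        then show ?case
        proof cases
          case 1
          then have "c * s + x = (c + p) * const a + q * u" unfolding x by (simp add: algebra_simps)
          then show ?thesis by blast
        next
          case 2
          then have "c * s + x = p * const a + (c + q) * u" unfolding x by (simp add: algebra_simps)
          then show ?thesis by blast
        qed
      qed
      then show ?thesis using that d by blast
    qed
    let ?e = "\<lambda>i. sgl (0::nat) (i::nat)"
    have e0: "?e (Suc i) \<noteq> 0" for i
    proof
      assume "?e (Suc i) = 0"
      then have "lk (?e (Suc i)) 0 = 0" by simp
      then show False by simp
    qed
    have lk_u: "lk (q * u) (?e (Suc i)) = lk q (?e (Suc i)) + b * lk q (?e i)" for i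
    proof -
      have "?e (Suc i) = ?e 1 + ?e i" by (simp flip: single_add)
      then have "lk (?X * q) (?e (Suc i)) = lk q (?e i)"
        unfolding mpow_def by (simp only: lookup_single_mult mult_1)
      moreover have "q * u = q + const b * (?X * q)" unfolding u_def by (simp add: algebra_simps)
      ultimately show ?thesis by (simp only: lookup_add lookup_const_mult)
    qed
    have pa: "a dvd lk (p * const a) \<gamma>" for \<gamma> by (simp add: mult.commute[of p])
    have coeff: "a dvd lk q (?e i) - d * (- b) ^ i" for i
    proof (induction i)
      case 0
      have "lk u 0 = 1"
        unfolding u_def lookup_add lookup_const_mult mpow_def using e0[of 0] by (simp add: lookup_single when_def)
      then have "d = lk (p * const a) 0 + lk q 0"
        using arg_cong[OF pq, of "\<lambda>p. lk p 0"] by (simp add: lookup_add lookup_mult_0 const_def)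
      then have "lk q (?e 0) - d * (- b) ^ 0 = - lk (p * const a) 0" by simp
      then show ?case using pa by simp
    next
      case (Suc i)
      have "0 = lk (p * const a) (?e (Suc i)) + (lk q (?e (Suc i)) + b * lk q (?e i))"
        using arg_cong[OF pq, of "\<lambda>p. lk p (?e (Suc i))"] unfolding lookup_add lk_u
        using e0[of i] by (simp add: const_def lookup_single when_def)
      then have "lk q (?e (Suc i)) - d * (- b) ^ Suc i = - lk (p * const a) (?e (Suc i)) - b * (lk q (?e i) - d * (- b) ^ i)"
        by (simp add: algebra_simps)
      then show ?case using pa Suc by (simp add: dvd_mult)
    qed
    have "inj ?e" by (rule injI) (metis lookup_single_eq)
    then have "infinite (range ?e)" using finite_imageD[of ?e UNIV] infinite_UNIV_nat by blast
    then have "\<not> range ?e \<subseteq> supp q" using finite_subset finite_keys by blast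
    then obtain k where "?e k \<notin> supp q" by blast
    then have "a dvd d * (- b) ^ k" using coeff[of k] by (simp add: in_keys_iff)
    moreover have "d * (- b) ^ k = d * b ^ k \<or> d * (- b) ^ k = - (d * b ^ k)"
      by (cases "even k") simp_all
    ultimately have "a dvd d * b ^ k" by auto
    then show ?thesis ..
  qed
  let ?T = "{lead_term lex_order f | f. f \<in> I \<and> f \<noteq> 0}"
  have Tp: "?T \<subseteq> polys 1" using lead_term_polys[OF rep] Ip by blast
  have LT: "lead_ideal 1 lex_order I = rspan 1 ?T"
    unfolding lead_ideal_def by (rule genideal_eq_rspan[OF Tp])
  have const_part: "const (lk p 0) \<in> I" if "p \<in> rspan 1 ?T" for p
    using that
  proof (induction p rule: rspan.induct)
    case rspan_zero
    show ?case using submodD(1)[OF Is] by simp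
  next
    case (rspan_step c t p)
    obtain f where f: "t = lead_term lex_order f" "f \<in> I" "f \<noteq> 0" using rspan_step.hyps(2) by blast
    have fp: "f \<in> polys 1" using f(2) Ip by blast
    note lead = lead_expo_props[OF rep fp f(3)]
    have "const (lk t 0) \<in> I"
    proof (cases "lead_expo lex_order f = 0")
      case True
      have "\<beta> = 0" if \<beta>: "\<beta> \<in> supp f" for \<beta>
      proof (rule expos_1_eqI)
        show "\<beta> \<in> expos 1" using \<beta> fp unfolding polys_def by blast
        have "unit_weights 1 = [\<lambda>j. if j = 0 then 1 else 0]" unfolding unit_weights_def by simp
        then show "lk \<beta> 0 = lk 0 0"
          using lead(2)[OF \<beta>] True wdeg_unit[of 0 1 \<beta>] by simp
      qed simp
      then have "f = const (lk f 0)"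
        unfolding const_def by (intro poly_mapping_eqI) (auto simp: lookup_single when_def in_keys_iff)
      moreover have "lk t 0 = lk f 0" unfolding f(1) lead_term_def True by simp
      ultimately show ?thesis using f(2) by metis
    next
      case False
      then have "lk t 0 = 0" unfolding f(1) lead_term_def by (simp add: lookup_single when_def)
      then show ?thesis using submodD(1)[OF Is] by simp
    qed
    then have "const (lk c 0) * const (lk t 0) + const (lk p 0) \<in> I"
      by (intro submodD(2)[OF Is] submodD(3)[OF Is polys_const] rspan_step.IH)
    then show ?case by (simp add: lookup_add lookup_mult_0 const_add const_mult)
  qed
  have "\<not> fin_gen_ideal (mpoly_ring 1) (lead_ideal 1 lex_order I)"
  proof
    assume "fin_gen_ideal (mpoly_ring 1) (lead_ideal 1 lex_order I)"
    then have "fgm 1 (rspan 1 ?T)"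
      unfolding LT using fin_gen_ideal_iff_fgm[OF rspan_subset_polys[OF Tp]] by blast
    then obtain S where S: "finite S" "rspan 1 ?T = rspan 1 S" unfolding fgm_def by (elim exE conjE)
    have "finite (insert 0 ((\<lambda>s. lk s 0) ` S))" "insert 0 ((\<lambda>s. lk s 0) ` S) \<noteq> {}" using S(1) by auto
    then obtain d where d: "d \<in> insert 0 ((\<lambda>s. lk s 0) ` S)" "\<forall>x\<in>insert 0 ((\<lambda>s. lk s 0) ` S). d dvd x"
      using finite_common_divisor by blast
    have dI: "const d \<in> I"
    proof (cases "d = 0")
      case True
      then show ?thesis using submodD(1)[OF Is] by simp
    next
      case False
      then obtain s where "s \<in> S" "d = lk s 0" using d(1) by blast
      then show ?thesis using const_part[of s] S(2) rspan_base[of s S 1] by simp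
    qed
    have dvd_span: "d dvd lk p 0" if "p \<in> rspan 1 S" for p
      using that
    proof (induction p rule: rspan.induct)
      case (rspan_step c s p)
      then have "d dvd lk s 0" using d(2) by blast
      then show ?case using rspan_step.IH by (simp add: lookup_add lookup_mult_0)
    qed simp
    have dvd_I: "d dvd c" if c: "const c \<in> I" for c
    proof (cases "c = 0")
      case False
      then have c0: "const c \<noteq> 0" by simp
      have "lead_expo lex_order (const c) = 0"
        using lead_expo_props(1)[OF rep polys_const c0] unfolding const_def by (simp split: if_splits)
      then have "lead_term lex_order (const c) = const c" unfolding lead_term_def by (simp add: const_def)
      then have "const c \<in> rspan 1 ?T" using c c0 by (intro rspan_base) (metis (mono_tags, lifting) mem_Collect_eq)
      then have "d dvd lk (const c) 0" using dvd_span S(2) by blast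
      then show ?thesis by (simp add: const_def)
    qed simp
    have d0: "d \<noteq> 0" using dvd_I[OF aI] a by auto
    obtain k where "a dvd d * b ^ k" using from_I[OF dI] ..
    then obtain e where e: "d * b ^ k = a * e" by (rule dvdE)
    obtain a' where a': "a = b ^ Suc k * a'" using ba[of "Suc k"] by (rule dvdE)
    have "b ^ k * d = b ^ k * (b * (a' * e))" using e unfolding a' by (simp add: mult_ac)
    then have dd: "d = b * (a' * e)" using b0 by simp
    have "(a' * e) * b ^ Suc k = a * e" unfolding a' by (simp add: mult_ac)
    then have "a dvd (a' * e) * b ^ Suc k" by (rule dvdI)
    then have "const (a' * e) \<in> I" by (rule in_I)
    then have "d dvd a' * e" by (rule dvd_I)
    then have "b * d dvd b * (a' * e)" by (rule mult_dvd_mono[OF dvd_refl])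
    then have "b * d dvd 1 * d" unfolding dd[symmetric] mult_1 .
    then have "b dvd 1" unfolding dvd_mult_cancel_right using d0 by simp
    then show False using b by blast
  qed
  moreover have "ideal I (mpoly_ring 1)" unfolding ideal_iff_submod using Ip Is by blast
  moreover have "fin_gen_ideal (mpoly_ring 1) I" using Ifg unfolding fin_gen_ideal_iff_fgm[OF Ip] .
  ultimately show ?thesis by blast
qed

lemma lead_ideal_lex_fin_gen_imp_krull_dim_le_1:
  assumes "\<And>I :: 'a mpol set. ideal I (mpoly_ring 1) \<Longrightarrow> fin_gen_ideal (mpoly_ring 1) I \<Longrightarrow>
    fin_gen_ideal (mpoly_ring 1) (lead_ideal 1 lex_order I)"
  shows "krull_dim TYPE('a) \<le> 1"
proof (rule archimedean_imp_krull_dim_le_1, rule ccontr)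
  fix a b :: 'a
  assume ab: "a \<noteq> 0" "\<not> b dvd 1" "\<nexists>k. a dvd b ^ k"
  then have "b ^ k dvd a" for k using dvd_linear[of a "b ^ k"] by blast
  then show False using lead_ideal_lex_not_fin_gen[OF ab(1,2)] assms by blast
qed

end

theorem corollary4p1:
  assumes "valuation_ring TYPE('a::idom)"
  shows "(groebner_ring TYPE('a) \<longleftrightarrow> krull_dim TYPE('a) \<le> 1) \<and>
    (krull_dim TYPE('a) \<le> 1 \<longleftrightarrow>
      (\<forall>n\<ge>1. \<forall>ord. rational_monomial_order n ord \<longrightarrow>
        (\<forall>I :: 'a mpol set. ideal I (mpoly_ring n) \<and> fin_gen_ideal (mpoly_ring n) I \<longrightarrow>
          fin_gen_ideal (mpoly_ring n) (lead_ideal n ord I))))"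
proof -
  interpret valuation_domain "TYPE('a)" by unfold_locales (rule assms)
  have fin_gen: "fin_gen_ideal (mpoly_ring n) (lead_ideal n ord I)"
    if dim: "krull_dim TYPE('a) \<le> 1" and "weights_represent n ws ord" "ideal I (mpoly_ring n)" "fin_gen_ideal (mpoly_ring n) I"
    for n ws ord and I :: "'a mpol set"
  proof -
    interpret archimedean_valuation_domain "TYPE('a)"
      by unfold_locales (rule krull_dim_le_1_imp_archimedean[OF dim])
    show ?thesis by (rule lead_ideal_fin_gen[OF that(2-4)])
  qed
  have "groebner_ring TYPE('a)" if "krull_dim TYPE('a) \<le> 1"
    unfolding groebner_ring_def using fin_gen[OF that lex_order_weights] by blast
  moreover have "krull_dim TYPE('a) \<le> 1" if g: "groebner_ring TYPE('a)"
  proof (rule lead_ideal_lex_fin_gen_imp_krull_dim_le_1)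
    fix I :: "'a mpol set" assume "ideal I (mpoly_ring 1)" "fin_gen_ideal (mpoly_ring 1) I"
    then show "fin_gen_ideal (mpoly_ring 1) (lead_ideal 1 lex_order I)"
      using g unfolding groebner_ring_def by blast
  qed
  moreover have "fin_gen_ideal (mpoly_ring n) (lead_ideal n ord I)"
    if dim: "krull_dim TYPE('a) \<le> 1" and rat: "rational_monomial_order n ord" and I: "ideal I (mpoly_ring n)" "fin_gen_ideal (mpoly_ring n) I"
    for n ord and I :: "'a mpol set"
  proof -
    obtain ws where "weights_represent n ws ord" using rational_order_weights[OF rat] ..
    then show ?thesis using fin_gen[OF dim _ I] by blast
  qed
  moreover have "krull_dim TYPE('a) \<le> 1"
    if g: "\<forall>n\<ge>1. \<forall>ord. rational_monomial_order n ord \<longrightarrow>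
        (\<forall>I :: 'a mpol set. ideal I (mpoly_ring n) \<and> fin_gen_ideal (mpoly_ring n) I \<longrightarrow>
          fin_gen_ideal (mpoly_ring n) (lead_ideal n ord I))"
  proof (rule lead_ideal_lex_fin_gen_imp_krull_dim_le_1)
    fix I :: "'a mpol set" assume "ideal I (mpoly_ring 1)" "fin_gen_ideal (mpoly_ring 1) I"
    then show "fin_gen_ideal (mpoly_ring 1) (lead_ideal 1 lex_order I)"
      using g rational_monomial_order_lex_1 by blast
  qed
  ultimately show ?thesis by blast
qed

end
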